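(* Let $d_L$ be such that $d_L \geq (r_Lr_P - r_L + 1)r_P$. By $V$ we denote the (algebraic) set of all $L \in \bar{C}[x][\partial]$ of order $r_L$ and degree $\leq d_L$ such that the leading coefficient of $L$ does not vanish at $\alpha_1, \ldots, \alpha_{r_P}$. We consider two (algebraic) subsets in $V$ \begin{alignat*}1 X &= \bigl\{ L \in V \bigm| \text{$M(L)$ has an apparent singularity at $0$}\bigr\},\\ Y &= \bigl\{ L \in V \bigm| \text{$M(L)$ has an apparent singularity at $0$}\\[-2pt] &\hspace{50pt} \text{which is not removable at cost one} \bigr\}. \end{alignat*} Then, $\dim X > \dim Y$ as algebraic sets.
   Context: Let $C$ be a field of characteristic zero with algebraic closure $\bar C$, and $\partial x = x\partial+1$. Fix $P\in C[x,y]$ with $r_P=\deg_y P>1$, squarefree in $C(x)[y]$ and with no divisors in $\bar C[y]$. For an operator $L\in\bar C[x][\partial]$ of order $r_L$, $M(L)$ denotes the minimal operator $M$ with $M(f(g(x)))=0$ whenever $Lf=0$ and $P(x,g(x))=0$. A factor $p$ of the leading coefficient $\operatorname{lc}_\partial(M)$ is removable at cost $n$ if there is $Q\in \bar C(x)[\partial]$ of order at most $n$ with $QM\in \bar C[x][\partial]$ and $\gcd(\operatorname{lc}_\partial(QM),p)=1$. It is assumed that: (S1) $P(0,y)$ is a squarefree polynomial of degree $r_P$; (S2) $g(0)$ is not a singularity of $L$ for any root $g(x)$ of $P$; (G) the power series roots of $P(x,g(x))=0$ at zero are $g_i(x)=\alpha_i+\beta_i x+\gamma_i x^2+\ldots$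 ($1\le i\le r_P$), where $\beta_2,\ldots,\beta_{r_P}$ are nonzero and either $\beta_1$ or $\gamma_1$ is nonzero. Here $\alpha_i = g_i(0)$. *)

theory Defs
  imports "HOL-Computational_Algebra.Computational_Algebra"
          "HOL-Library.Extended_Real"
begin

text \<open>An operator  sum_i a_i D^i  with coefficients in a commutative ring carrying a derivation
  Dc is represented by the (commutative) polynomial  sum_i [:..:] with coefficient a_i at index i.
  Order = degree, leading coefficient = lead_coeff.  The (noncommutative) Ore product uses
  D^i b = sum_k (i choose k) Dc^k(b) D^(i-k).\<close>

definition op_mult :: "('a::comm_ring_1 \<Rightarrow> 'a) \<Rightarrow> 'a poly \<Rightarrow> 'a poly \<Rightarrow> 'a poly" where
  "op_mult Dc A B =
     (\<Sum>i\<le>degree A. \<Sum>j\<le>degree B. \<Sum>k\<le>i.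
        monom (coeff A i * of_nat (i choose k) * (Dc ^^ k) (coeff B j)) (i + j - k))"

definition fract_deriv :: "'k::field poly fract \<Rightarrow> 'k poly fract" where
  "fract_deriv r = (case (SOME (a, b). b \<noteq> 0 \<and> r = Fract a b) of (a, b) \<Rightarrow>
      Fract (pderiv a * b - a * pderiv b) (b * b))"

text \<open>Action of an operator with polynomial coefficients on a formal power series in (x - alpha):
  the coefficient p(x) is re-expanded as p(alpha + t).\<close>
definition op_apply_at :: "'k::field poly poly \<Rightarrow> 'k \<Rightarrow> 'k fps \<Rightarrow> 'k fps" where
  "op_apply_at L a f = (\<Sum>i\<le>degree L. fps_of_poly (pcompose (coeff L i) [:a, 1:]) * (fps_deriv ^^ i) f)"

definition is_ps_root :: "'k::field poly poly \<Rightarrow> 'k fps \<Rightarrow> bool" where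
  "is_ps_root P h \<longleftrightarrow> poly (map_poly fps_of_poly P) h = 0"

text \<open>M is (a normalized representative of) the minimal operator M(L): M in k[x][D], nonzero,
  with coprime coefficients, annihilating f(g(x)) for every power series root g of P and every
  (power series) solution f of L at g(0), and of minimal order among such nonzero operators.\<close>
definition annihilates_comp :: "'k::field_char_0 poly poly \<Rightarrow> 'k poly poly \<Rightarrow> 'k poly poly \<Rightarrow> bool" where
  "annihilates_comp P L M \<longleftrightarrow>
     (\<forall>h f. is_ps_root P h \<longrightarrow> op_apply_at L (h $ 0) f = 0 \<longrightarrow>
        op_apply_at M 0 (fps_compose f (h - fps_const (h $ 0))) = 0)"

definition is_min_op :: "'k::field_char_0 poly poly \<Rightarrow> 'k poly poly \<Rightarrow> 'k poly poly \<Rightarrow> bool" where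
  "is_min_op P L M \<longleftrightarrow> M \<noteq> 0 \<and> annihilates_comp P L M
     \<and> (\<forall>N. N \<noteq> 0 \<longrightarrow> annihilates_comp P L N \<longrightarrow> degree M \<le> degree N)
     \<and> (\<forall>q. (\<forall>i. q dvd coeff M i) \<longrightarrow> degree q = 0)"

definition apparent_sing_at0 :: "'k::field poly poly \<Rightarrow> bool" where
  "apparent_sing_at0 M \<longleftrightarrow> poly (lead_coeff M) 0 = 0 \<and>
     (\<exists>hs :: nat \<Rightarrow> 'k fps. (\<forall>i<degree M. op_apply_at M 0 (hs i) = 0) \<and>
        (\<forall>c. (\<Sum>i<degree M. fps_const (c i) * hs i) = 0 \<longrightarrow> (\<forall>i<degree M. c i = 0)))"

definition removable_at_cost :: "'k::field poly poly \<Rightarrow> 'k poly \<Rightarrow> nat \<Rightarrow> bool" where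
  "removable_at_cost M p n \<longleftrightarrow>
     (\<exists>Q :: 'k poly fract poly. degree Q \<le> n \<and>
        (\<exists>R :: 'k poly poly. op_mult fract_deriv Q (map_poly to_fract M) = map_poly to_fract R
            \<and> coprime (lead_coeff R) p))"

text \<open>Points of k^N are functions nat => k (only coordinates < N matter);
  polynomial functions in the coordinates 0..N-1.\<close>
inductive_set polyfun :: "nat \<Rightarrow> ((nat \<Rightarrow> 'k::comm_ring_1) \<Rightarrow> 'k) set" for N :: nat where
  pf_const: "(\<lambda>v. c) \<in> polyfun N"
| pf_var: "i < N \<Longrightarrow> (\<lambda>v. v i) \<in> polyfun N"
| pf_add: "f \<in> polyfun N \<Longrightarrow> g \<in> polyfun N \<Longrightarrow> (\<lambda>v. f v + g v) \<in> polyfun N"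
| pf_mult: "f \<in> polyfun N \<Longrightarrow> g \<in> polyfun N \<Longrightarrow> (\<lambda>v. f v * g v) \<in> polyfun N"

definition zclosed_in :: "nat \<Rightarrow> (nat \<Rightarrow> 'k::comm_ring_1) set \<Rightarrow> (nat \<Rightarrow> 'k) set \<Rightarrow> bool" where
  "zclosed_in N S T \<longleftrightarrow> (\<exists>F \<subseteq> polyfun N. T = {v \<in> S. \<forall>f\<in>F. f v = 0})"

definition zirreducible_in :: "nat \<Rightarrow> (nat \<Rightarrow> 'k::comm_ring_1) set \<Rightarrow> (nat \<Rightarrow> 'k) set \<Rightarrow> bool" where
  "zirreducible_in N S Z \<longleftrightarrow> Z \<noteq> {} \<and> zclosed_in N S Z \<and>
     (\<forall>A B. zclosed_in N S A \<longrightarrow> zclosed_in N S B \<longrightarrow> Z \<subseteq> A \<union> B \<longrightarrow> Z \<subseteq> A \<or> Z \<subseteq> B)"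

definition irr_chain :: "nat \<Rightarrow> (nat \<Rightarrow> 'k::comm_ring_1) set \<Rightarrow> nat \<Rightarrow> bool" where
  "irr_chain N S n \<longleftrightarrow> (\<exists>Z :: nat \<Rightarrow> (nat \<Rightarrow> 'k) set.
      (\<forall>k\<le>n. zirreducible_in N S (Z k)) \<and> (\<forall>k<n. Z k \<subset> Z (Suc k)))"

definition alg_dim :: "nat \<Rightarrow> (nat \<Rightarrow> 'k::comm_ring_1) set \<Rightarrow> ereal" where
  "alg_dim N S = (if S = {} then -1 else (SUP n \<in> {n. irr_chain N S n}. ereal (real n)))"

definition op_coords :: "nat \<Rightarrow> nat \<Rightarrow> 'k::zero poly poly \<Rightarrow> (nat \<Rightarrow> 'k)" where
  "op_coords rL dL L = (\<lambda>n. if n < (rL + 1) * (dL + 1)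
      then coeff (coeff L (n div (dL + 1))) (n mod (dL + 1)) else 0)"

definition op_dim :: "nat \<Rightarrow> nat \<Rightarrow> 'k::comm_ring_1 poly poly set \<Rightarrow> ereal" where
  "op_dim rL dL S = alg_dim ((rL + 1) * (dL + 1)) (op_coords rL dL ` S)"

end

theory Submission
  imports Defs "Jordan_Normal_Form.Determinant"
begin

text \<open>Write \<open>r = rL \<cdot> deg P\<close> and let \<open>W\<close> be the span of all compositions \<open>f \<circ> g\<^sub>i\<close>, with \<open>f\<close> a
  solution of \<open>L\<close> at \<open>\<alpha>\<^sub>i\<close>. Some operator of order at most \<open>r\<close> annihilates \<open>W\<close>. If the \<open>r\<close>
  generators of \<open>W\<close> are independent modulo \<open>x ^ (r + 1)\<close>, then \<open>M(L)\<close> has order \<open>r\<close>, it is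
  singular at 0 iff the generators are dependent modulo \<open>x ^ r\<close>, and the singularity is removable
  at cost one by adjoining to \<open>W\<close> a monomial with the missing exponent. So \<open>Y\<close> lies in the set of
  \<open>L\<close> for which the generators are dependent modulo \<open>x ^ (r + 1)\<close>, and \<open>X\<close> contains the rest of
  the hypersurface on which an \<open>r \<times> r\<close> determinant vanishes.

  Since \<open>dL\<close> is large, the Taylor coefficients of \<open>L\<close> at the points \<open>\<alpha>\<^sub>i\<close> up to order \<open>r - rL\<close> are
  independent coordinates. A relation modulo \<open>x ^ (r + 1)\<close> trades \<open>r - rL + 1\<close> of them for
  \<open>r - rL - 1\<close> coefficients of the relation, so \<open>Y\<close> has codimension at least two; and the
  determinant is affine in a single coordinate, so the hypersurface is parametrized by the others.\<close>

text \<open>\<open>alg_dim\<close> counts chains of irreducible relatively closed sets, and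
  membership in \<open>X\<close> or \<open>Y\<close> is not given by equations in the coefficients
  of L, so both bounds rest on parametrizations. A chain of length n provides n algebraically
  independent functions, whereas more than m functions always satisfy a relation on finitely many
  images of m parameters. This argument passes to subsets, so a set containing \<open>Y\<close>
  suffices. For \<open>X\<close> a chain is written down.

  The obstacle is branch 1, where \<beta> may vanish: composition with g_1 - \<alpha>_1 then loses
  coefficients and cannot be inverted up to a given order. Hence the solution to be eliminated, and
  the coordinate that is solved for, always belong to a branch i >= 2. The first branch only needs
  order at most two, which rules out relations that live on one branch alone.

  The bound on \<open>dL\<close> leaves room for Taylor coefficients of orders 0 to r - rL at all
  branch points. Polynomials built from the powers (x - \<alpha>_k)^(r - rL + 1) change them at one
  point without disturbing the others.\<close>

no_notation vec_index (infixl "$" 100)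

hide_const (open) Module.smult

text \<open>Fraction-free elimination: the pivot is multiplied in rather than divided out, so any
  integral domain will do. It is used over the field, over polynomials in x and over power
  series.\<close>

lemma homogeneous_system_nontrivial_solution:
  fixes a :: "'i \<Rightarrow> 'j \<Rightarrow> 'a::idom"
  assumes "finite J" "finite I" "card J < card I"
  shows "\<exists>m. (\<exists>i\<in>I. m i \<noteq> 0) \<and> (\<forall>j\<in>J. (\<Sum>i\<in>I. m i * a i j) = 0)"
  using assms
proof (induction J arbitrary: I a rule: finite_induct)
  case empty
  then obtain i where "i \<in> I" by fastforce
  then show ?case by (intro exI[of _ "\<lambda>_. 1"]) auto
next
  case (insert j J)
  show ?case
  proof (cases "\<forall>i\<in>I. a i j = 0")
    case True
    have "card J < card I" using insert by simp
    from insert.IH[OF insert.prems(1) this, of a] obtain m where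
      m: "\<exists>i\<in>I. m i \<noteq> 0" "\<forall>j\<in>J. (\<Sum>i\<in>I. m i * a i j) = 0" by blast
    have "(\<Sum>i\<in>I. m i * a i j) = 0" using True by (intro sum.neutral) auto
    with m show ?thesis by blast
  next
    case False
    then obtain k where k: "k \<in> I" "a k j \<noteq> 0" by blast
    define I' where "I' = I - {k}"
    have I': "finite I'" "I = insert k I'" "k \<notin> I'" using insert.prems k by (auto simp: I'_def)
    have "card J < card I'" using insert.prems insert.hyps I' by simp
    from insert.IH[OF I'(1) this, of "\<lambda>i l. a k j * a i l - a i j * a k l"] obtain m where
      m: "\<exists>i\<in>I'. m i \<noteq> 0" "\<forall>l\<in>J. (\<Sum>i\<in>I'. m i * (a k j * a i l - a i j * a k l)) = 0" by blast
    define m' where "m' = (\<lambda>i. if i = k then - (\<Sum>i\<in>I'. m i * a i j) else m i * a k j)"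
    have sm: "(\<Sum>i\<in>I. m' i * a i l) = (\<Sum>i\<in>I'. m i * (a k j * a i l - a i j * a k l))" for l
    proof -
      have "(\<Sum>i\<in>I. m' i * a i l) = m' k * a k l + (\<Sum>i\<in>I'. m' i * a i l)"
        using I' by simp
      also have "(\<Sum>i\<in>I'. m' i * a i l) = (\<Sum>i\<in>I'. m i * a k j * a i l)"
        using I' by (intro sum.cong) (auto simp: m'_def)
      also have "m' k * a k l + \<dots> = (\<Sum>i\<in>I'. m i * (a k j * a i l - a i j * a k l))"
        by (simp add: m'_def sum_distrib_left sum_subtractf algebra_simps)
      finally show ?thesis .
    qed
    have "(\<Sum>i\<in>I. m' i * a i l) = 0" if "l \<in> insert j J" for l
      using that m(2) unfolding sm by (auto simp: mult.commute)
    moreover have "\<exists>i\<in>I. m' i \<noteq> 0" using m(1) I' k by (auto simp: m'_def)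
    ultimately show ?thesis by blast
  qed
qed

section \<open>Polynomial functions\<close>

lemma polyfun_uminus: "f \<in> polyfun N \<Longrightarrow> (\<lambda>v. - f v) \<in> polyfun N"
  using pf_mult[OF pf_const[of "-1"], of f N] by simp

lemma polyfun_diff: "f \<in> polyfun N \<Longrightarrow> g \<in> polyfun N \<Longrightarrow> (\<lambda>v. f v - g v) \<in> polyfun N"
  using pf_add[OF _ polyfun_uminus, of f N g] by simp

lemma polyfun_sum: "(\<And>i. i \<in> A \<Longrightarrow> f i \<in> polyfun N) \<Longrightarrow> (\<lambda>v. \<Sum>i\<in>A. f i v) \<in> polyfun N"
  by (induction A rule: infinite_finite_induct) (auto intro: pf_const pf_add)

lemma polyfun_prod: "(\<And>i. i \<in> A \<Longrightarrow> f i \<in> polyfun N) \<Longrightarrow> (\<lambda>v. \<Prod>i\<in>A. f i v) \<in> polyfun N"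
  by (induction A rule: infinite_finite_induct) (auto intro: pf_const pf_mult)

lemma polyfun_power: "f \<in> polyfun N \<Longrightarrow> (\<lambda>v. f v ^ k) \<in> polyfun N"
  by (induction k) (auto intro: pf_const pf_mult)

lemma polyfun_comp:
  assumes "p \<in> polyfun n" "\<And>k. k < n \<Longrightarrow> h k \<in> polyfun N"
  shows "(\<lambda>v. p (\<lambda>k. h k v)) \<in> polyfun N"
  using assms by (induction rule: polyfun.induct) (auto intro: polyfun.intros)

lemma polyfun_cong:
  assumes "p \<in> polyfun n" "\<And>k. k < n \<Longrightarrow> u k = v k"
  shows "p u = p v"
  using assms by (induction rule: polyfun.induct) auto

lemma polyfun_on_line:
  fixes a b :: "nat \<Rightarrow> 'k::comm_ring_1"
  assumes "p \<in> polyfun n"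
  shows "\<exists>q. \<forall>s. p (\<lambda>k. a k + s * (b k - a k)) = poly q s"
  using assms
proof (induction rule: polyfun.induct)
  case (pf_const c)
  show ?case by (intro exI[of _ "[:c:]"]) simp
next
  case (pf_var i)
  show ?case by (intro exI[of _ "[:a i, b i - a i:]"]) simp
next
  case (pf_add f g)
  then obtain q1 q2 where "\<forall>s. f (\<lambda>k. a k + s * (b k - a k)) = poly q1 s"
    "\<forall>s. g (\<lambda>k. a k + s * (b k - a k)) = poly q2 s" by blast
  then show ?case by (intro exI[of _ "q1 + q2"]) simp
next
  case (pf_mult f g)
  then obtain q1 q2 where "\<forall>s. f (\<lambda>k. a k + s * (b k - a k)) = poly q1 s"
    "\<forall>s. g (\<lambda>k. a k + s * (b k - a k)) = poly q2 s" by blast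
  then show ?case by (intro exI[of _ "q1 * q2"]) simp
qed

text \<open>Stands in for the irreducibility of affine space: on the line from a to b both functions
  become nonzero univariate polynomials, which have finitely many roots. That the point lies on this
  line matters later, where it has to stay in an affine subspace.\<close>

lemma polyfun_common_nonzero:
  fixes a b :: "nat \<Rightarrow> 'k::field_char_0"
  assumes "p \<in> polyfun n" "q \<in> polyfun n" "p a \<noteq> 0" "q b \<noteq> 0"
  obtains s where "p (\<lambda>k. a k + s * (b k - a k)) \<noteq> 0" "q (\<lambda>k. a k + s * (b k - a k)) \<noteq> 0"
proof -
  obtain p' where p': "\<And>s. p (\<lambda>k. a k + s * (b k - a k)) = poly p' s"
    using polyfun_on_line[OF assms(1)] by blast
  obtain q' where q': "\<And>s. q (\<lambda>k. a k + s * (b k - a k)) = poly q' s"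
    using polyfun_on_line[OF assms(2)] by blast
  have "p' \<noteq> 0" using p'[of 0] assms by auto
  moreover have "q' \<noteq> 0" using q'[of 1] assms by auto
  ultimately have "p' * q' \<noteq> 0" by simp
  then have "finite {s. poly (p' * q') s = 0}" by (rule poly_roots_finite)
  then obtain s where "poly (p' * q') s \<noteq> 0"
    using infinite_UNIV_char_0[where 'a='k] by (metis (mono_tags, lifting) UNIV_eq_I mem_Collect_eq)
  then show ?thesis using that[of s] p' q' by auto
qed

section \<open>Polynomial functions of bounded degree\<close>

definition exps :: "nat \<Rightarrow> nat \<Rightarrow> (nat \<Rightarrow> nat) set" where
  "exps m C = ({..<m} \<rightarrow>\<^sub>E {..C})"

definition monfun :: "nat \<Rightarrow> (nat \<Rightarrow> nat) \<Rightarrow> (nat \<Rightarrow> 'k::comm_ring_1) \<Rightarrow> 'k" where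
  "monfun m e v = (\<Prod>k<m. v k ^ e k)"

text \<open>The degree is bounded in each variable separately, so \<open>(C + 1) ^ m\<close>
  monomials span these functions. This is the number used in the counting argument for algebraic
  relations.\<close>

definition bpolyfun :: "nat \<Rightarrow> nat \<Rightarrow> ((nat \<Rightarrow> 'k::comm_ring_1) \<Rightarrow> 'k) set" where
  "bpolyfun m C = {p. \<exists>c. \<forall>v. p v = (\<Sum>e\<in>exps m C. c e * monfun m e v)}"

lemma finite_exps: "finite (exps m C)"
  unfolding exps_def by (intro finite_PiE) auto

lemma card_exps: "card (exps m C) = (C + 1) ^ m"
  unfolding exps_def by (subst card_PiE) auto

lemma bpolyfun_monfun:
  assumes "\<And>k. k < m \<Longrightarrow> e k \<le> C"
  shows "monfun m e \<in> bpolyfun m C"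
proof -
  define e' where "e' = restrict e {..<m}"
  have e': "e' \<in> exps m C" using assms by (auto simp: e'_def exps_def)
  have "monfun m e v = (\<Sum>f\<in>exps m C. (if f = e' then 1 else 0) * monfun m f v)" for v :: "nat \<Rightarrow> 'a"
  proof -
    have "(\<Sum>f\<in>exps m C. (if f = e' then 1 else 0) * monfun m f v) =
       (\<Sum>f\<in>exps m C. (if f = e' then monfun m f v else 0))" by (intro sum.cong) auto
    also have "\<dots> = monfun m e' v" using e' finite_exps by simp
    also have "\<dots> = monfun m e v" by (auto simp: monfun_def e'_def intro!: prod.cong)
    finally show ?thesis ..
  qed
  then show ?thesis unfolding bpolyfun_def
    by (intro CollectI exI[of _ "\<lambda>f. if f = e' then 1 else 0"] allI)
qed

lemma bpolyfun_add: "p \<in> bpolyfun m C \<Longrightarrow> q \<in> bpolyfun m C \<Longrightarrow> (\<lambda>v. p v + q v) \<in> bpolyfun m C"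
  unfolding bpolyfun_def
proof clarify
  fix c d assume *: "\<forall>v. p v = (\<Sum>e\<in>exps m C. c e * monfun m e v)"
    "\<forall>v. q v = (\<Sum>e\<in>exps m C. d e * monfun m e v)"
  show "\<exists>c. \<forall>v. p v + q v = (\<Sum>e\<in>exps m C. c e * monfun m e v)"
    by (rule exI[of _ "\<lambda>e. c e + d e"]) (simp add: * sum.distrib algebra_simps)
qed

lemma bpolyfun_smult: "p \<in> bpolyfun m C \<Longrightarrow> (\<lambda>v. a * p v) \<in> bpolyfun m C"
  unfolding bpolyfun_def
proof clarify
  fix c assume *: "\<forall>v. p v = (\<Sum>e\<in>exps m C. c e * monfun m e v)"
  show "\<exists>c. \<forall>v. a * p v = (\<Sum>e\<in>exps m C. c e * monfun m e v)"
    by (rule exI[of _ "\<lambda>e. a * c e"]) (simp add: * sum_distrib_left algebra_simps)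
qed

lemma bpolyfun_0: "(\<lambda>v. 0) \<in> bpolyfun m C"
  unfolding bpolyfun_def by (auto intro: exI[of _ "\<lambda>_. 0"])

lemma bpolyfun_sum:
  "(\<And>i. i \<in> A \<Longrightarrow> f i \<in> bpolyfun m C) \<Longrightarrow> (\<lambda>v. \<Sum>i\<in>A. f i v) \<in> bpolyfun m C"
  by (induction A rule: infinite_finite_induct) (auto intro: bpolyfun_0 bpolyfun_add)

lemma bpolyfun_mult:
  assumes "p \<in> bpolyfun m C" "q \<in> bpolyfun m D"
  shows "(\<lambda>v. p v * q v) \<in> bpolyfun m (C + D)"
proof -
  obtain c d where c: "\<And>v. p v = (\<Sum>e\<in>exps m C. c e * monfun m e v)"
    and d: "\<And>v. q v = (\<Sum>f\<in>exps m D. d f * monfun m f v)"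
    using assms unfolding bpolyfun_def by blast
  have "(\<lambda>v. p v * q v) =
    (\<lambda>v. \<Sum>e\<in>exps m C. \<Sum>f\<in>exps m D. (c e * d f) * monfun m (\<lambda>k. e k + f k) v)"
    by (auto simp: c d sum_product monfun_def power_add prod.distrib algebra_simps intro!: sum.cong)
  also have "\<dots> \<in> bpolyfun m (C + D)"
    by (intro bpolyfun_sum bpolyfun_smult bpolyfun_monfun)
       (auto simp: exps_def PiE_def Pi_def intro: add_mono)
  finally show ?thesis .
qed

lemma bpolyfun_const: "(\<lambda>v. c) \<in> bpolyfun m C"
proof -
  have "(\<lambda>v. c) = (\<lambda>v. c * monfun m (\<lambda>_. 0) v)" by (simp add: monfun_def)
  also have "\<dots> \<in> bpolyfun m C" by (intro bpolyfun_smult bpolyfun_monfun) auto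
  finally show ?thesis .
qed

lemma bpolyfun_mono:
  assumes "p \<in> bpolyfun m C" "C \<le> D" shows "p \<in> bpolyfun m D"
  using bpolyfun_mult[OF assms(1) bpolyfun_const[of 1 m "D - C"]] assms(2) by simp

lemma bpolyfun_power: "p \<in> bpolyfun m C \<Longrightarrow> (\<lambda>v. p v ^ k) \<in> bpolyfun m (k * C)"
  by (induction k) (auto intro: bpolyfun_const bpolyfun_mult)

lemma bpolyfun_prod:
  "finite A \<Longrightarrow> (\<And>i. i \<in> A \<Longrightarrow> f i \<in> bpolyfun m C) \<Longrightarrow> (\<lambda>v. \<Prod>i\<in>A. f i v) \<in> bpolyfun m (card A * C)"
  by (induction A rule: finite_induct) (auto intro: bpolyfun_const bpolyfun_mult)

lemma polyfun_bounded:
  fixes p :: "(nat \<Rightarrow> 'k::comm_ring_1) \<Rightarrow> 'k"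
  assumes "p \<in> polyfun m" shows "\<exists>C. p \<in> bpolyfun m C"
  using assms
proof (induction rule: polyfun.induct)
  case (pf_const c) show ?case using bpolyfun_const by blast
next
  case (pf_var i)
  have "(\<lambda>v :: nat \<Rightarrow> 'k. v i) = monfun m (\<lambda>k. if k = i then 1 else 0)"
  proof
    fix v :: "nat \<Rightarrow> 'k"
    have "monfun m (\<lambda>k. if k = i then 1 else 0) v = (\<Prod>k<m. if k = i then v k else 1)"
      unfolding monfun_def by (intro prod.cong) auto
    then show "v i = monfun m (\<lambda>k. if k = i then 1 else 0) v" using pf_var by simp
  qed
  also have "\<dots> \<in> bpolyfun m 1" by (intro bpolyfun_monfun) auto
  finally show ?case by blast
next
  case (pf_add f g)
  then obtain C D where "f \<in> bpolyfun m C" "g \<in> bpolyfun m D" by blast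
  then have "f \<in> bpolyfun m (max C D)" "g \<in> bpolyfun m (max C D)" by (auto intro: bpolyfun_mono)
  then show ?case using bpolyfun_add by blast
next
  case (pf_mult f g)
  then show ?case using bpolyfun_mult by blast
qed

lemma polyfun_family_bounded:
  assumes "finite A" "\<And>i. i \<in> A \<Longrightarrow> f i \<in> polyfun m"
  shows "\<exists>C. \<forall>i\<in>A. f i \<in> bpolyfun m C"
  using assms
proof (induction A rule: finite_induct)
  case (insert a A)
  then obtain C where C: "\<forall>i\<in>A. f i \<in> bpolyfun m C" by blast
  obtain D where "f a \<in> bpolyfun m D" using insert polyfun_bounded by blast
  with C have "\<forall>i\<in>insert a A. f i \<in> bpolyfun m (max C D)" by (auto intro: bpolyfun_mono)
  then show ?case by blast
qed simp

section \<open>Rational functions in given parameters\<close>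

text \<open>Quotients of polynomials in the parameter vector \<open>t d\<close>, with one
  denominator valid on all of \<open>D\<close>. A point of \<open>D\<close> may carry more data than
  its parameters (later an operator together with a relation), and nothing is asked of the image of
  \<open>t\<close>.\<close>

definition ratfun :: "nat \<Rightarrow> ('d \<Rightarrow> nat \<Rightarrow> 'k::field_char_0) \<Rightarrow> 'd set \<Rightarrow> ('d \<Rightarrow> 'k) set" where
  "ratfun m t D = {f. \<exists>p\<in>polyfun m. \<exists>q\<in>polyfun m. \<forall>d\<in>D. q (t d) \<noteq> 0 \<and> f d * q (t d) = p (t d)}"

lemma ratfunI:
  assumes "p \<in> polyfun m" "q \<in> polyfun m" "\<And>d. d \<in> D \<Longrightarrow> q (t d) \<noteq> 0" "\<And>d. d \<in> D \<Longrightarrow> f d * q (t d) = p (t d)"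
  shows "f \<in> ratfun m t D"
  using assms unfolding ratfun_def by blast

lemma ratfunE:
  assumes "f \<in> ratfun m t D"
  obtains p q where "p \<in> polyfun m" "q \<in> polyfun m" "\<And>d. d \<in> D \<Longrightarrow> q (t d) \<noteq> 0"
    "\<And>d. d \<in> D \<Longrightarrow> f d * q (t d) = p (t d)"
  using assms unfolding ratfun_def by blast

lemma ratfun_polyfun: "p \<in> polyfun m \<Longrightarrow> (\<lambda>d. p (t d)) \<in> ratfun m t D"
  by (rule ratfunI[of p _ "\<lambda>_. 1"]) (auto intro: polyfun.intros)

lemma ratfun_const: "(\<lambda>_. c) \<in> ratfun m t D"
  using ratfun_polyfun[OF pf_const] by fastforce

lemma ratfun_var: "i < m \<Longrightarrow> (\<lambda>d. t d i) \<in> ratfun m t D"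
  using ratfun_polyfun[OF pf_var] by fastforce

lemma ratfun_mult:
  assumes "f \<in> ratfun m t D" "g \<in> ratfun m t D"
  shows "(\<lambda>d. f d * g d) \<in> ratfun m t D"
proof -
  obtain p q where 1: "p \<in> polyfun m" "q \<in> polyfun m" "\<And>d. d \<in> D \<Longrightarrow> q (t d) \<noteq> 0"
    "\<And>d. d \<in> D \<Longrightarrow> f d * q (t d) = p (t d)" using ratfunE[OF assms(1)] by blast
  obtain p' q' where 2: "p' \<in> polyfun m" "q' \<in> polyfun m" "\<And>d. d \<in> D \<Longrightarrow> q' (t d) \<noteq> 0"
    "\<And>d. d \<in> D \<Longrightarrow> g d * q' (t d) = p' (t d)" using ratfunE[OF assms(2)] by blast
  show ?thesis
    by (rule ratfunI[OF pf_mult[OF 1(1) 2(1)] pf_mult[OF 1(2) 2(2)]])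
       (auto simp: 1(3) 2(3) 1(4)[symmetric] 2(4)[symmetric])
qed

lemma ratfun_add:
  assumes "f \<in> ratfun m t D" "g \<in> ratfun m t D"
  shows "(\<lambda>d. f d + g d) \<in> ratfun m t D"
proof -
  obtain p q where 1: "p \<in> polyfun m" "q \<in> polyfun m" "\<And>d. d \<in> D \<Longrightarrow> q (t d) \<noteq> 0"
    "\<And>d. d \<in> D \<Longrightarrow> f d * q (t d) = p (t d)" using ratfunE[OF assms(1)] by blast
  obtain p' q' where 2: "p' \<in> polyfun m" "q' \<in> polyfun m" "\<And>d. d \<in> D \<Longrightarrow> q' (t d) \<noteq> 0"
    "\<And>d. d \<in> D \<Longrightarrow> g d * q' (t d) = p' (t d)" using ratfunE[OF assms(2)] by blast
  show ?thesis
    by (rule ratfunI[OF pf_add[OF pf_mult[OF 1(1) 2(2)] pf_mult[OF 2(1) 1(2)]] pf_mult[OF 1(2) 2(2)]])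
       (auto simp: 1(3) 2(3) 1(4)[symmetric] 2(4)[symmetric] algebra_simps)
qed

lemma ratfun_cong:
  assumes "g \<in> ratfun m t D" "\<And>d. d \<in> D \<Longrightarrow> f d = g d"
  shows "f \<in> ratfun m t D"
  using assms unfolding ratfun_def by auto

lemma ratfun_subset: "f \<in> ratfun m t D \<Longrightarrow> D' \<subseteq> D \<Longrightarrow> f \<in> ratfun m t D'"
  unfolding ratfun_def by blast

lemma ratfun_uminus: "f \<in> ratfun m t D \<Longrightarrow> (\<lambda>d. - f d) \<in> ratfun m t D"
  using ratfun_mult[OF ratfun_const[of "-1"], of f m t D] by simp

lemma ratfun_diff: "f \<in> ratfun m t D \<Longrightarrow> g \<in> ratfun m t D \<Longrightarrow> (\<lambda>d. f d - g d) \<in> ratfun m t D"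
  using ratfun_add[OF _ ratfun_uminus, of f m t D g] by simp

lemma ratfun_sum:
  "(\<And>i. i \<in> A \<Longrightarrow> f i \<in> ratfun m t D) \<Longrightarrow> (\<lambda>d. \<Sum>i\<in>A. f i d) \<in> ratfun m t D"
  by (induction A rule: infinite_finite_induct) (auto intro: ratfun_const ratfun_add)

lemma ratfun_prod:
  "(\<And>i. i \<in> A \<Longrightarrow> f i \<in> ratfun m t D) \<Longrightarrow> (\<lambda>d. \<Prod>i\<in>A. f i d) \<in> ratfun m t D"
  by (induction A rule: infinite_finite_induct) (auto intro: ratfun_const ratfun_mult)

lemma ratfun_inverse:
  assumes "f \<in> ratfun m t D" "\<And>d. d \<in> D \<Longrightarrow> f d \<noteq> 0"
  shows "(\<lambda>d. inverse (f d)) \<in> ratfun m t D"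
proof -
  obtain p q where 1: "p \<in> polyfun m" "q \<in> polyfun m" "\<And>d. d \<in> D \<Longrightarrow> q (t d) \<noteq> 0"
    "\<And>d. d \<in> D \<Longrightarrow> f d * q (t d) = p (t d)" using ratfunE[OF assms(1)] by blast
  show ?thesis
    by (rule ratfunI[OF 1(2) 1(1)]) (auto simp: 1(3) assms(2) 1(4)[symmetric])
qed

lemma ratfun_divide:
  assumes "f \<in> ratfun m t D" "g \<in> ratfun m t D" "\<And>d. d \<in> D \<Longrightarrow> g d \<noteq> 0"
  shows "(\<lambda>d. f d / g d) \<in> ratfun m t D"
  using ratfun_mult[OF assms(1) ratfun_inverse[OF assms(2,3)]] by (simp add: divide_inverse)

lemma ratfun_comp:
  assumes "h \<in> polyfun N" "\<And>i. i < N \<Longrightarrow> (\<lambda>d. \<phi> d i) \<in> ratfun m t D"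
  shows "(\<lambda>d. h (\<phi> d)) \<in> ratfun m t D"
  using assms by (induction rule: polyfun.induct) (auto intro: ratfun_const ratfun_add ratfun_mult)

lemma ratfun_common_denominator:
  fixes n :: nat
  assumes "\<And>k. k < n \<Longrightarrow> f k \<in> ratfun m t D"
  shows "\<exists>q\<in>polyfun m. \<exists>p. (\<forall>k<n. p k \<in> polyfun m) \<and>
    (\<forall>d\<in>D. q (t d) \<noteq> 0 \<and> (\<forall>k<n. f k d * q (t d) = p k (t d)))"
  using assms
proof (induction n)
  case 0 show ?case by (intro bexI[of _ "\<lambda>_. 1"]) (auto intro: polyfun.intros)
next
  case (Suc n)
  have "f k \<in> ratfun m t D" if "k < n" for k using Suc.prems that by simp
  from Suc.IH[OF this] obtain q p where 1: "q \<in> polyfun m" "\<forall>k<n. p k \<in> polyfun m"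
    "\<forall>d\<in>D. q (t d) \<noteq> 0 \<and> (\<forall>k<n. f k d * q (t d) = p k (t d))" by blast
  obtain p' q' where 2: "p' \<in> polyfun m" "q' \<in> polyfun m" "\<And>d. d \<in> D \<Longrightarrow> q' (t d) \<noteq> 0"
    "\<And>d. d \<in> D \<Longrightarrow> f n d * q' (t d) = p' (t d)" using ratfunE[OF Suc.prems[of n]] by blast
  define P where "P = (\<lambda>k v. if k = n then p' v * q v else p k v * q' v)"
  have "\<forall>k<Suc n. P k \<in> polyfun m" using 1 2 by (auto simp: P_def less_Suc_eq intro: pf_mult)
  moreover have "\<forall>d\<in>D. q (t d) * q' (t d) \<noteq> 0 \<and> (\<forall>k<Suc n. f k d * (q (t d) * q' (t d)) = P k (t d))"
    using 1(3) 2(3)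
    by (auto simp: P_def less_Suc_eq 2(4)[symmetric] mult_ac)
  ultimately show ?case using pf_mult[OF 1(1) 2(2)] by (intro bexI[of _ "\<lambda>v. q v * q' v"]) auto
qed

section \<open>Dimension\<close>

definition digit :: "nat \<Rightarrow> nat \<Rightarrow> nat \<Rightarrow> nat" where
  "digit b K k = K div b ^ k mod b"

lemma sum_digits: "b > 0 \<Longrightarrow> K < b ^ n \<Longrightarrow> (\<Sum>k<n. digit b K k * b ^ k) = K"
proof -
  assume b: "b > 0"
  have "(\<Sum>k<n. digit b K k * b ^ k) = K mod b ^ n" for K
    using b by (induction n) (auto simp: digit_def mod_mult2_eq[of _ "b ^ _" b] power_Suc2 simp del: power_Suc)
  then show "K < b ^ n \<Longrightarrow> ?thesis" by simp
qed

lemma digit_le: "digit (Suc d) K k \<le> d"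
  by (simp add: digit_def less_Suc_eq_le[symmetric])

text \<open>Counting: there are \<open>(d + 1) ^ n\<close> monomials in \<open>n\<close> of the functions with exponents at most
  \<open>d\<close>, but after clearing denominators they all lie in a space of dimension \<open>O(d ^ m)\<close>.
  The Kronecker substitution shows that the resulting relation is nontrivial.\<close>

lemma algebraic_relation_on_parametrized:
  fixes \<phi> :: "'i \<Rightarrow> 'd \<Rightarrow> nat \<Rightarrow> 'k::field_char_0"
  assumes I: "finite I" and mn: "m < n"
    and h: "\<And>k. k < n \<Longrightarrow> h k \<in> polyfun N"
    and \<phi>: "\<And>i l. i \<in> I \<Longrightarrow> l < N \<Longrightarrow> (\<lambda>d. \<phi> i d l) \<in> ratfun m (t i) (D i)"
  shows "\<exists>p\<in>polyfun n. (\<exists>u. p u \<noteq> 0) \<and> (\<forall>i\<in>I. \<forall>d\<in>D i. p (\<lambda>k. h k (\<phi> i d)) = 0)"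
proof -
  have "\<forall>i\<in>I. \<exists>q p. q \<in> polyfun m \<and> (\<forall>k<n. p k \<in> polyfun m) \<and>
    (\<forall>d\<in>D i. q (t i d) \<noteq> 0 \<and> (\<forall>k<n. h k (\<phi> i d) * q (t i d) = p k (t i d)))"
  proof
    fix i assume i: "i \<in> I"
    have "(\<lambda>d. h k (\<phi> i d)) \<in> ratfun m (t i) (D i)" if "k < n" for k
      by (rule ratfun_comp[OF h[OF that] \<phi>[OF i]])
    from ratfun_common_denominator[of n "\<lambda>k d. h k (\<phi> i d)", OF this]
    show "\<exists>q p. q \<in> polyfun m \<and> (\<forall>k<n. p k \<in> polyfun m) \<and>
      (\<forall>d\<in>D i. q (t i d) \<noteq> 0 \<and> (\<forall>k<n. h k (\<phi> i d) * q (t i d) = p k (t i d)))" by blast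
  qed
  then obtain q p where "\<forall>i\<in>I. q i \<in> polyfun m \<and> (\<forall>k<n. p i k \<in> polyfun m) \<and>
    (\<forall>d\<in>D i. q i (t i d) \<noteq> 0 \<and> (\<forall>k<n. h k (\<phi> i d) * q i (t i d) = p i k (t i d)))"
    unfolding bchoice_iff by blast
  then have q: "\<And>i. i \<in> I \<Longrightarrow> q i \<in> polyfun m"
    and p: "\<And>i k. i \<in> I \<Longrightarrow> k < n \<Longrightarrow> p i k \<in> polyfun m"
    and q0: "\<And>i d. i \<in> I \<Longrightarrow> d \<in> D i \<Longrightarrow> q i (t i d) \<noteq> 0"
    and pq: "\<And>i d k. i \<in> I \<Longrightarrow> d \<in> D i \<Longrightarrow> k < n \<Longrightarrow> h k (\<phi> i d) * q i (t i d) = p i k (t i d)"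
    by blast+
  obtain C1 where C1: "\<forall>i\<in>I. q i \<in> bpolyfun m C1" using polyfun_family_bounded[of I q m] I q by blast
  obtain C2 where C2: "\<forall>x\<in>I \<times> {..<n}. (\<lambda>(i,k). p i k) x \<in> bpolyfun m C2"
    using polyfun_family_bounded[of "I \<times> {..<n}" "\<lambda>(i,k). p i k" m] I p by auto
  define C where "C = max C1 C2"
  have Cq: "q i \<in> bpolyfun m C" if "i \<in> I" for i
    using that C1 by (auto simp: C_def intro: bpolyfun_mono)
  have Cp: "p i k \<in> bpolyfun m C" if "i \<in> I" "k < n" for i k
    using that C2 bpolyfun_mono[of "p i k" m C2 C] by (auto simp: C_def)
  \<comment> \<open>With this d the count closes: \<open>card I * ((n * C + 1) * Suc d) ^ m\<close>
    equals \<open>d * Suc d ^ m\<close>, which is less than \<open>Suc d ^ Suc m\<close> and so less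
    than \<open>Suc d ^ n\<close>.\<close>
  define d where "d = card I * (n * C + 1) ^ m"
  \<comment> \<open>The digits of K in base \<open>Suc d\<close> are an exponent vector.
    \<open>f K i\<close> is the corresponding monomial in the functions \<open>h k\<close>,
    multiplied by the power d * n of \<open>q i\<close>, which clears the denominators of all these
    monomials alike.\<close>
  define f where "f = (\<lambda>K i v. \<Prod>k<n. p i k v ^ digit (Suc d) K k * q i v ^ (d - digit (Suc d) K k))"
  have f: "f K i \<in> bpolyfun m (n * (d * C))" if "i \<in> I" for K i
  proof -
    have "(\<lambda>v. p i k v ^ digit (Suc d) K k * q i v ^ (d - digit (Suc d) K k)) \<in> bpolyfun m (d * C)"
      if "k < n" for k
      using bpolyfun_mult[OF bpolyfun_power[OF Cp[OF \<open>i \<in> I\<close> that]] bpolyfun_power[OF Cq[OF \<open>i \<in> I\<close>]],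
          of "digit (Suc d) K k" "d - digit (Suc d) K k"] digit_le[of d K k]
      by (simp add: add_mult_distrib[symmetric])
    then show ?thesis using bpolyfun_prod[of "{..<n}"] unfolding f_def by fastforce
  qed
  then have "\<forall>K. \<forall>i\<in>I. \<exists>c. \<forall>v. f K i v = (\<Sum>e\<in>exps m (n * (d * C)). c e * monfun m e v)"
    unfolding bpolyfun_def by blast
  then obtain c where c: "\<And>K i v. i \<in> I \<Longrightarrow> f K i v = (\<Sum>e\<in>exps m (n * (d * C)). c K i e * monfun m e v)"
    by metis
  have "card (I \<times> exps m (n * (d * C))) < card {..<(Suc d) ^ n}"
  proof -
    have "card (I \<times> exps m (n * (d * C))) = card I * (n * (d * C) + 1) ^ m"
      by (simp add: card_cartesian_product card_exps)
    also have "\<dots> \<le> card I * ((n * C + 1) * Suc d) ^ m"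
      by (intro mult_le_mono power_mono) (auto simp: algebra_simps)
    also have "\<dots> = d * Suc d ^ m"
      unfolding power_mult_distrib by (simp only: d_def mult.assoc[symmetric])
    also have "\<dots> < Suc d ^ Suc m" by simp
    also have "\<dots> \<le> Suc d ^ n" using mn by (intro power_increasing) auto
    finally show ?thesis by simp
  qed
  from homogeneous_system_nontrivial_solution[OF _ _ this, of "\<lambda>K (i,e). c K i e"]
  obtain a where a: "\<exists>K\<in>{..<(Suc d) ^ n}. a K \<noteq> 0"
    "\<And>i e. i \<in> I \<Longrightarrow> e \<in> exps m (n * (d * C)) \<Longrightarrow> (\<Sum>K<(Suc d) ^ n. a K * c K i e) = 0"
    using I finite_exps by fastforce
  define P where "P = (\<lambda>u :: nat \<Rightarrow> 'k. \<Sum>K<(Suc d) ^ n. a K * (\<Prod>k<n. u k ^ digit (Suc d) K k))"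
  have "P \<in> polyfun n"
    unfolding P_def by (intro polyfun_sum pf_mult pf_const polyfun_prod polyfun_power pf_var) auto
  moreover have "\<exists>u. P u \<noteq> 0"
  proof (rule ccontr)
    assume "\<nexists>u. P u \<noteq> 0"
    then have 0: "P (\<lambda>k. s ^ (Suc d ^ k)) = 0" for s by blast
    define \<pi> where "\<pi> = (\<Sum>K<(Suc d) ^ n. monom (a K) K)"
    have "poly \<pi> s = 0" for s
    proof -
      have "(\<Prod>k<n. (s ^ (Suc d ^ k)) ^ digit (Suc d) K k) = s ^ K" if "K < Suc d ^ n" for K
        using sum_digits[OF _ that]
        by (simp add: power_mult[symmetric] power_sum[symmetric] mult.commute del: power_Suc)
      then have "P (\<lambda>k. s ^ (Suc d ^ k)) = (\<Sum>K<(Suc d) ^ n. a K * s ^ K)"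
        unfolding P_def by (intro sum.cong) auto
      then show ?thesis using 0[of s] by (simp add: \<pi>_def poly_sum poly_monom)
    qed
    then have "\<pi> = 0" using poly_all_0_iff_0 by blast
    moreover have "coeff \<pi> K = a K" if "K < Suc d ^ n" for K
      using that by (simp add: \<pi>_def coeff_sum)
    ultimately show False using a(1) by (metis coeff_0 lessThan_iff)
  qed
  moreover have "P (\<lambda>k. h k (\<phi> i x)) = 0" if "i \<in> I" "x \<in> D i" for i x
  proof -
    have "P (\<lambda>k. h k (\<phi> i x)) * q i (t i x) ^ (d * n) = (\<Sum>K<(Suc d) ^ n. a K * f K i (t i x))"
    proof -
      have "(\<Prod>k<n. h k (\<phi> i x) ^ digit (Suc d) K k) * q i (t i x) ^ (d * n) = f K i (t i x)" for K
      proof -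
        have "(\<Prod>k<n. h k (\<phi> i x) ^ digit (Suc d) K k) * q i (t i x) ^ (d * n) =
          (\<Prod>k<n. h k (\<phi> i x) ^ digit (Suc d) K k * q i (t i x) ^ d)"
          by (simp add: prod.distrib power_mult)
        also have "\<dots> = f K i (t i x)" unfolding f_def
        proof (intro prod.cong refl)
          fix k assume "k \<in> {..<n}"
          then have k: "k < n" by simp
          have "q i (t i x) ^ d = q i (t i x) ^ digit (Suc d) K k * q i (t i x) ^ (d - digit (Suc d) K k)"
            using digit_le[of d K k] by (simp add: power_add[symmetric])
          then show "h k (\<phi> i x) ^ digit (Suc d) K k * q i (t i x) ^ d =
            p i k (t i x) ^ digit (Suc d) K k * q i (t i x) ^ (d - digit (Suc d) K k)"
            by (simp add: pq[OF that k, symmetric] power_mult_distrib)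
        qed
        finally show ?thesis .
      qed
      then show ?thesis unfolding P_def sum_distrib_right by (simp add: mult.assoc)
    qed
    also have "\<dots> = (\<Sum>e\<in>exps m (n * (d * C)). (\<Sum>K<(Suc d) ^ n. a K * c K i e) * monfun m e (t i x))"
      unfolding c[OF that(1)] sum_distrib_left sum_distrib_right
      by (subst sum.swap) (simp add: mult.assoc)
    also have "\<dots> = 0" by (simp add: a(2)[OF that(1)])
    finally show ?thesis using q0[OF that] by simp
  qed
  ultimately show ?thesis by blast
qed

text \<open>Lets the independence proof below treat a relation as a polynomial in the newest
  function. The coefficients still take the whole vector u but depend on its first n entries
  only.\<close>

lemma polyfun_expand_last:
  assumes "p \<in> polyfun (Suc n)"
  shows "\<exists>d c. (\<forall>a. c a \<in> polyfun n) \<and> (\<forall>u. p u = (\<Sum>a<d. c a u * u n ^ a))"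
proof -
  define S where "S = {p :: (nat \<Rightarrow> 'a) \<Rightarrow> 'a. \<exists>d c. (\<forall>a. c a \<in> polyfun n) \<and> (\<forall>u. p u = (\<Sum>a<d. c a u * u n ^ a))}"
  have mono: "\<exists>c. (\<forall>a. c a \<in> polyfun n) \<and> (\<forall>u. p u = (\<Sum>a<d'. c a u * u n ^ a))"
    if "\<forall>a. c a \<in> polyfun n" "\<forall>u. p u = (\<Sum>a<d. c a u * u n ^ a)" "d \<le> d'" for p d c d'
  proof (intro exI conjI allI)
    show "(\<lambda>v. if a < d then c a v else 0) \<in> polyfun n" for a
      using that by (cases "a < d") (auto intro: pf_const)
    show "p u = (\<Sum>a<d'. (if a < d then c a u else 0) * u n ^ a)" for u
    proof -
      have "(\<Sum>a<d'. (if a < d then c a u else 0) * u n ^ a) = (\<Sum>a<d. (if a < d then c a u else 0) * u n ^ a)"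
        using that by (intro sum.mono_neutral_right) auto
      then show ?thesis using that by simp
    qed
  qed
  have add: "(\<lambda>v. p v + q v) \<in> S" if pS: "p \<in> S" and qS: "q \<in> S" for p q
  proof -
    obtain d c where 1: "\<forall>a. c a \<in> polyfun n" "\<forall>u. p u = (\<Sum>a<d. c a u * u n ^ a)" using pS unfolding S_def by blast
    obtain d' c' where 2: "\<forall>a. c' a \<in> polyfun n" "\<forall>u. q u = (\<Sum>a<d'. c' a u * u n ^ a)" using qS unfolding S_def by blast
    obtain e where 3: "\<forall>a. e a \<in> polyfun n" "\<forall>u. p u = (\<Sum>a<max d d'. e a u * u n ^ a)"
      using mono[OF 1] by (metis max.cobounded1)
    obtain e' where 4: "\<forall>a. e' a \<in> polyfun n" "\<forall>u. q u = (\<Sum>a<max d d'. e' a u * u n ^ a)"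
      using mono[OF 2] by (metis max.cobounded2)
    show ?thesis unfolding S_def using 3 4
      by (intro CollectI exI[of _ "max d d'"] exI[of _ "\<lambda>a u. e a u + e' a u"])
         (auto intro: pf_add simp: sum.distrib algebra_simps)
  qed
  have S0: "(\<lambda>v. 0) \<in> S" unfolding S_def by (auto intro!: exI[of _ 0] exI[of _ "\<lambda>_ _. 0"] intro: pf_const)
  have sum: "(\<lambda>v. \<Sum>i\<in>A. f i v) \<in> S" if "\<And>i. i \<in> A \<Longrightarrow> f i \<in> S" for A :: "nat set" and f
    using that by (induction A rule: infinite_finite_induct) (auto intro: S0 add)
  have mon: "(\<lambda>u. b u * u n ^ k) \<in> S" if "b \<in> polyfun n" for b k
    unfolding S_def
  proof (intro CollectI exI[of _ "Suc k"] exI[of _ "\<lambda>a. if a = k then b else (\<lambda>_. 0)"] conjI allI)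
    show "(if a = k then b else (\<lambda>_. 0)) \<in> polyfun n" for a using that by (auto intro: pf_const)
    show "b u * u n ^ k = (\<Sum>a<Suc k. (if a = k then b else (\<lambda>_. 0)) u * u n ^ a)" for u
    proof -
      have "(\<Sum>a<Suc k. (if a = k then b else (\<lambda>_. 0)) u * u n ^ a) = (\<Sum>a<Suc k. if a = k then b u * u n ^ a else 0)"
        by (intro sum.cong) auto
      then show ?thesis by simp
    qed
  qed
  have mult: "(\<lambda>v. p v * q v) \<in> S" if pS: "p \<in> S" and qS: "q \<in> S" for p q
  proof -
    obtain d c where 1: "\<forall>a. c a \<in> polyfun n" "\<And>u. p u = (\<Sum>a<d. c a u * u n ^ a)" using pS unfolding S_def by blast
    obtain d' c' where 2: "\<forall>a. c' a \<in> polyfun n" "\<And>u. q u = (\<Sum>a<d'. c' a u * u n ^ a)" using qS unfolding S_def by blast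
    have "(\<lambda>v. p v * q v) = (\<lambda>u. \<Sum>a<d. \<Sum>b<d'. (c a u * c' b u) * u n ^ (a + b))"
      unfolding 1(2) 2(2) sum_product by (simp add: power_add mult_ac)
    also have "\<dots> \<in> S" using 1 2 by (intro sum mon pf_mult) auto
    finally show ?thesis .
  qed
  have "p \<in> S" using assms
  proof (induction rule: polyfun.induct)
    case (pf_const c) show ?case using mon[OF polyfun.pf_const[of c], of 0] by simp
  next
    case (pf_var i)
    show ?case
    proof (cases "i = n")
      case True then show ?thesis using mon[OF polyfun.pf_const[of 1], of 1] by simp
    next
      case False then show ?thesis using mon[OF polyfun.pf_var[of i n], of 0] pf_var by simp
    qed
  qed (auto intro: add mult)
  then show ?thesis unfolding S_def by blast
qed

text \<open>The zero sets of f and g cover Z, so one of them contains Z: functions on an irreducible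
  set form an integral domain.\<close>

lemma zirreducible_mult_zero:
  assumes "zirreducible_in N S Z" "f \<in> polyfun N" "g \<in> polyfun N" "\<And>v. v \<in> Z \<Longrightarrow> f v * g v = (0::'k::idom)"
    "v \<in> Z" "f v \<noteq> 0" "w \<in> Z"
  shows "g w = 0"
proof -
  have "zclosed_in N S {v \<in> S. f v = 0}" "zclosed_in N S {v \<in> S. g v = 0}"
    unfolding zclosed_in_def using assms by (intro exI[of _ "{f}"] exI[of _ "{g}"]; auto)+
  moreover have "Z \<subseteq> S" using assms(1) unfolding zirreducible_in_def zclosed_in_def by blast
  then have "Z \<subseteq> {v \<in> S. f v = 0} \<union> {v \<in> S. g v = 0}" using assms(4) by auto
  ultimately show ?thesis using assms unfolding zirreducible_in_def by blast
qed

text \<open>Expand a relation in powers of the last function \<open>h n\<close>. On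
  \<open>Z n\<close> only the constant coefficient survives, and it is zero by induction; on the
  irreducible \<open>Z (Suc n)\<close>, where \<open>h n\<close> is not identically zero, the
  remaining relation can be divided by \<open>h n\<close>. Repeating this kills every
  coefficient.\<close>

lemma irr_chain_algebraically_independent:
  fixes Z :: "nat \<Rightarrow> (nat \<Rightarrow> 'k::idom) set"
  assumes "\<And>k. k \<le> n \<Longrightarrow> zirreducible_in N S (Z k)"
    and "\<And>k. k < n \<Longrightarrow> Z k \<subseteq> Z (Suc k)"
    and "\<And>k. k < n \<Longrightarrow> h k \<in> polyfun N"
    and "\<And>k v. k < n \<Longrightarrow> v \<in> Z k \<Longrightarrow> h k v = 0"
    and "\<And>k. k < n \<Longrightarrow> \<exists>v\<in>Z (Suc k). h k v \<noteq> 0"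
    and "p \<in> polyfun n" "\<And>v. v \<in> Z n \<Longrightarrow> p (\<lambda>k. h k v) = 0"
  shows "p u = 0"
  using assms
proof (induction n arbitrary: p u)
  case 0
  obtain v where "v \<in> Z 0" using 0(1)[of 0] unfolding zirreducible_in_def by blast
  then have "p (\<lambda>k. h k v) = 0" using 0 by blast
  then show ?case using polyfun_cong[OF 0(6), of u "\<lambda>k. h k v"] by simp
next
  case (Suc n)
  obtain d c where c: "\<And>a. c a \<in> polyfun n" and pc: "\<And>u. p u = (\<Sum>a<d. c a u * u n ^ a)"
    using polyfun_expand_last[OF Suc.prems(6)] by blast
  have h: "h k \<in> polyfun N" if "k < Suc n" for k using Suc.prems(3) that .
  have sub: "Z n \<subseteq> Z (Suc n)" using Suc.prems(2) by blast
  have hZ: "h n v = 0" if "v \<in> Z n" for v using Suc.prems(4) that by blast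
  have irr: "zirreducible_in N S (Z (Suc n))" using Suc.prems(1) by blast
  have indep: "q w = 0" if "q \<in> polyfun n" "\<And>v. v \<in> Z n \<Longrightarrow> q (\<lambda>k. h k v) = 0" for q w
    by (rule Suc.IH) (use Suc.prems that in auto)
  obtain v0 where v0: "v0 \<in> Z (Suc n)" "h n v0 \<noteq> 0" using Suc.prems(5) by blast
  have "\<forall>v\<in>Z (Suc n). (\<Sum>a<d. c a (\<lambda>k. h k v) * h n v ^ a) = 0"
    using Suc.prems(7) pc by simp
  with c have "\<forall>a<d. \<forall>u. c a u = 0"
  proof (induction d arbitrary: c)
    case 0 then show ?case by simp
  next
    case (Suc d)
    define q where "q = (\<lambda>v. \<Sum>a<d. c (Suc a) (\<lambda>k. h k v) * h n v ^ a)"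
    have cN: "(\<lambda>v. c a (\<lambda>k. h k v)) \<in> polyfun N" for a
      using polyfun_comp[OF Suc.prems(1)] h by fastforce
    have q: "q \<in> polyfun N" unfolding q_def
      by (intro polyfun_sum pf_mult cN polyfun_power h) auto
    have split: "(\<Sum>a<Suc d. c a (\<lambda>k. h k v) * h n v ^ a) = c 0 (\<lambda>k. h k v) + h n v * q v" for v
      by (subst sum.lessThan_Suc_shift) (simp add: q_def sum_distrib_left mult_ac)
    have "c 0 (\<lambda>k. h k v) = 0" if "v \<in> Z n" for v
    proof -
      have "c 0 (\<lambda>k. h k v) + h n v * q v = 0" using Suc.prems(2) that sub split[of v] by force
      then show ?thesis using hZ[OF that] by simp
    qed
    then have c0: "c 0 u = 0" for u by (rule indep[OF Suc.prems(1)])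
    have "h n v * q v = 0" if "v \<in> Z (Suc n)" for v
    proof -
      have "c 0 (\<lambda>k. h k v) + h n v * q v = 0" using Suc.prems(2) that split[of v] by force
      then show ?thesis using c0 by simp
    qed
    then have "q v = 0" if "v \<in> Z (Suc n)" for v
      using zirreducible_mult_zero[OF irr h[of n] q _ v0 that] by simp
    then have "\<forall>a<d. \<forall>u. c (Suc a) u = 0"
      by (intro Suc.IH) (auto simp: q_def Suc.prems(1))
    with c0 show ?case by (auto simp: less_Suc_eq_0_disj)
  qed
  then show ?case by (simp add: pc)
qed

text \<open>Each strict inclusion in the chain supplies a function vanishing on the smaller set but
  not on the larger one. If n > m, these n functions would be independent on the top set and yet
  satisfy one relation on all pieces of the cover.\<close>

theorem irr_chain_length_le:
  fixes \<phi> :: "'i \<Rightarrow> 'd \<Rightarrow> nat \<Rightarrow> 'k::field_char_0"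
  assumes "finite I" "S \<subseteq> (\<Union>i\<in>I. \<phi> i ` D i)"
    and \<phi>: "\<And>i l. i \<in> I \<Longrightarrow> l < N \<Longrightarrow> (\<lambda>d. \<phi> i d l) \<in> ratfun m (t i) (D i)"
    and "irr_chain N S n"
  shows "n \<le> m"
proof (rule ccontr)
  assume "\<not> n \<le> m"
  then have mn: "m < n" by simp
  obtain Z where Z: "\<And>k. k \<le> n \<Longrightarrow> zirreducible_in N S (Z k)" "\<And>k. k < n \<Longrightarrow> Z k \<subset> Z (Suc k)"
    using assms(4) unfolding irr_chain_def by blast
  have ZS: "Z k \<subseteq> S" if "k \<le> n" for k
    using Z(1)[OF that] unfolding zirreducible_in_def zclosed_in_def by blast
  have "\<exists>f\<in>polyfun N. (\<forall>v\<in>Z k. f v = 0) \<and> (\<exists>v\<in>Z (Suc k). f v \<noteq> 0)" if k: "k < n" for k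
  proof -
    obtain F where F: "F \<subseteq> polyfun N" "Z k = {v \<in> S. \<forall>f\<in>F. f v = 0}"
      using Z(1)[of k] k unfolding zirreducible_in_def zclosed_in_def by auto
    obtain v where v: "v \<in> Z (Suc k)" "v \<notin> Z k" using Z(2)[OF k] by blast
    then have "v \<in> S" using ZS[of "Suc k"] k by auto
    with v F obtain f where "f \<in> F" "f v \<noteq> 0" by blast
    with F v show ?thesis by blast
  qed
  then obtain h where h: "\<And>k. k < n \<Longrightarrow> h k \<in> polyfun N" "\<And>k v. k < n \<Longrightarrow> v \<in> Z k \<Longrightarrow> h k v = 0"
    "\<And>k. k < n \<Longrightarrow> \<exists>v\<in>Z (Suc k). h k v \<noteq> 0" by metis
  obtain p u where p: "p \<in> polyfun n" "p u \<noteq> 0" "\<forall>i\<in>I. \<forall>d\<in>D i. p (\<lambda>k. h k (\<phi> i d)) = 0"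
    using algebraic_relation_on_parametrized[OF assms(1) mn, of h N \<phi> t D] h(1) \<phi> by blast
  have "p (\<lambda>k. h k v) = 0" if "v \<in> Z n" for v
    using that ZS[of n] assms(2) p(3) by blast
  then have "p u = 0"
    using irr_chain_algebraically_independent[of n N S Z h p] Z h p(1) by blast
  with p(2) show False by contradiction
qed

text \<open>The chain consists of the closures of the images of a flag of affine subspaces of the parameter space.\<close>

theorem irr_chain_of_open_parametrization:
  fixes \<phi> :: "(nat \<Rightarrow> 'k::field_char_0) \<Rightarrow> nat \<Rightarrow> 'k"
  assumes Q: "Q \<in> polyfun m" "Q a0 \<noteq> 0"
    and \<phi>: "\<And>l. l < N \<Longrightarrow> (\<lambda>u. \<phi> u l) \<in> ratfun m (\<lambda>u. u) {u. Q u \<noteq> 0}"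
    and \<phi>S: "\<And>u. Q u \<noteq> 0 \<Longrightarrow> \<phi> u \<in> S"
    and \<tau>: "\<And>k. k < m \<Longrightarrow> \<tau> k \<in> polyfun N"
    and \<tau>\<phi>: "\<And>k u. k < m \<Longrightarrow> Q u \<noteq> 0 \<Longrightarrow> \<tau> k (\<phi> u) = u k"
  shows "irr_chain N S m"
proof -
  define U where "U = (\<lambda>k. {u. Q u \<noteq> 0 \<and> (\<forall>j\<ge>k. u j = a0 j)})"
  define Z where "Z = (\<lambda>k. {v \<in> S. \<forall>f\<in>polyfun N. (\<forall>u\<in>U k. f (\<phi> u) = 0) \<longrightarrow> f v = 0})"
  have a0U: "a0 \<in> U k" for k using Q by (simp add: U_def)
  have UZ: "\<phi> u \<in> Z k" if "u \<in> U k" for u k using that \<phi>S by (auto simp: Z_def U_def)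
  have closed: "zclosed_in N S (Z k)" for k
    unfolding zclosed_in_def
    by (rule exI[of _ "{f \<in> polyfun N. \<forall>u\<in>U k. f (\<phi> u) = 0}"]) (auto simp: Z_def)
  have min: "Z k \<subseteq> A" if A: "zclosed_in N S A" "\<And>u. u \<in> U k \<Longrightarrow> \<phi> u \<in> A" for A k
    using A unfolding zclosed_in_def Z_def by blast
  have irr: "zirreducible_in N S (Z k)" for k
    unfolding zirreducible_in_def
  proof (intro conjI allI impI)
    show "Z k \<noteq> {}" using UZ a0U by blast
    show "zclosed_in N S (Z k)" by (rule closed)
    fix A B assume A: "zclosed_in N S A" and B: "zclosed_in N S B" and AB: "Z k \<subseteq> A \<union> B"
    show "Z k \<subseteq> A \<or> Z k \<subseteq> B"
    proof (rule ccontr)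
      assume "\<not> ?thesis"
      then obtain a b where a: "a \<in> U k" "\<phi> a \<notin> A" and b: "b \<in> U k" "\<phi> b \<notin> B"
        using min[OF A] min[OF B] by blast
      obtain f where f: "f \<in> polyfun N" "f (\<phi> a) \<noteq> 0" "\<And>v. v \<in> A \<Longrightarrow> f v = 0"
        using A a \<phi>S unfolding zclosed_in_def U_def by blast
      obtain g where g: "g \<in> polyfun N" "g (\<phi> b) \<noteq> 0" "\<And>v. v \<in> B \<Longrightarrow> g v = 0"
        using B b \<phi>S unfolding zclosed_in_def U_def by blast
      obtain p q where pq: "p \<in> polyfun m" "q \<in> polyfun m" "\<And>u. Q u \<noteq> 0 \<Longrightarrow> q u \<noteq> 0"
        "\<And>u. Q u \<noteq> 0 \<Longrightarrow> f (\<phi> u) * q u = p u"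
        by (rule ratfunE[OF ratfun_comp[where \<phi>=\<phi>, OF f(1) \<phi>]]) auto
      obtain p' q' where pq': "p' \<in> polyfun m" "q' \<in> polyfun m" "\<And>u. Q u \<noteq> 0 \<Longrightarrow> q' u \<noteq> 0"
        "\<And>u. Q u \<noteq> 0 \<Longrightarrow> g (\<phi> u) * q' u = p' u"
        by (rule ratfunE[OF ratfun_comp[where \<phi>=\<phi>, OF g(1) \<phi>]]) auto
      have Qa: "Q a \<noteq> 0" and Qb: "Q b \<noteq> 0" using a b by (auto simp: U_def)
      have 1: "p a * Q a \<noteq> 0" using Qa f(2) pq(3)[OF Qa] pq(4)[OF Qa, symmetric] by simp
      have 2: "p' b * Q b \<noteq> 0" using Qb g(2) pq'(3)[OF Qb] pq'(4)[OF Qb, symmetric] by simp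
      \<comment> \<open>Both witnesses lie in the affine subspace underlying \<open>U k\<close>,
        hence so does the line through them; the factor \<open>Q\<close> keeps the chosen point in
        the open set.\<close>
      obtain s where s: "p (\<lambda>k. a k + s * (b k - a k)) * Q (\<lambda>k. a k + s * (b k - a k)) \<noteq> 0"
          "p' (\<lambda>k. a k + s * (b k - a k)) * Q (\<lambda>k. a k + s * (b k - a k)) \<noteq> 0"
        using polyfun_common_nonzero[OF pf_mult[OF pq(1) Q(1)] pf_mult[OF pq'(1) Q(1)] 1 2] by blast
      define w where "w = (\<lambda>k. a k + s * (b k - a k))"
      have "w \<in> U k" using a b s by (auto simp: U_def w_def)
      then have "\<phi> w \<in> A \<union> B" using UZ AB by blast
      moreover have Qw: "Q w \<noteq> 0" using s by (simp add: w_def)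
      have "f (\<phi> w) \<noteq> 0" "g (\<phi> w) \<noteq> 0"
        using s pq(4)[OF Qw] pq'(4)[OF Qw] by (auto simp: w_def)
      then have "\<phi> w \<notin> A" "\<phi> w \<notin> B" using f(3) g(3) by blast+
      ultimately show False by blast
    qed
  qed
  have strict: "Z k \<subset> Z (Suc k)" if k: "k < m" for k
  proof
    have "U k \<subseteq> U (Suc k)" by (auto simp: U_def)
    then show "Z k \<subseteq> Z (Suc k)" unfolding Z_def by blast
    \<comment> \<open>The point b itself may violate \<open>Q u \<noteq> 0\<close>, so a suitable
      point is taken on the line from \<open>a0\<close> to b. The function \<open>\<tau> k\<close>
      reads off coordinate k and separates its image from \<open>Z k\<close>.\<close>
    define b where "b = a0(k := a0 k + 1)"
    have "(\<lambda>v. v k - a0 k) \<in> polyfun m" using k by (intro polyfun_diff pf_var pf_const)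
    from polyfun_common_nonzero[OF Q(1) this Q(2), of b]
    obtain s where s: "Q (\<lambda>l. a0 l + s * (b l - a0 l)) \<noteq> 0" "a0 k + s * (b k - a0 k) - a0 k \<noteq> 0"
      by (auto simp: b_def)
    define w where "w = (\<lambda>l. a0 l + s * (b l - a0 l))"
    have w: "w \<in> U (Suc k)" "w k \<noteq> a0 k" using s by (auto simp: w_def U_def b_def)
    define f where "f = (\<lambda>v. \<tau> k v - a0 k)"
    have "f \<in> polyfun N" unfolding f_def by (intro polyfun_diff \<tau> k pf_const)
    moreover have "f (\<phi> u) = 0" if "u \<in> U k" for u
      using that \<tau>\<phi>[OF k] by (auto simp: f_def U_def)
    moreover have "f (\<phi> w) \<noteq> 0" using w \<tau>\<phi>[OF k, of w] by (auto simp: f_def U_def)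
    ultimately have "\<phi> w \<notin> Z k" unfolding Z_def by blast
    then show "Z k \<noteq> Z (Suc k)" using UZ[OF w(1)] by blast
  qed
  show ?thesis unfolding irr_chain_def using irr strict by blast
qed

section \<open>Power series solutions\<close>

text \<open>The Taylor coefficient of order p at a of the coefficient of D^k in L. In these
  quantities the equation L f = 0 is a recurrence for the coefficients of f.\<close>

definition jet :: "'k::field poly poly \<Rightarrow> 'k \<Rightarrow> nat \<Rightarrow> nat \<Rightarrow> 'k" where
  "jet L a k p = coeff (pcompose (coeff L k) [:a, 1:]) p"

lemma jet_0: "jet L a k 0 = poly (coeff L k) a"
  unfolding jet_def by (metis poly_0_coeff_0 poly_pcompose poly_pCons poly_0 mult_zero_left add.right_neutral)

lemma op_apply_at_upto:
  "degree L \<le> n \<Longrightarrow> op_apply_at L a f = (\<Sum>i\<le>n. fps_of_poly (pcompose (coeff L i) [:a, 1:]) * (fps_deriv ^^ i) f)"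
  unfolding op_apply_at_def by (intro sum.mono_neutral_left) (auto simp: coeff_eq_0)

lemma fps_deriv_funpow_nth:
  "(fps_deriv ^^ k) f $ q = pochhammer (of_nat (q + 1)) k * (f :: 'k::field_char_0 fps) $ (q + k)"
proof (induction k arbitrary: f)
  case (Suc k)
  have "(fps_deriv ^^ Suc k) f $ q = (fps_deriv ^^ k) (fps_deriv f) $ q"
    by (simp add: funpow_swap1)
  also have "\<dots> = pochhammer (of_nat (q + 1)) (Suc k) * f $ (q + Suc k)"
    by (subst Suc.IH) (simp add: pochhammer_Suc algebra_simps)
  finally show ?case .
qed simp

lemma pochhammer_Suc_nonzero: "pochhammer (of_nat (Suc q)) k \<noteq> (0 :: 'k::field_char_0)"
proof
  assume "pochhammer (of_nat (Suc q)) k = (0::'k)"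
  then obtain i where "of_nat (Suc q) = - (of_nat i :: 'k)" unfolding pochhammer_eq_0_iff by blast
  then have "of_nat (Suc q + i) = (0::'k)" by (simp only: of_nat_add) simp
  then show False unfolding of_nat_eq_0_iff by simp
qed

lemma op_apply_at_nth:
  fixes L :: "'k::field_char_0 poly poly"
  assumes "degree L \<le> n"
  shows "op_apply_at L a F $ s = (\<Sum>k\<le>n. \<Sum>p\<le>s. jet L a k p * (pochhammer (of_nat (s - p + 1)) k * F $ (s - p + k)))"
  unfolding op_apply_at_upto[OF assms] fps_sum_nth fps_mult_nth fps_deriv_funpow_nth jet_def
    fps_of_poly_nth atLeast0AtMost ..

text \<open>In coefficient s of L F the top unknown \<open>F $ (s + r)\<close> occurs only with the
  index pair (r, 0). The remaining pairs, collected here, reach strictly lower coefficients of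
  F.\<close>

definition lower_terms :: "nat \<Rightarrow> nat \<Rightarrow> (nat \<times> nat) set" where
  "lower_terms r s = {..r} \<times> {..s} - {(r, 0)}"

lemma op_apply_at_nth_split:
  fixes L :: "'k::field_char_0 poly poly"
  assumes "degree L \<le> r"
  shows "op_apply_at L a F $ s = jet L a r 0 * (pochhammer (of_nat (s + 1)) r * F $ (s + r)) +
    (\<Sum>x\<in>lower_terms r s. jet L a (fst x) (snd x) * (pochhammer (of_nat (s - snd x + 1)) (fst x) * F $ (s - snd x + fst x)))"
proof -
  have "op_apply_at L a F $ s = (\<Sum>x\<in>{..r} \<times> {..s}. jet L a (fst x) (snd x) * (pochhammer (of_nat (s - snd x + 1)) (fst x) * F $ (s - snd x + fst x)))"
    unfolding op_apply_at_nth[OF assms] sum.cartesian_product by (simp add: case_prod_beta)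
  also have "\<dots> = jet L a r 0 * (pochhammer (of_nat (s + 1)) r * F $ (s + r)) +
    (\<Sum>x\<in>lower_terms r s. jet L a (fst x) (snd x) * (pochhammer (of_nat (s - snd x + 1)) (fst x) * F $ (s - snd x + fst x)))"
    unfolding lower_terms_def by (subst sum.remove[of _ "(r, 0)"]) auto
  finally show ?thesis .
qed

lemma lower_terms_less: "x \<in> lower_terms r s \<Longrightarrow> s - snd x + fst x < s + r"
  unfolding lower_terms_def by (cases x) auto

text \<open>With zero initial values the recurrence propagates zeros as long as the right-hand side
  vanishes, and the first nonzero right-hand side shows up undisturbed in the next coefficient. The
  second part later measures the effect of perturbing an operator.\<close>

lemma op_apply_at_truncated_unique:
  fixes L :: "'k::field_char_0 poly poly"
  assumes "degree L \<le> r" "jet L a r 0 \<noteq> 0" "\<And>m. m < r \<Longrightarrow> F $ m = 0"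
    "\<And>s. s < S \<Longrightarrow> op_apply_at L a F $ s = 0"
  shows "m < S + r \<Longrightarrow> F $ m = 0"
    and "jet L a r 0 * (pochhammer (of_nat (S + 1)) r * F $ (S + r)) = op_apply_at L a F $ S"
proof -
  have rest: "(\<Sum>x\<in>lower_terms r s. jet L a (fst x) (snd x) * (pochhammer (of_nat (s - snd x + 1)) (fst x) * F $ (s - snd x + fst x))) = 0"
    if "\<And>m. m < s + r \<Longrightarrow> F $ m = 0" for s
    using that lower_terms_less[of _ r s] by (intro sum.neutral) auto
  have zero: "m < S + r \<longrightarrow> F $ m = 0" for m
  proof (induction m rule: less_induct)
    case (less m)
    show ?case
    proof (cases "m < r")
      case False
      show ?thesis
      proof
        assume m: "m < S + r"
        define s where "s = m - r"
        have ms: "m = s + r" "s < S" using False m by (auto simp: s_def)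
        have "F $ l = 0" if "l < s + r" for l using less.IH[of l] that m ms by auto
        from rest[OF this] have "jet L a r 0 * (pochhammer (of_nat (s + 1)) r * F $ (s + r)) = 0"
          using op_apply_at_nth_split[OF assms(1), of a F s] assms(4)[OF ms(2)] by simp
        then show "F $ m = 0" using assms(2) pochhammer_Suc_nonzero[of s r, where 'k='k] by (simp add: ms)
      qed
    qed (use assms in simp)
  qed
  then show "m < S + r \<Longrightarrow> F $ m = 0" by blast
  show "jet L a r 0 * (pochhammer (of_nat (S + 1)) r * F $ (S + r)) = op_apply_at L a F $ S"
    using op_apply_at_nth_split[OF assms(1), of a F S] rest[of S] zero by simp
qed

lemma op_apply_at_unique:
  fixes L :: "'k::field_char_0 poly poly"
  assumes "degree L = r" "jet L a r 0 \<noteq> 0" "op_apply_at L a F = 0" "\<And>m. m < r \<Longrightarrow> F $ m = 0"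
  shows "F = 0"
proof (rule fps_ext)
  fix m
  show "F $ m = 0 $ m"
    using op_apply_at_truncated_unique(1)[of L r a F "Suc m" m] assms by simp
qed

text \<open>The recurrence solved for its top unknown and started from c. The quotient is meaningful
  when the leading coefficient of L does not vanish at a, the case in which it yields a
  solution.\<close>

function solseq :: "'k::field_char_0 poly poly \<Rightarrow> 'k \<Rightarrow> (nat \<Rightarrow> 'k) \<Rightarrow> nat \<Rightarrow> 'k" where
  "solseq L a c m = (if m < degree L then c m else
     - (\<Sum>x\<in>lower_terms (degree L) (m - degree L). jet L a (fst x) (snd x) *
         (pochhammer (of_nat (m - degree L - snd x + 1)) (fst x) * solseq L a c (m - degree L - snd x + fst x)))
     / (jet L a (degree L) 0 * pochhammer (of_nat (m - degree L + 1)) (degree L)))"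
  by auto
termination
proof (relation "measure (\<lambda>(L, a, c, m). m)", goal_cases)
  case (2 L a c m x)
  then show ?case using lower_terms_less[of x "degree L" "m - degree L"] by simp
qed simp

declare solseq.simps [simp del]

lemma op_apply_at_solseq:
  fixes L :: "'k::field_char_0 poly poly"
  assumes "jet L a (degree L) 0 \<noteq> 0"
  shows "op_apply_at L a (Abs_fps (solseq L a c)) = 0"
proof (rule fps_ext)
  fix s
  let ?r = "degree L"
  have eq: "solseq L a c (s + ?r) * (jet L a ?r 0 * pochhammer (of_nat (s + 1)) ?r) =
    - (\<Sum>x\<in>lower_terms ?r s. jet L a (fst x) (snd x) *
         (pochhammer (of_nat (s - snd x + 1)) (fst x) * solseq L a c (s - snd x + fst x)))"
    using assms pochhammer_Suc_nonzero[of s ?r, where 'k='k] by (subst solseq.simps) (simp add: field_simps)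
  then show "op_apply_at L a (Abs_fps (solseq L a c)) $ s = 0 $ s"
    by (subst op_apply_at_nth_split[OF order.refl]) (simp add: mult_ac)
qed

text \<open>Solving the recurrence divides only by the leading jet and a Pochhammer factor, both
  nonzero on \<open>D\<close>. Coefficients up to index n + r involve only jets up to order
  n.\<close>

lemma ratfun_solution_coeffs:
  fixes L :: "'d \<Rightarrow> 'k::field_char_0 poly poly"
  assumes deg: "\<And>d. d \<in> D \<Longrightarrow> degree (L d) \<le> r" and lc: "\<And>d. d \<in> D \<Longrightarrow> jet (L d) a r 0 \<noteq> 0"
    and sol: "\<And>d s. d \<in> D \<Longrightarrow> s \<le> n \<Longrightarrow> op_apply_at (L d) a (F d) $ s = 0"
    and jets: "\<And>k p. k \<le> r \<Longrightarrow> p \<le> n \<Longrightarrow> (\<lambda>d. jet (L d) a k p) \<in> ratfun m t D"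
    and init: "\<And>q. q < r \<Longrightarrow> (\<lambda>d. F d $ q) \<in> ratfun m t D"
  shows "q \<le> n + r \<Longrightarrow> (\<lambda>d. F d $ q) \<in> ratfun m t D"
proof (induction q rule: less_induct)
  case (less q)
  show ?case
  proof (cases "q < r")
    case False
    define s where "s = q - r"
    have q: "q = s + r" "s \<le> n" using False less.prems by (auto simp: s_def)
    define rest where "rest = (\<lambda>d. \<Sum>x\<in>lower_terms r s. jet (L d) a (fst x) (snd x) *
      (pochhammer (of_nat (s - snd x + 1)) (fst x) * F d $ (s - snd x + fst x)))"
    have "rest \<in> ratfun m t D" unfolding rest_def
    proof (intro ratfun_sum ratfun_mult ratfun_const)
      fix x assume x: "x \<in> lower_terms r s"
      then have "fst x \<le> r" "snd x \<le> n" using q by (auto simp: lower_terms_def)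
      then show "(\<lambda>d. jet (L d) a (fst x) (snd x)) \<in> ratfun m t D" by (rule jets)
      show "(\<lambda>d. F d $ (s - snd x + fst x)) \<in> ratfun m t D"
        using lower_terms_less[OF x] q by (intro less.IH) auto
    qed
    then have "(\<lambda>d. - rest d / (jet (L d) a r 0 * pochhammer (of_nat (s + 1)) r)) \<in> ratfun m t D"
      using lc pochhammer_Suc_nonzero[of s r, where 'k='k] jets
      by (intro ratfun_divide ratfun_uminus ratfun_mult ratfun_const) auto
    then show ?thesis
    proof (rule ratfun_cong)
      fix d assume d: "d \<in> D"
      have "jet (L d) a r 0 * (pochhammer (of_nat (s + 1)) r * F d $ (s + r)) + rest d = 0"
        using op_apply_at_nth_split[OF deg[OF d], of a "F d" s] sol[OF d q(2)] by (simp add: rest_def)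
      then show "F d $ q = - rest d / (jet (L d) a r 0 * pochhammer (of_nat (s + 1)) r)"
        using lc[OF d] pochhammer_Suc_nonzero[of s r, where 'k='k]
        by (simp add: q field_simps eq_neg_iff_add_eq_0)
    qed
  qed (rule init)
qed

lemma ratfun_compose_nth:
  assumes "\<And>i. i \<le> c \<Longrightarrow> (\<lambda>d. F d $ i) \<in> ratfun m t D"
  shows "(\<lambda>d. (F d oo u) $ c) \<in> ratfun m t D"
  unfolding fps_compose_nth using assms by (intro ratfun_sum ratfun_mult ratfun_const) auto

text \<open>Composition with u acts triangularly on coefficients, with the powers of
  \<open>u $ 1\<close> on the diagonal. So it can be undone with the same truncation order R; an
  inner series of order two would not permit this.\<close>

lemma ratfun_decompose_nth:
  fixes u :: "'k::field_char_0 fps"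
  assumes u: "u $ 0 = 0" "u $ 1 \<noteq> 0"
    and comp: "\<And>c. c < R \<Longrightarrow> (\<lambda>d. (F d oo u) $ c) \<in> ratfun m t D"
  shows "q < R \<Longrightarrow> (\<lambda>d. F d $ q) \<in> ratfun m t D"
proof (induction q rule: less_induct)
  case (less q)
  have "(\<lambda>d. ((F d oo u) $ q - (\<Sum>i<q. F d $ i * (u ^ i) $ q)) / (u $ 1) ^ q) \<in> ratfun m t D"
    using less u by (intro ratfun_divide ratfun_diff comp ratfun_sum ratfun_mult ratfun_const) auto
  then show ?case
  proof (rule ratfun_cong)
    fix d
    have "(F d oo u) $ q = (\<Sum>i<q. F d $ i * (u ^ i) $ q) + F d $ q * (u $ 1) ^ q"
      using startsby_zero_power_nth_same[OF u(1), of q]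
      by (simp add: fps_compose_nth atLeast0AtMost lessThan_Suc_atMost[symmetric])
    then show "F d $ q = ((F d oo u) $ q - (\<Sum>i<q. F d $ i * (u ^ i) $ q)) / (u $ 1) ^ q"
      using u by simp
  qed
qed

text \<open>Orders multiply under composition: at index \<open>j * subdegree u\<close> the terms
  below j vanish by assumption and those above j start too late.\<close>

lemma fps_compose_leading_nth:
  fixes F u :: "'k::field_char_0 fps"
  assumes "F $ j \<noteq> 0" "\<And>i. i < j \<Longrightarrow> F $ i = 0" "subdegree u > 0"
  shows "(F oo u) $ (j * subdegree u) \<noteq> 0"
proof -
  have "(F oo u) $ (j * subdegree u) = (\<Sum>i\<in>{0..j * subdegree u}. F $ i * (u ^ i) $ (j * subdegree u))"
    by (rule fps_compose_nth)
  also have "\<dots> = (\<Sum>i\<in>{j}. F $ i * (u ^ i) $ (j * subdegree u))"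
  proof (rule sum.mono_neutral_right)
    show "\<forall>i\<in>{0..j * subdegree u} - {j}. F $ i * (u ^ i) $ (j * subdegree u) = 0"
    proof
      fix i assume i: "i \<in> {0..j * subdegree u} - {j}"
      show "F $ i * (u ^ i) $ (j * subdegree u) = 0"
      proof (cases "i < j")
        case False
        then have "j * subdegree u < subdegree (u ^ i)" using i assms by simp
        then have "(u ^ i) $ (j * subdegree u) = 0" by (rule nth_less_subdegree_zero)
        then show ?thesis by simp
      qed (use assms in simp)
    qed
  qed (use assms in auto)
  also have "\<dots> \<noteq> 0"
    using assms nth_subdegree_nonzero[of "u ^ j"] by (auto simp: subdegree_power)
  finally show ?thesis .
qed

section \<open>The solution space of an operator\<close>

lemma fps_wronskian_zero:
  fixes a b :: "'k::field_char_0 fps"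
  assumes "fps_deriv a * b = a * fps_deriv b" "b \<noteq> 0"
  shows "\<exists>c. a = fps_const c * b"
proof -
  define e where "e = subdegree b"
  \<comment> \<open>Chosen to cancel the coefficient of index e, so that w, if nonzero, has an order
    different from that of b.\<close>
  define c where "c = a $ e / b $ e"
  define w where "w = a - fps_const c * b"
  have be: "b $ e \<noteq> 0" using assms(2) by (simp add: e_def)
  have w0: "w $ e = 0" using be by (simp add: w_def c_def)
  have wd: "fps_deriv w * b = w * fps_deriv b" using assms(1) by (simp add: w_def algebra_simps)
  have "w = 0"
  proof (rule ccontr)
    assume w: "w \<noteq> 0"
    define f where "f = subdegree w"
    have wf: "w $ f \<noteq> 0" using w by (simp add: f_def)
    have fe: "f \<noteq> e" using wf w0 by auto
    \<comment> \<open>Multiplying by X turns the derivative into the Euler operator, which keeps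
      orders. Comparing lowest coefficients at f + e then gives (f - e) * w_f * b_e = 0.\<close>
    have wd': "(fps_X * fps_deriv w) * b = w * (fps_X * fps_deriv b)" using wd by (simp add: mult_ac)
    have X: "(fps_X * fps_deriv g) $ k = of_nat k * g $ k" for g :: "'k fps" and k
      by (cases k) simp_all
    have l: "(p * q) $ (f + e) = p $ f * q $ e" if p: "\<And>k. k < f \<Longrightarrow> p $ k = 0" and q: "\<And>k. k < e \<Longrightarrow> q $ k = 0"
      for p q :: "'k fps"
    proof -
      have "(p * q) $ (f + e) = (\<Sum>i\<in>{0..f + e}. p $ i * q $ (f + e - i))" by (rule fps_mult_nth)
      also have "\<dots> = (\<Sum>i\<in>{f}. p $ i * q $ (f + e - i))"
      proof (rule sum.mono_neutral_right)
        show "\<forall>i\<in>{0..f + e} - {f}. p $ i * q $ (f + e - i) = 0"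
        proof
          fix i assume "i \<in> {0..f + e} - {f}"
          then have "i < f \<or> f + e - i < e" by auto
          then show "p $ i * q $ (f + e - i) = 0" using p q by auto
        qed
      qed auto
      finally show ?thesis by simp
    qed
    have wlow: "w $ k = 0" if "k < f" for k using that unfolding f_def by (rule nth_less_subdegree_zero)
    have blow: "b $ k = 0" if "k < e" for k using that unfolding e_def by (rule nth_less_subdegree_zero)
    have "((fps_X * fps_deriv w) * b) $ (f + e) = of_nat f * w $ f * b $ e"
      using l[of "fps_X * fps_deriv w" b] unfolding X using wlow blow by simp
    moreover have "(w * (fps_X * fps_deriv b)) $ (f + e) = w $ f * (of_nat e * b $ e)"
      using l[of w "fps_X * fps_deriv b"] unfolding X using wlow blow by simp
    ultimately have "of_nat f * w $ f * b $ e = w $ f * (of_nat e * b $ e)"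
      unfolding wd' by (rule trans[OF sym])
    then have "(of_nat f - of_nat e) * (w $ f * b $ e) = 0"
      by (simp add: algebra_simps)
    then show False using wf be fe by simp
  qed
  then show ?thesis by (auto simp: w_def)
qed

text \<open>A minimal relation over the ring of power series between the vectors
  \<open>(F, F', \<dots>)\<close> has, up to a common factor, constant coefficients: its derivative is again a relation.\<close>

lemma solutions_linearly_dependent:
  fixes M :: "'k::field_char_0 poly poly"
  assumes M: "M \<noteq> 0" and I: "finite I" "card I > degree M"
    and sol: "\<And>i. i \<in> I \<Longrightarrow> op_apply_at M 0 (F i) = 0"
  shows "\<exists>c. (\<exists>i\<in>I. c i \<noteq> 0) \<and> (\<Sum>i\<in>I. fps_const (c i) * F i) = 0"
proof -
  let ?d = "degree M"
  define rel where "rel = (\<lambda>a. \<forall>s<?d. (\<Sum>i\<in>I. a i * (fps_deriv ^^ s) (F i)) = 0)"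
  define supp where "supp = (\<lambda>a :: _ \<Rightarrow> 'k fps. {i\<in>I. a i \<noteq> 0})"
  have "\<exists>a. supp a \<noteq> {} \<and> rel a"
    using homogeneous_system_nontrivial_solution[of "{..<?d}" I "\<lambda>i s. (fps_deriv ^^ s) (F i)"] I
    unfolding supp_def rel_def by auto
  then obtain a where a: "supp a \<noteq> {}" "rel a"
    and min: "\<And>b. supp b \<noteq> {} \<Longrightarrow> rel b \<Longrightarrow> card (supp a) \<le> card (supp b)"
    using exists_least_iff[of "\<lambda>n. \<exists>a. supp a \<noteq> {} \<and> rel a \<and> card (supp a) = n"]
    by (metis (mono_tags, lifting) not_less)
  \<comment> \<open>The relation is imposed on derivatives of order below \<open>degree M\<close>
    only; the equations M F = 0 extend it to order \<open>degree M\<close>, so that it can be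
    differentiated.\<close>
  have top: "(\<Sum>i\<in>I. a i * (fps_deriv ^^ ?d) (F i)) = 0"
  proof -
    define m where "m = (\<lambda>s. fps_of_poly (coeff M s))"
    have "0 = (\<Sum>i\<in>I. a i * op_apply_at M 0 (F i))" using sol by simp
    also have "\<dots> = (\<Sum>s\<le>?d. m s * (\<Sum>i\<in>I. a i * (fps_deriv ^^ s) (F i)))"
      unfolding op_apply_at_def sum_distrib_left by (subst sum.swap) (simp add: m_def mult_ac)
    also have "\<dots> = m ?d * (\<Sum>i\<in>I. a i * (fps_deriv ^^ ?d) (F i))"
      using a(2) unfolding rel_def by (subst lessThan_Suc_atMost[symmetric]) simp
    finally show ?thesis using M by (simp add: m_def fps_of_poly_eq_iff[of _ 0, simplified])
  qed
  have rel': "rel (\<lambda>i. fps_deriv (a i))"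
    unfolding rel_def
  proof (intro allI impI)
    fix s assume s: "s < ?d"
    have "(\<Sum>i\<in>I. a i * (fps_deriv ^^ Suc s) (F i)) = 0"
      using a(2) top s unfolding rel_def by (cases "Suc s = ?d") (auto simp del: funpow.simps)
    moreover have "fps_deriv (\<Sum>i\<in>I. a i * (fps_deriv ^^ s) (F i)) = 0"
      using a(2) s unfolding rel_def by simp
    ultimately show "(\<Sum>i\<in>I. fps_deriv (a i) * (fps_deriv ^^ s) (F i)) = 0"
      by (simp add: fps_deriv_sum sum.distrib)
  qed
  obtain k where k: "k \<in> I" "a k \<noteq> 0" using a(1) by (auto simp: supp_def)
  \<comment> \<open>The combination of the relation and its derivative that eliminates index k. By
    minimality of the support it is zero, which says that the Wronskians of \<open>a i\<close> and
    \<open>a k\<close> vanish.\<close>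
  define b where "b = (\<lambda>i. fps_deriv (a i) * a k - a i * fps_deriv (a k))"
  have "rel b" unfolding rel_def
  proof (intro allI impI)
    fix s assume s: "s < ?d"
    have "(\<Sum>i\<in>I. b i * (fps_deriv ^^ s) (F i)) =
      a k * (\<Sum>i\<in>I. fps_deriv (a i) * (fps_deriv ^^ s) (F i)) - fps_deriv (a k) * (\<Sum>i\<in>I. a i * (fps_deriv ^^ s) (F i))"
      by (simp add: b_def sum_distrib_left sum_subtractf[symmetric] algebra_simps)
    then show "(\<Sum>i\<in>I. b i * (fps_deriv ^^ s) (F i)) = 0" using rel' a(2) s by (simp add: rel_def)
  qed
  moreover have "supp b \<subset> supp a"
  proof -
    have "supp b \<subseteq> supp a" by (auto simp: supp_def b_def)
    moreover have "k \<in> supp a" "k \<notin> supp b" using k by (auto simp: supp_def b_def)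
    ultimately show ?thesis by blast
  qed
  then have "card (supp b) < card (supp a)" using I by (intro psubset_card_mono) (auto simp: supp_def)
  ultimately have "supp b = {}" using min by (meson leD)
  then have "\<exists>c. a i = fps_const c * a k" if "i \<in> I" for i
    using that k by (intro fps_wronskian_zero) (auto simp: supp_def b_def)
  then obtain c where c: "\<And>i. i \<in> I \<Longrightarrow> a i = fps_const (c i) * a k" by metis
  have "c k \<noteq> 0" using c[OF k(1)] k(2) by auto
  moreover have "(\<Sum>i\<in>I. fps_const (c i) * F i) = 0"
  \<comment> \<open>For order 0 the condition \<open>rel\<close> is vacuous, so the relation has to
    come from M F = 0, which then forces every \<open>F i\<close> to vanish.\<close>
  proof (cases "?d = 0")
    case True
    have "F i = 0" if "i \<in> I" for i
    proof -
      have "fps_of_poly (coeff M 0) * F i = 0" using sol[OF that] True by (simp add: op_apply_at_def)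
      moreover have "coeff M 0 \<noteq> 0" using M True by (metis leading_coeff_0_iff)
      ultimately show ?thesis by (simp add: fps_of_poly_eq_iff[of _ 0, simplified])
    qed
    then show ?thesis by simp
  next
    case False
    have "a k * (\<Sum>i\<in>I. fps_const (c i) * F i) = (\<Sum>i\<in>I. a i * (fps_deriv ^^ 0) (F i))"
      unfolding sum_distrib_left by (intro sum.cong refl) (simp add: c mult_ac)
    also have "\<dots> = 0" using a(2)[unfolded rel_def, rule_format, of 0] False by simp
    finally show ?thesis using k by simp
  qed
  ultimately show ?thesis using k(1) by blast
qed

text \<open>If the leading coefficient vanished at 0, the constant term of M F = 0 would be one
  linear condition on the first \<open>degree M\<close> coefficients of each solution, nontrivial
  because \<open>coeff M k\<close> survives at 0. But \<open>degree M\<close> solutions independent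
  modulo \<open>x ^ degree M\<close> satisfy no such common condition.\<close>

lemma lead_coeff_nonzero_at_0:
  fixes M :: "'k::field_char_0 poly poly"
  assumes I: "finite I" "card I = degree M"
    and sol: "\<And>i. i \<in> I \<Longrightarrow> op_apply_at M 0 (F i) = 0"
    and indep: "\<And>c. (\<And>s. s < degree M \<Longrightarrow> (\<Sum>i\<in>I. c i * F i $ s) = 0) \<Longrightarrow> (\<forall>i\<in>I. c i = 0)"
    and nz: "poly (coeff M k) 0 \<noteq> 0"
  shows "poly (lead_coeff M) 0 \<noteq> 0"
proof
  let ?d = "degree M"
  assume lc: "poly (lead_coeff M) 0 = 0"
  define y where "y = (\<lambda>s. poly (coeff M s) 0 * fact s)"
  have y: "(\<Sum>s<?d. y s * F i $ s) = 0" if "i \<in> I" for i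
  proof -
    have "0 = op_apply_at M 0 (F i) $ 0" using sol[OF that] by simp
    also have "\<dots> = (\<Sum>s\<le>?d. y s * F i $ s)"
      by (subst op_apply_at_nth[OF order.refl]) (simp add: y_def jet_0 pochhammer_fact mult_ac)
    also have "\<dots> = (\<Sum>s<?d. y s * F i $ s)"
      using lc by (simp add: lessThan_Suc_atMost[symmetric] y_def)
    finally show ?thesis by simp
  qed
  have "k \<le> ?d" using nz by (metis coeff_eq_0 linorder_not_le poly_0)
  moreover have "k \<noteq> ?d" using nz lc by auto
  ultimately have k: "k < ?d" by simp
  have yk: "y k \<noteq> 0" using nz by (simp add: y_def)
  \<comment> \<open>Kills all coefficients of a combination except number k, one condition fewer
    than there are solutions. The functional y, nonzero at k, then kills that one too.\<close>
  have "card ({..<?d} - {k}) < card I" using k I by simp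
  from homogeneous_system_nontrivial_solution[OF _ I(1) this, of "\<lambda>i s. F i $ s"]
  obtain c where c: "\<exists>i\<in>I. c i \<noteq> 0" "\<forall>s\<in>{..<?d} - {k}. (\<Sum>i\<in>I. c i * F i $ s) = 0" by auto
  have "0 = (\<Sum>i\<in>I. c i * (\<Sum>s<?d. y s * F i $ s))" using y by simp
  also have "\<dots> = (\<Sum>s<?d. y s * (\<Sum>i\<in>I. c i * F i $ s))"
    unfolding sum_distrib_left by (subst sum.swap) (simp add: mult_ac)
  also have "\<dots> = y k * (\<Sum>i\<in>I. c i * F i $ k)"
    using c(2) k by (subst sum.remove[of _ k]) auto
  finally have "(\<Sum>i\<in>I. c i * F i $ k) = 0" using yk by simp
  with c(2) have "(\<Sum>i\<in>I. c i * F i $ s) = 0" if "s < ?d" for s using that by (cases "s = k") auto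
  with indep c(1) show False by blast
qed

section \<open>Operators annihilating compositions with algebraic functions\<close>

text \<open>Polynomials in y over k[x] are evaluated at y = h(x), so \<open>is_ps_root P h\<close>
  means that \<open>bieval P h\<close> is zero.\<close>

definition bieval :: "'k::field_char_0 poly poly \<Rightarrow> 'k fps \<Rightarrow> 'k fps" where
  "bieval b h = poly (map_poly fps_of_poly b) h"

definition in_y :: "'k::field_char_0 poly \<Rightarrow> 'k poly poly" where
  "in_y q = map_poly (\<lambda>c. [:c:]) q"

lemma bieval_0 [simp]: "bieval 0 h = 0"
  by (simp add: bieval_def)

lemma bieval_pCons: "bieval (pCons c b) h = fps_of_poly c + h * bieval b h"
  by (simp add: bieval_def map_poly_pCons)

lemma bieval_1 [simp]: "bieval 1 h = 1"
  by (simp add: one_pCons bieval_pCons)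

lemma bieval_add: "bieval (a + b) h = bieval a h + bieval b h"
  by (induction a b rule: poly_induct2) (auto simp: bieval_pCons fps_of_poly_add algebra_simps)

lemma bieval_smult: "bieval (smult c a) h = fps_of_poly c * bieval a h"
  by (induction a) (auto simp: bieval_pCons fps_of_poly_mult algebra_simps)

lemma bieval_mult: "bieval (a * b) h = bieval a h * bieval b h"
  by (induction a) (auto simp: bieval_pCons bieval_add bieval_smult algebra_simps)

lemma bieval_uminus: "bieval (- a) h = - bieval a h"
  using bieval_smult[of "-1" a h] by (simp add: fps_of_poly_uminus)

lemma bieval_diff: "bieval (a - b) h = bieval a h - bieval b h"
  using bieval_add[of a "-b" h] by (simp add: bieval_uminus)

lemma bieval_sum: "bieval (\<Sum>i\<in>A. f i) h = (\<Sum>i\<in>A. bieval (f i) h)"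
  by (induction A rule: infinite_finite_induct) (auto simp: bieval_add)

lemma bieval_prod: "bieval (\<Prod>i\<in>A. f i) h = (\<Prod>i\<in>A. bieval (f i) h)"
  by (induction A rule: infinite_finite_induct) (auto simp: bieval_mult)

lemma map_poly_pderiv_pCons: "map_poly pderiv (pCons c b) = pCons (pderiv c) (map_poly pderiv b)"
  by (simp add: map_poly_pCons)

lemma fps_deriv_bieval:
  "fps_deriv (bieval b h) = bieval (map_poly pderiv b) h + bieval (pderiv b) h * fps_deriv h"
  by (induction b)
     (auto simp: bieval_pCons map_poly_pderiv_pCons pderiv_pCons bieval_add fps_of_poly_pderiv algebra_simps)

lemma bieval_nth_0: "bieval b h $ 0 = poly (map_poly (\<lambda>c. poly c 0) b) (h $ 0)"
  by (induction b) (auto simp: bieval_pCons map_poly_pCons poly_0_coeff_0)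

text \<open>Expanding q at h(0) and composing with h - h(0) amounts to substituting h. This is the
  form in which the coefficients of L appear once L f = 0 is composed with a branch.\<close>

lemma bieval_in_y:
  "bieval (in_y q) h = fps_of_poly (pcompose q [:h $ 0, 1:]) oo (h - fps_const (h $ 0))"
proof (induction q)
  case (pCons c q)
  let ?u = "h - fps_const (h $ 0)"
  have "fps_of_poly (pcompose (pCons c q) [:h $ 0, 1:]) oo ?u =
    fps_const c + (fps_of_poly [:h $ 0, 1:] oo ?u) * (fps_of_poly (pcompose q [:h $ 0, 1:]) oo ?u)"
    unfolding pcompose_pCons fps_of_poly_add fps_of_poly_mult fps_compose_add_distrib fps_of_poly_const
    by (subst fps_compose_mult_distrib) simp_all
  also have "fps_of_poly [:h $ 0, 1:] oo ?u = h"
    unfolding fps_of_poly_linear fps_compose_add_distrib by (simp add: fps_X_fps_compose fps_eq_iff)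
  finally show ?case using pCons
    by (simp add: in_y_def map_poly_pCons bieval_pCons fps_of_poly_const)
qed (simp add: in_y_def)

text \<open>Every derivative of f(h) is a combination of the first \<open>degree L\<close>
  derivatives of f at h, with coefficients rational in x and h. In the induction step h' is
  eliminated through P_x + P_y h' = 0 and the highest derivative of f through L; hence the new
  denominators P_y and lc(L)(h). It is essential that E and a do not depend on h and f.\<close>

lemma composition_derivatives_module:
  fixes P L :: "'k::field_char_0 poly poly"
  assumes rL: "degree L > 0"
    and Py: "\<And>h. is_ps_root P h \<Longrightarrow> bieval (pderiv P) h \<noteq> 0"
    and lc: "\<And>h. is_ps_root P h \<Longrightarrow> bieval (in_y (lead_coeff L)) h \<noteq> 0"
  shows "\<exists>E a. (\<forall>h. is_ps_root P h \<longrightarrow> bieval E h \<noteq> 0) \<and>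
    (\<forall>h f. is_ps_root P h \<longrightarrow> op_apply_at L (h $ 0) f = 0 \<longrightarrow>
      bieval E h * (fps_deriv ^^ s) (f oo (h - fps_const (h $ 0))) =
      (\<Sum>j<degree L. bieval (a j) h * ((fps_deriv ^^ j) f oo (h - fps_const (h $ 0)))))"
proof (induction s)
  case 0
  show ?case
  proof (intro exI[of _ 1] exI[of _ "\<lambda>j. if j = 0 then 1 else 0"] conjI allI impI)
    fix h f
    have "(\<Sum>j<degree L. bieval (if j = 0 then 1 else 0) h * ((fps_deriv ^^ j) f oo (h - fps_const (h $ 0)))) =
      (\<Sum>j<degree L. if j = 0 then f oo (h - fps_const (h $ 0)) else 0)"
      by (intro sum.cong) auto
    then show "bieval 1 h * (fps_deriv ^^ 0) (f oo (h - fps_const (h $ 0))) =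
      (\<Sum>j<degree L. bieval (if j = 0 then 1 else 0) h * ((fps_deriv ^^ j) f oo (h - fps_const (h $ 0))))"
      using rL by simp
  qed simp
next
  case (Suc s)
  let ?r = "degree L"
  obtain E a where E: "\<And>h. is_ps_root P h \<Longrightarrow> bieval E h \<noteq> 0"
    and a: "\<And>h f. is_ps_root P h \<Longrightarrow> op_apply_at L (h $ 0) f = 0 \<Longrightarrow>
      bieval E h * (fps_deriv ^^ s) (f oo (h - fps_const (h $ 0))) =
      (\<Sum>j<?r. bieval (a j) h * ((fps_deriv ^^ j) f oo (h - fps_const (h $ 0))))"
    using Suc.IH by blast
  \<comment> \<open>At a root h this is P_y times the derivative of b(x, h(x)), with h' already
    eliminated.\<close>
  define \<delta> where "\<delta> = (\<lambda>b. map_poly pderiv b * pderiv P - pderiv b * map_poly pderiv P)"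
  define l where "l = (\<lambda>k. in_y (coeff L k))"
  define Px where "Px = map_poly pderiv P"
  define a' where "a' = (\<lambda>j. l ?r * E * \<delta> (a j) - E * Px * ((if j = 0 then 0 else l ?r * a (j - 1)) - a (?r - 1) * l j)
     - l ?r * \<delta> E * a j)"
  show ?case
  proof (intro exI[of _ "E * E * pderiv P * l ?r"] exI[of _ a'] conjI allI impI)
    fix h assume h: "is_ps_root P h"
    show "bieval (E * E * pderiv P * l ?r) h \<noteq> 0"
      using E[OF h] Py[OF h] lc[OF h] by (simp add: bieval_mult l_def)
    fix f assume f: "op_apply_at L (h $ 0) f = 0"
    let ?u = "h - fps_const (h $ 0)"
    define F where "F = (\<lambda>j. (fps_deriv ^^ j) f oo ?u)"
    define y where "y = (fps_deriv ^^ s) (f oo ?u)"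
    define e A pl where "e = bieval E h" and "A = (\<lambda>j. bieval (a j) h)" and "pl = (\<lambda>k. bieval (l k) h)"
    have Fd: "fps_deriv (F j) = F (Suc j) * fps_deriv h" for j
      by (simp add: F_def fps_compose_deriv)
    have root: "bieval Px h + bieval (pderiv P) h * fps_deriv h = 0"
      using h fps_deriv_bieval[of P h] by (simp add: is_ps_root_def bieval_def Px_def)
    then have root': "bieval (pderiv P) h * fps_deriv h = - bieval Px h" by (simp add: eq_neg_iff_add_eq_0 add.commute)
    have \<delta>: "bieval (pderiv P) h * fps_deriv (bieval b h) = bieval (\<delta> b) h" for b
    proof -
      have "bieval (pderiv P) h * fps_deriv (bieval b h) =
        bieval (map_poly pderiv b) h * bieval (pderiv P) h + bieval (pderiv b) h * (bieval (pderiv P) h * fps_deriv h)"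
        by (simp add: fps_deriv_bieval algebra_simps)
      then show ?thesis unfolding root' by (simp add: \<delta>_def bieval_diff bieval_mult Px_def)
    qed
    have rel: "(\<Sum>k<?r. pl k * F k) = - (pl ?r * F ?r)"
    proof -
      have "0 = op_apply_at L (h $ 0) f oo ?u" using f by simp
      also have "\<dots> = (\<Sum>k\<le>?r. pl k * F k)"
        unfolding op_apply_at_def fps_compose_sum_distrib pl_def l_def bieval_in_y F_def
        by (simp add: fps_compose_mult_distrib)
      also have "\<dots> = (\<Sum>k<?r. pl k * F k) + pl ?r * F ?r" by (simp add: lessThan_Suc_atMost[symmetric])
      finally show ?thesis by (simp add: eq_neg_iff_add_eq_0)
    qed
    define S1 S2 S3 where "S1 = (\<Sum>j<?r. bieval (\<delta> (a j)) h * F j)"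
      and "S2 = (\<Sum>j<?r. A j * F (Suc j))" and "S3 = (\<Sum>j<?r. A j * F j)"
    have ey: "e * y = S3" using a[OF h f] by (simp add: e_def y_def S3_def A_def F_def)
    have S3': "bieval (pderiv P) h * fps_deriv S3 = S1 - bieval Px h * S2"
    proof -
      have "bieval (pderiv P) h * fps_deriv S3 =
        (\<Sum>j<?r. (bieval (pderiv P) h * fps_deriv (A j)) * F j + (bieval (pderiv P) h * fps_deriv h) * (A j * F (Suc j)))"
        by (simp add: S3_def fps_deriv_sum Fd sum_distrib_left algebra_simps)
      also have "\<dots> = S1 - bieval Px h * S2"
        unfolding root' A_def \<delta> by (simp add: S1_def S2_def A_def sum.distrib sum_distrib_left sum_negf sum_subtractf)
      finally show ?thesis .
    qed
    \<comment> \<open>Shifting j to j + 1 produces one derivative of order \<open>degree L\<close>;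
      \<open>rel\<close> folds it back into the lower ones at the cost of the factor
      \<open>pl ?r\<close>.\<close>
    have S2': "pl ?r * S2 = (\<Sum>j<?r. ((if j = 0 then 0 else pl ?r * A (j - 1)) - A (?r - 1) * pl j) * F j)"
    proof -
      obtain q where q: "?r = Suc q" using rL by (cases ?r) auto
      have "(\<Sum>j<?r. (if j = 0 then 0 else pl ?r * A (j - 1)) * F j) = (\<Sum>j<q. pl ?r * A j * F (Suc j))"
        unfolding q by (subst sum.lessThan_Suc_shift) simp
      moreover have "(\<Sum>j<?r. A (?r - 1) * pl j * F j) = - (A q * pl ?r * F ?r)"
        using rel by (simp add: q mult.assoc sum_distrib_left[symmetric] del: sum.lessThan_Suc)
      moreover have "pl ?r * S2 = (\<Sum>j<q. pl ?r * A j * F (Suc j)) + A q * pl ?r * F ?r"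
        unfolding S2_def q by (simp add: algebra_simps sum_distrib_left)
      ultimately show ?thesis by (simp add: left_diff_distrib sum_subtractf)
    qed
    have yS: "(fps_deriv ^^ Suc s) (f oo ?u) = fps_deriv y" by (simp add: y_def)
    have "e * fps_deriv y = fps_deriv S3 - fps_deriv e * y" unfolding ey[symmetric] by (simp add: algebra_simps)
    then have "e * bieval (pderiv P) h * pl ?r * (e * fps_deriv y) =
      e * bieval (pderiv P) h * pl ?r * (fps_deriv S3 - fps_deriv e * y)" by simp
    then have "e * e * bieval (pderiv P) h * pl ?r * fps_deriv y =
      pl ?r * e * (bieval (pderiv P) h * fps_deriv S3) - pl ?r * (bieval (pderiv P) h * fps_deriv e) * (e * y)"
      by (simp add: algebra_simps)
    also have "\<dots> = pl ?r * e * S1 - e * bieval Px h * (pl ?r * S2) - pl ?r * bieval (\<delta> E) h * S3"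
      unfolding S3' e_def \<delta> unfolding e_def[symmetric] ey by (simp add: algebra_simps)
    also have "\<dots> = (\<Sum>j<?r. bieval (a' j) h * F j)"
    proof -
      have "bieval (a' j) h = pl ?r * e * bieval (\<delta> (a j)) h
        - e * bieval Px h * ((if j = 0 then 0 else pl ?r * A (j - 1)) - A (?r - 1) * pl j) - pl ?r * bieval (\<delta> E) h * A j" for j
        by (simp add: a'_def bieval_diff bieval_mult pl_def e_def A_def)
      then show ?thesis unfolding S2' S1_def S3_def
        by (simp only: left_diff_distrib sum_subtractf[symmetric] sum_distrib_left mult.assoc)
    qed
    finally show "bieval (E * E * pderiv P * l ?r) h * (fps_deriv ^^ Suc s) (f oo ?u) =
      (\<Sum>j<?r. bieval (a' j) h * ((fps_deriv ^^ j) f oo ?u))"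
      unfolding yS F_def by (simp add: bieval_mult e_def pl_def)
  qed
qed

text \<open>Division by P in y without leaving k[x]. A single multiplier c for the whole family, the
  product of the individual ones, lets a linear relation among the remainders hold for the family at
  every root of P.\<close>

lemma pseudo_mod_family:
  fixes P :: "'a::idom poly"
  assumes "finite A" "P \<noteq> 0"
  shows "\<exists>c \<rho>. c \<noteq> 0 \<and> (\<forall>x\<in>A. P dvd smult c (b x) - \<rho> x \<and> (\<forall>l\<ge>degree P. degree P > 0 \<longrightarrow> coeff (\<rho> x) l = 0))"
proof -
  have "\<exists>c q. c \<noteq> 0 \<and> smult c (b x) = P * q + pseudo_mod (b x) P" for x
    using pseudo_mod(1)[OF assms(2)] by blast
  then obtain c q where cq: "\<And>x. c x \<noteq> 0" "\<And>x. smult (c x) (b x) = P * q x + pseudo_mod (b x) P" by metis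
  define \<rho> where "\<rho> = (\<lambda>x. smult (\<Prod>y\<in>A - {x}. c y) (pseudo_mod (b x) P))"
  show ?thesis
  proof (intro exI[of _ "\<Prod>x\<in>A. c x"] exI[of _ \<rho>] conjI ballI allI impI)
    show "(\<Prod>x\<in>A. c x) \<noteq> 0" using assms cq by simp
    fix x assume x: "x \<in> A"
    have "smult (\<Prod>x\<in>A. c x) (b x) = smult (\<Prod>y\<in>A - {x}. c y) (smult (c x) (b x))"
      using x assms by (simp add: prod.remove[of A x] mult.commute)
    also have "\<dots> - \<rho> x = P * smult (\<Prod>y\<in>A - {x}. c y) (q x)"
      unfolding cq by (simp add: \<rho>_def smult_add_right)
    finally show "P dvd smult (\<Prod>x\<in>A. c x) (b x) - \<rho> x" by (simp only: dvd_triv_left)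
    fix l assume l: "degree P \<le> l" "degree P > 0"
    have "pseudo_mod (b x) P = 0 \<or> degree (pseudo_mod (b x) P) < degree P" using pseudo_mod(2)[OF assms(2)] .
    then have "coeff (pseudo_mod (b x) P) l = 0" using l by (auto intro: coeff_eq_0)
    then show "coeff (\<rho> x) l = 0" by (simp add: \<rho>_def)
  qed
qed

text \<open>The derivatives of all \<open>f \<circ> g\<close> lie in a module of rank \<open>deg L \<cdot> deg P\<close> over the rational functions.\<close>

theorem annihilator_exists:
  fixes P L :: "'k::field_char_0 poly poly"
  assumes rL: "degree L > 0" and rP: "degree P > 0"
    and Py: "\<And>h. is_ps_root P h \<Longrightarrow> bieval (pderiv P) h \<noteq> 0"
    and lc: "\<And>h. is_ps_root P h \<Longrightarrow> bieval (in_y (lead_coeff L)) h \<noteq> 0"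
  shows "\<exists>M. M \<noteq> 0 \<and> degree M \<le> degree L * degree P \<and> annihilates_comp P L M"
proof -
  let ?r = "degree L * degree P"
  have "\<forall>s. \<exists>E a. (\<forall>h. is_ps_root P h \<longrightarrow> bieval E h \<noteq> 0) \<and>
    (\<forall>h f. is_ps_root P h \<longrightarrow> op_apply_at L (h $ 0) f = 0 \<longrightarrow>
      bieval E h * (fps_deriv ^^ s) (f oo (h - fps_const (h $ 0))) =
      (\<Sum>j<degree L. bieval (a j) h * ((fps_deriv ^^ j) f oo (h - fps_const (h $ 0)))))"
    using composition_derivatives_module[OF rL Py lc] by blast
  then obtain E a where Ea: "\<forall>s. (\<forall>h. is_ps_root P h \<longrightarrow> bieval (E s) h \<noteq> 0) \<and>
    (\<forall>h f. is_ps_root P h \<longrightarrow> op_apply_at L (h $ 0) f = 0 \<longrightarrow>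
      bieval (E s) h * (fps_deriv ^^ s) (f oo (h - fps_const (h $ 0))) =
      (\<Sum>j<degree L. bieval (a s j) h * ((fps_deriv ^^ j) f oo (h - fps_const (h $ 0)))))"
    unfolding choice_iff by blast
  \<comment> \<open>Puts the representations of all derivatives of order at most \<open>?r\<close>
    over the product of all denominators \<open>E t\<close>.\<close>
  define b where "b = (\<lambda>(s, j). (\<Prod>t\<in>{..?r} - {s}. E t) * a s j)"
  obtain c \<rho> where c: "c \<noteq> 0"
    and \<rho>: "\<And>s j. s \<le> ?r \<Longrightarrow> j < degree L \<Longrightarrow> P dvd smult c (b (s, j)) - \<rho> (s, j)"
      "\<And>s j l. s \<le> ?r \<Longrightarrow> j < degree L \<Longrightarrow> l \<ge> degree P \<Longrightarrow> coeff (\<rho> (s, j)) l = 0"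
    using pseudo_mod_family[of "{..?r} \<times> {..<degree L}" P b] rP by fastforce
  \<comment> \<open>The unknowns are the coefficients of M in k[x]. There is one equation for each
    derivative j of f and each power l of y, hence one fewer than unknowns. The relation is formal
    and therefore valid for all branches and all solutions at once.\<close>
  have "card ({..<degree L} \<times> {..<degree P}) < card {..?r}" by simp
  from homogeneous_system_nontrivial_solution[OF _ _ this, of "\<lambda>s (j, l). coeff (\<rho> (s, j)) l"]
  obtain m where m: "\<exists>s\<in>{..?r}. m s \<noteq> 0"
    "\<And>j l. j < degree L \<Longrightarrow> l < degree P \<Longrightarrow> (\<Sum>s\<le>?r. m s * coeff (\<rho> (s, j)) l) = 0" by force
  define M where "M = (\<Sum>s\<le>?r. monom (m s) s)"
  have coeffM: "coeff M s = (if s \<le> ?r then m s else 0)" for s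
    by (simp add: M_def coeff_sum)
  have degM: "degree M \<le> ?r" by (intro degree_le) (simp add: coeffM)
  have "M \<noteq> 0" using m(1) coeffM by (metis atMost_iff coeff_0)
  moreover have "annihilates_comp P L M"
    unfolding annihilates_comp_def
  proof (intro allI impI)
    fix h f assume h: "is_ps_root P h" and f: "op_apply_at L (h $ 0) f = 0"
    let ?u = "h - fps_const (h $ 0)"
    define F where "F = (\<lambda>j. (fps_deriv ^^ j) f oo ?u)"
    define y where "y = (\<lambda>s. (fps_deriv ^^ s) (f oo ?u))"
    define \<epsilon> where "\<epsilon> = (\<Prod>s\<le>?r. bieval (E s) h)"
    have \<epsilon>: "\<epsilon> \<noteq> 0" using Ea h by (simp add: \<epsilon>_def)
    have Py0: "bieval P h = 0" using h by (simp add: is_ps_root_def bieval_def)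
    have by': "\<epsilon> * y s = (\<Sum>j<degree L. bieval (b (s, j)) h * F j)" if "s \<le> ?r" for s
    proof -
      have "\<epsilon> = (\<Prod>t\<in>{..?r} - {s}. bieval (E t) h) * bieval (E s) h"
        using that by (simp add: \<epsilon>_def prod.remove[of _ s] mult.commute)
      moreover have "bieval (E s) h * y s = (\<Sum>j<degree L. bieval (a s j) h * F j)"
        using Ea h f by (simp add: y_def F_def)
      ultimately show ?thesis
        by (simp add: b_def bieval_mult bieval_prod mult.assoc sum_distrib_left)
    qed
    have red: "fps_of_poly c * bieval (b (s, j)) h = bieval (\<rho> (s, j)) h" if sj: "s \<le> ?r" "j < degree L" for s j
    proof -
      obtain q where "smult c (b (s, j)) - \<rho> (s, j) = P * q" using \<rho>(1)[OF sj] by blast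
      then have "bieval (smult c (b (s, j)) - \<rho> (s, j)) h = bieval (P * q) h" by simp
      then show ?thesis by (simp add: bieval_diff bieval_smult bieval_mult Py0)
    qed
    have rel: "(\<Sum>s\<le>?r. fps_of_poly (m s) * bieval (\<rho> (s, j)) h) = 0" if j: "j < degree L" for j
    proof -
      have "(\<Sum>s\<le>?r. smult (m s) (\<rho> (s, j))) = 0"
      proof (rule poly_eqI)
        fix l show "coeff (\<Sum>s\<le>?r. smult (m s) (\<rho> (s, j))) l = coeff 0 l"
          using m(2)[OF j, of l] \<rho>(2)[OF _ j, of _ l] by (cases "l < degree P") (auto simp: coeff_sum)
      qed
      then have "bieval (\<Sum>s\<le>?r. smult (m s) (\<rho> (s, j))) h = 0" by simp
      then show ?thesis by (simp add: bieval_sum bieval_smult)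
    qed
    have "fps_of_poly c * \<epsilon> * op_apply_at M 0 (f oo ?u) = (\<Sum>s\<le>?r. fps_of_poly (m s) * (fps_of_poly c * (\<epsilon> * y s)))"
      unfolding op_apply_at_upto[OF degM] by (simp add: coeffM y_def sum_distrib_left algebra_simps)
    also have "\<dots> = (\<Sum>s\<le>?r. \<Sum>j<degree L. fps_of_poly (m s) * bieval (\<rho> (s, j)) h * F j)"
      using by' by (intro sum.cong refl) (simp add: sum_distrib_left red[symmetric] mult_ac)
    also have "\<dots> = (\<Sum>j<degree L. (\<Sum>s\<le>?r. fps_of_poly (m s) * bieval (\<rho> (s, j)) h) * F j)"
      unfolding sum_distrib_right by (rule sum.swap)
    also have "\<dots> = 0" by (simp add: rel)
    finally show "op_apply_at M 0 (f oo ?u) = 0"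
      using \<epsilon> c by (simp add: fps_of_poly_eq_iff[of _ 0, simplified])
  qed
  ultimately show ?thesis using degM by blast
qed

lemma op_apply_at_0: "op_apply_at M 0 f = (\<Sum>i\<le>degree M. fps_of_poly (coeff M i) * (fps_deriv ^^ i) f)"
  by (simp add: op_apply_at_def)

lemma op_apply_at_0_upto:
  "degree M \<le> n \<Longrightarrow> op_apply_at M 0 f = (\<Sum>i\<le>n. fps_of_poly (coeff M i) * (fps_deriv ^^ i) f)"
  by (simp add: op_apply_at_upto)

lemma op_apply_at_smult: "op_apply_at (smult q M) 0 f = fps_of_poly q * op_apply_at M 0 f"
  by (simp add: op_apply_at_0_upto[OF degree_smult_le] op_apply_at_0 fps_of_poly_mult sum_distrib_left mult.assoc)

text \<open>Among the annihilators of least order, one with leading coefficient of least degree has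
  no common factor: dividing it out would keep the order and lower that degree.\<close>

lemma min_op_exists:
  fixes P L N :: "'k::field_char_0 poly poly"
  assumes "N \<noteq> 0" "annihilates_comp P L N"
  shows "\<exists>M. is_min_op P L M"
proof -
  define S where "S = {M. M \<noteq> 0 \<and> annihilates_comp P L M}"
  obtain M where M: "M \<in> S" "\<And>M'. M' \<in> S \<Longrightarrow> degree M \<le> degree M'"
    "\<And>M'. M' \<in> S \<Longrightarrow> degree M' = degree M \<Longrightarrow> degree (lead_coeff M) \<le> degree (lead_coeff M')"
  proof -
    define d where "d = (LEAST d. \<exists>M\<in>S. degree M = d)"
    have ex: "\<exists>M\<in>S. degree M = d"
      unfolding d_def using assms by (intro LeastI_ex[of "\<lambda>d. \<exists>M\<in>S. degree M = d"]) (auto simp: S_def)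
    have min: "d \<le> degree M" if "M \<in> S" for M unfolding d_def using that by (intro Least_le) auto
    define e where "e = (LEAST e. \<exists>M\<in>S. degree M = d \<and> degree (lead_coeff M) = e)"
    have "\<exists>M\<in>S. degree M = d \<and> degree (lead_coeff M) = e"
      unfolding e_def using ex by (intro LeastI_ex[of "\<lambda>e. \<exists>M\<in>S. degree M = d \<and> degree (lead_coeff M) = e"]) auto
    moreover have "e \<le> degree (lead_coeff M)" if "M \<in> S" "degree M = d" for M
      unfolding e_def using that by (intro Least_le) auto
    ultimately show ?thesis using that min by metis
  qed
  have "degree q = 0" if q: "\<forall>i. q dvd coeff M i" for q
  proof (rule ccontr)
    assume dq: "degree q \<noteq> 0"
    define M' where "M' = map_poly (\<lambda>c. c div q) M"
    have MM': "M = smult q M'"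
    proof (rule poly_eqI)
      fix i
      have "coeff M' i = coeff M i div q" by (simp add: M'_def coeff_map_poly)
      then show "coeff M i = coeff (smult q M') i" using q by simp
    qed
    have q0: "q \<noteq> 0" using dq by auto
    have M'0: "M' \<noteq> 0" using M(1) MM' by (auto simp: S_def)
    have "annihilates_comp P L M'"
      unfolding annihilates_comp_def
    proof (intro allI impI)
      fix h f assume "is_ps_root P h" "op_apply_at L (h $ 0) f = 0"
      then have "op_apply_at M 0 (f oo (h - fps_const (h $ 0))) = 0"
        using M(1) by (auto simp: S_def annihilates_comp_def)
      then show "op_apply_at M' 0 (f oo (h - fps_const (h $ 0))) = 0"
        unfolding MM' op_apply_at_smult using q0 by (simp add: fps_of_poly_eq_iff[of _ 0, simplified])
    qed
    then have "M' \<in> S" using M'0 by (simp add: S_def)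
    moreover have deg: "degree M' = degree M" using q0 by (simp add: MM')
    ultimately have "degree (lead_coeff M) \<le> degree (lead_coeff M')" using M(3) by blast
    moreover have "degree (lead_coeff M) = degree q + degree (lead_coeff M')"
      using q0 M'0 by (simp add: MM' degree_mult_eq)
    ultimately show False using dq by simp
  qed
  then show ?thesis using M unfolding is_min_op_def S_def by blast
qed

section \<open>Removing an apparent singularity at cost one\<close>

text \<open>\<open>fract_deriv\<close> works on a chosen representation. For a polynomial c every
  representation has numerator c * b, and the quotient rule then gives \<open>pderiv c\<close>
  whatever b is.\<close>

lemma fract_deriv_to_fract: "fract_deriv (to_fract (c :: 'k::field poly)) = to_fract (pderiv c)"
proof -
  define S where "S = (\<lambda>(a, b). b \<noteq> 0 \<and> to_fract c = Fract a b)"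
  have "S (c, 1)" by (simp add: S_def to_fract_def)
  then have "S (SOME x. S x)" by (rule someI)
  moreover obtain a b where ab: "(SOME x. S x) = (a, b)" by fastforce
  ultimately have b: "b \<noteq> 0" and "to_fract c = Fract a b" by (auto simp: S_def)
  then have a: "a = c * b" by (simp add: to_fract_def eq_fract)
  have "fract_deriv (to_fract c) = Fract (pderiv a * b - a * pderiv b) (b * b)"
    unfolding fract_deriv_def using ab[unfolded S_def] by simp
  also have "pderiv a * b - a * pderiv b = pderiv c * (b * b)"
    by (simp add: a pderiv_mult algebra_simps)
  finally show ?thesis using b by (simp add: to_fract_def eq_fract)
qed

lemma op_apply_at_0_add: "op_apply_at (A + B) 0 f = op_apply_at A 0 f + op_apply_at B 0 f"
proof -
  let ?n = "max (degree A) (degree B)"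
  have "degree (A + B) \<le> ?n" by (rule degree_add_le_max)
  then show ?thesis
    by (simp add: op_apply_at_0_upto[of _ ?n] fps_of_poly_add sum.distrib algebra_simps)
qed

lemma op_apply_at_0_pCons: "op_apply_at (pCons 0 M) 0 f = op_apply_at M 0 (fps_deriv f)"
proof -
  have "degree (pCons 0 M) \<le> Suc (degree M)" by (rule degree_pCons_le)
  then have "op_apply_at (pCons 0 M) 0 f = (\<Sum>i\<le>Suc (degree M). fps_of_poly (coeff (pCons 0 M) i) * (fps_deriv ^^ i) f)"
    by (rule op_apply_at_0_upto)
  also have "\<dots> = op_apply_at M 0 (fps_deriv f)"
    by (subst sum.atMost_Suc_shift) (simp add: op_apply_at_0 funpow_swap1)
  finally show ?thesis .
qed

text \<open>The operator on the right is the Ore product D M: the coefficients are differentiated,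
  plus a shift by one order.\<close>

lemma fps_deriv_op_apply_at_0:
  "fps_deriv (op_apply_at M 0 f) = op_apply_at (map_poly pderiv M + pCons 0 M) 0 f"
proof -
  have "degree (map_poly pderiv M) \<le> degree M" by (intro degree_le) (simp add: coeff_map_poly coeff_eq_0)
  then have "op_apply_at (map_poly pderiv M) 0 f = (\<Sum>i\<le>degree M. fps_of_poly (pderiv (coeff M i)) * (fps_deriv ^^ i) f)"
    by (simp add: op_apply_at_0_upto coeff_map_poly)
  then show ?thesis
    unfolding op_apply_at_0_add op_apply_at_0_pCons
    by (simp add: op_apply_at_0 fps_deriv_sum fps_of_poly_pderiv sum.distrib funpow_swap1 algebra_simps)
qed

lemma op_apply_at_0_fps_of_poly:
  "op_apply_at M 0 (fps_of_poly q) = fps_of_poly (\<Sum>i\<le>degree M. coeff M i * (pderiv ^^ i) q)"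
proof -
  have "(fps_deriv ^^ i) (fps_of_poly q) = fps_of_poly ((pderiv ^^ i) q)" for i
    by (induction i) (auto simp: fps_of_poly_pderiv)
  then show ?thesis by (simp add: op_apply_at_0 fps_of_poly_sum fps_of_poly_mult)
qed

lemma factor_out_power_of_x:
  fixes R :: "'k::field poly poly"
  assumes "R \<noteq> 0"
  shows "\<exists>a R'. R = smult (monom 1 a) R' \<and> (\<exists>k. poly (coeff R' k) 0 \<noteq> 0)"
  using assms
proof (induction "degree (lead_coeff R)" arbitrary: R rule: less_induct)
  case less
  show ?case
  proof (cases "\<exists>k. poly (coeff R k) 0 \<noteq> 0")
    case True
    then show ?thesis by (intro exI[of _ 0] exI[of _ R]) auto
  next
    case False
    define R1 where "R1 = map_poly (\<lambda>c. c div [:0, 1:]) R"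
    have dvd: "[:0, 1:] dvd coeff R i" for i
      using False poly_eq_0_iff_dvd[of "coeff R i" 0] by simp
    have R: "R = smult [:0, 1:] R1"
    proof (rule poly_eqI)
      fix i
      have "coeff R1 i = coeff R i div [:0, 1:]" by (simp add: R1_def coeff_map_poly)
      then show "coeff R i = coeff (smult [:0, 1:] R1) i"
        using dvd_mult_div_cancel[OF dvd[of i]] by (simp only: coeff_smult)
    qed
    have "R1 \<noteq> 0" using less.prems R by auto
    moreover have "lead_coeff R = [:0, 1:] * lead_coeff R1" unfolding R by simp
    then have "degree (lead_coeff R1) < degree (lead_coeff R)" using \<open>R1 \<noteq> 0\<close> by (simp add: degree_mult_eq)
    ultimately obtain a R' where R': "R1 = smult (monom 1 a) R'" "\<exists>k. poly (coeff R' k) 0 \<noteq> 0"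
      using less.hyps by blast
    have "R = smult (monom 1 (Suc a)) R'" unfolding R R' by (simp add: monom_Suc)
    with R' show ?thesis by blast
  qed
qed

lemma coprime_x_if_nonzero_at_0:
  assumes "poly c 0 \<noteq> (0 :: 'k::field)" shows "coprime c [:0, 1:]"
proof -
  have "prime_elem [:0, 1 :: 'k:]" by (rule prime_elem_linear_field_poly) simp
  moreover have "\<not> [:0, 1:] dvd c" using assms poly_eq_0_iff_dvd[of c 0] by simp
  ultimately have nd: "prime_elem [:0, 1 :: 'k:]" "\<not> [:0, 1:] dvd c" by blast+
  show ?thesis
  proof (rule coprimeI)
    fix x assume x: "x dvd c" "x dvd [:0, 1:]"
    then obtain y where y: "[:0, 1:] = x * y" by blast
    then have "[:0, 1:] dvd x \<or> [:0, 1:] dvd y"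
      using prime_elem_dvd_multD[OF nd(1), of x y] by simp
    moreover have "\<not> [:0, 1:] dvd x" using nd(2) x(1) dvd_trans by blast
    ultimately obtain z where "y = [:0, 1:] * z" by blast
    then have "[:0, 1:] * 1 = [:0, 1:] * (x * z)" using y by (metis mult.left_commute mult.right_neutral)
    then have "x * z = 1" by (metis mult_cancel_left nd(1) prime_elem_not_zeroI)
    then show "is_unit x" by (metis dvd_triv_left)
  qed
qed

lemma op_mult_first_order:
  fixes M :: "'k::field_char_0 poly poly"
  assumes "q1 \<noteq> 0"
  shows "coeff (op_mult fract_deriv [:q0, q1:] (map_poly to_fract M)) l =
    q0 * to_fract (coeff M l) + q1 * (to_fract (coeff (pCons 0 M) l) + to_fract (pderiv (coeff M l)))"
proof -
  let ?n = "degree M" and ?m = "\<lambda>j. to_fract (coeff M j)"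
  have cf: "coeff (map_poly to_fract M) j = ?m j" for j by (simp add: coeff_map_poly)
  have deg: "degree (map_poly to_fract M) = ?n" by (rule degree_map_poly) simp
  have big: "coeff M l = 0" if "\<not> l \<le> ?n" for l using that by (simp add: coeff_eq_0)
  have one: "{..Suc 0} = {0, Suc 0}" by auto
  have "op_mult fract_deriv [:q0, q1:] (map_poly to_fract M) =
    (\<Sum>j\<le>?n. monom (q0 * ?m j) j) + ((\<Sum>j\<le>?n. monom (q1 * ?m j) (Suc j)) + (\<Sum>j\<le>?n. monom (q1 * to_fract (pderiv (coeff M j))) j))"
    unfolding op_mult_def using assms
    by (simp add: deg cf one fract_deriv_to_fract sum.distrib)
  also have "coeff \<dots> l = q0 * ?m l + (q1 * to_fract (coeff (pCons 0 M) l) + q1 * to_fract (pderiv (coeff M l)))"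
  proof -
    have "coeff (\<Sum>j\<le>?n. monom (q0 * ?m j) j) l = q0 * ?m l"
      using big by (auto simp: coeff_sum)
    moreover have "coeff (\<Sum>j\<le>?n. monom (q1 * to_fract (pderiv (coeff M j))) j) l = q1 * to_fract (pderiv (coeff M l))"
      using big by (auto simp: coeff_sum)
    moreover have "coeff (\<Sum>j\<le>?n. monom (q1 * ?m j) (Suc j)) l = q1 * to_fract (coeff (pCons 0 M) l)"
      using big by (cases l) (auto simp: coeff_sum)
    ultimately show ?thesis by simp
  qed
  finally show ?thesis by (simp add: algebra_simps)
qed

text \<open>Adjoin to the solution space a monomial \<open>x ^ e\<close> whose exponent is missing. With
  \<open>p = M(x ^ e)\<close>, the operator \<open>(p D - p') M\<close> annihilates the larger space, which has the exponents
  \<open>0, \<dots>, deg M\<close>, so it is regular at 0 once powers of \<open>x\<close> are divided out.\<close>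

theorem removable_if_independent:
  fixes M :: "'k::field_char_0 poly poly"
  assumes M: "M \<noteq> 0" and I: "finite I" "card I = degree M"
    and sol: "\<And>i. i \<in> I \<Longrightarrow> op_apply_at M 0 (w i) = 0"
    and indep: "\<And>c. (\<And>s. s \<le> degree M \<Longrightarrow> (\<Sum>i\<in>I. c i * w i $ s) = 0) \<Longrightarrow> (\<forall>i\<in>I. c i = 0)"
  shows "removable_at_cost M [:0, 1:] 1"
proof -
  let ?r = "degree M"
  \<comment> \<open>The r solutions, truncated after \<open>x ^ r\<close>, span at most r of r + 1
    dimensions, so some unit vector is missing.\<close>
  have "\<exists>e\<le>?r. \<forall>c. \<exists>s\<le>?r. (\<Sum>i\<in>I. c i * w i $ s) \<noteq> (if s = e then 1 else 0)"
  proof (rule ccontr)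
    assume "\<not> ?thesis"
    then obtain c where c: "\<And>e s. e \<le> ?r \<Longrightarrow> s \<le> ?r \<Longrightarrow> (\<Sum>i\<in>I. c e i * w i $ s) = (if s = e then 1 else 0)"
      by metis
    obtain m where m: "\<exists>e\<in>{..?r}. m e \<noteq> 0" "\<forall>i\<in>I. (\<Sum>e\<le>?r. m e * c e i) = 0"
      using homogeneous_system_nontrivial_solution[of I "{..?r}" c] I by auto
    have "m s = 0" if s: "s \<le> ?r" for s
    proof -
      have "0 = (\<Sum>i\<in>I. (\<Sum>e\<le>?r. m e * c e i) * w i $ s)" using m by simp
      also have "\<dots> = (\<Sum>e\<le>?r. m e * (\<Sum>i\<in>I. c e i * w i $ s))"
        unfolding sum_distrib_left sum_distrib_right by (subst sum.swap) (simp add: mult_ac)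
      also have "\<dots> = (\<Sum>e\<le>?r. if e = s then m e else 0)" using s by (intro sum.cong) (auto simp: c)
      finally show ?thesis using s by simp
    qed
    with m(1) show False by auto
  qed
  then obtain e where e: "e \<le> ?r" "\<And>c. \<exists>s\<le>?r. (\<Sum>i\<in>I. c i * w i $ s) \<noteq> (if s = e then 1 else 0)" by blast
  define J where "J = insert None (Some ` I)"
  define W where "W = (\<lambda>x. case x of None \<Rightarrow> fps_X ^ e | Some i \<Rightarrow> w i)"
  have J: "finite J" "card J = Suc ?r" using I by (auto simp: J_def card_image)
  have sumJ: "(\<Sum>x\<in>J. f x) = f None + (\<Sum>i\<in>I. f (Some i))" for f :: "'a option \<Rightarrow> 'b::comm_monoid_add"
    using I by (simp add: J_def sum.reindex)
  have indepJ: "\<forall>x\<in>J. c x = 0" if c: "\<And>s. s \<le> ?r \<Longrightarrow> (\<Sum>x\<in>J. c x * W x $ s) = 0" for c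
  proof -
    have eq: "c None * (if s = e then 1 else 0) + (\<Sum>i\<in>I. c (Some i) * w i $ s) = 0" if "s \<le> ?r" for s
      using c[OF that] by (simp add: sumJ W_def fps_X_power_nth)
    have "c None = 0"
    proof (rule ccontr)
      assume n: "c None \<noteq> 0"
      have "(\<Sum>i\<in>I. - (c (Some i) / c None) * w i $ s) = (if s = e then 1 else 0)" if "s \<le> ?r" for s
      proof -
        have "(\<Sum>i\<in>I. - (c (Some i) / c None) * w i $ s) = - (\<Sum>i\<in>I. c (Some i) * w i $ s) / c None"
          by (simp add: sum_negf sum_divide_distrib)
        also have "- (\<Sum>i\<in>I. c (Some i) * w i $ s) = c None * (if s = e then 1 else 0)"
          using eq[OF that] by (metis add.commute neg_eq_iff_add_eq_0)
        finally show ?thesis using n by simp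
      qed
      then show False using e(2)[of "\<lambda>i. - (c (Some i) / c None)"] by auto
    qed
    moreover from this have "\<forall>i\<in>I. c (Some i) = 0" using eq by (intro indep) simp
    ultimately show ?thesis by (auto simp: J_def)
  qed
  define p where "p = (\<Sum>i\<le>degree M. coeff M i * (pderiv ^^ i) (monom 1 e))"
  have p: "op_apply_at M 0 (fps_X ^ e) = fps_of_poly p"
    unfolding p_def op_apply_at_0_fps_of_poly[symmetric] by (simp add: fps_of_poly_monom')
  \<comment> \<open>Otherwise the monomial would be a further solution, and M would have
    \<open>degree M + 1\<close> independent ones.\<close>
  have p0: "p \<noteq> 0"
  proof
    assume "p = 0"
    then have "op_apply_at M 0 (W x) = 0" if "x \<in> J" for x
      using that sol p by (auto simp: J_def W_def)
    from solutions_linearly_dependent[where F=W, OF M J(1) _ this] J(2)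
    obtain c where c: "\<exists>x\<in>J. c x \<noteq> 0" "(\<Sum>x\<in>J. fps_const (c x) * W x) = 0" by auto
    have "(\<Sum>x\<in>J. c x * W x $ s) = 0" for s
      using arg_cong[OF c(2), of "\<lambda>f. f $ s"] by (simp add: fps_sum_nth)
    with indepJ c(1) show False by blast
  qed
  define R0 where "R0 = smult p (map_poly pderiv M + pCons 0 M) + smult (- pderiv p) M"
  have R0app: "op_apply_at R0 0 f = fps_of_poly p * fps_deriv (op_apply_at M 0 f) - fps_of_poly (pderiv p) * op_apply_at M 0 f" for f
    unfolding R0_def op_apply_at_0_add[of "smult _ _"] op_apply_at_smult fps_deriv_op_apply_at_0 by (simp add: fps_of_poly_uminus)
  have R0top: "coeff R0 (Suc ?r) = p * lead_coeff M"
    by (simp add: R0_def coeff_map_poly coeff_eq_0)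
  have degR0: "degree R0 = Suc ?r"
  proof (rule antisym)
    show "degree R0 \<le> Suc ?r"
      by (intro degree_le) (auto simp: R0_def coeff_map_poly coeff_eq_0 coeff_pCons split: nat.split)
    show "Suc ?r \<le> degree R0" using R0top p0 M by (intro le_degree) simp
  qed
  then have "R0 \<noteq> 0" by auto
  then obtain a R k where R: "R0 = smult (monom 1 a) R" and k: "poly (coeff R k) 0 \<noteq> 0"
    using factor_out_power_of_x by blast
  have xa: "monom 1 a \<noteq> (0 :: 'k poly)" by simp
  have degR: "degree R = Suc ?r" using degR0 R xa by simp
  have solR: "op_apply_at R 0 (W x) = 0" if "x \<in> J" for x
  proof -
    have "op_apply_at R0 0 (W x) = 0"
      using that sol by (auto simp: R0app J_def W_def p fps_of_poly_pderiv)
    then show ?thesis using xa unfolding R op_apply_at_smult by (simp add: fps_of_poly_monom')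
  qed
  have "poly (lead_coeff R) 0 \<noteq> 0"
    by (rule lead_coeff_nonzero_at_0[OF J(1) _ solR _ k]) (use J degR indepJ in auto)
  then have cop: "coprime (lead_coeff R) [:0, 1:]" by (rule coprime_x_if_nonzero_at_0)
  define x where "x = to_fract (monom 1 a :: 'k poly)"
  have x0: "x \<noteq> 0" using xa by (simp add: x_def)
  \<comment> \<open>The power of x is divided out here, which is legitimate because Q may have
    rational function coefficients.\<close>
  define Q where "Q = [:to_fract (- pderiv p) / x, to_fract p / x:]"
  have "op_mult fract_deriv Q (map_poly to_fract M) = map_poly to_fract R"
  proof (rule poly_eqI)
    fix l
    have "coeff (op_mult fract_deriv Q (map_poly to_fract M)) l * x = to_fract (coeff R0 l)"
      unfolding Q_def using p0 x0
      by (subst op_mult_first_order) (simp_all add: R0_def coeff_map_poly field_simps)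
    also have "\<dots> = coeff (map_poly to_fract R) l * x"
      by (simp add: R x_def coeff_map_poly mult.commute)
    finally show "coeff (op_mult fract_deriv Q (map_poly to_fract M)) l = coeff (map_poly to_fract R) l"
      using x0 by simp
  qed
  moreover have "degree Q \<le> 1" by (simp add: Q_def)
  ultimately show ?thesis using cop unfolding removable_at_cost_def by blast
qed

section \<open>Degenerate operators\<close>

lemma coeff_pcompose_sum:
  fixes q r :: "'a::comm_ring_1 poly"
  assumes "degree q \<le> m"
  shows "coeff (pcompose q r) p = (\<Sum>d\<le>m. coeff q d * coeff (r ^ d) p)"
proof -
  let ?q = "map_poly (\<lambda>x. [:x:]) q"
  have "degree ?q \<le> m"
    using assms by (intro degree_le) (simp add: coeff_map_poly coeff_eq_0)
  then have "(\<Sum>d\<le>degree ?q. coeff ?q d * r ^ d) = (\<Sum>d\<le>m. coeff ?q d * r ^ d)"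
    by (intro sum.mono_neutral_left) (auto simp: coeff_eq_0)
  then have "pcompose q r = (\<Sum>d\<le>m. [:coeff q d:] * r ^ d)"
    by (simp add: pcompose_altdef poly_altdef coeff_map_poly)
  then show ?thesis by (simp add: coeff_sum)
qed

lemma pcompose_power: "pcompose (p ^ m) q = pcompose p q ^ m"
  by (induction m) (simp_all add: pcompose_mult pcompose_1)

lemma ratfun_pcompose_coeff:
  assumes "\<And>x. x \<in> D \<Longrightarrow> degree (q x) \<le> m'" "\<And>d. (\<lambda>x. coeff (q x) d) \<in> ratfun m t D"
  shows "(\<lambda>x. coeff (pcompose (q x) r) p) \<in> ratfun m t D"
proof (rule ratfun_cong)
  show "(\<lambda>x. \<Sum>d\<le>m'. coeff (q x) d * coeff (r ^ d) p) \<in> ratfun m t D"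
    by (intro ratfun_sum ratfun_mult ratfun_const assms(2))
qed (rule coeff_pcompose_sum[OF assms(1)])

lemma ratfun_enumerated_parameters:
  fixes tt :: "'p \<Rightarrow> 'd \<Rightarrow> 'k::field_char_0"
  assumes "finite Par" "card Par = m"
  shows "\<exists>t. \<forall>\<pi>\<in>Par. tt \<pi> \<in> ratfun m t D"
proof -
  obtain b where b: "bij_betw b {0..<m} Par" using ex_bij_betw_nat_finite[OF assms(1)] assms(2) by blast
  have "tt \<pi> \<in> ratfun m (\<lambda>x l. tt (b l) x) D" if \<pi>: "\<pi> \<in> Par" for \<pi>
  proof -
    obtain l where "l < m" "b l = \<pi>" using \<pi> b unfolding bij_betw_def by auto
    then show ?thesis using ratfun_var[of l m "\<lambda>x l. tt (b l) x" D] by simp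
  qed
  then show ?thesis by blast
qed

text \<open>A change of coordinates on polynomials of degree at most m: the W coefficients in the
  window starting at deg G are traded for those of Z. With G vanishing to high order at all branch
  points but one, Z influences low-order Taylor coefficients at that point only. Terms above the
  window stay in A, the rest is divided by G.\<close>

lemma poly_window_split:
  fixes q G :: "'a::field poly"
  assumes "degree G = w" "G \<noteq> 0" "W > 0" "degree q \<le> m" "w + W \<le> m + 1"
  shows "\<exists>A Z. q = A + G * Z \<and> degree A \<le> m \<and> (\<forall>d. w \<le> d \<and> d < w + W \<longrightarrow> coeff A d = 0) \<and> degree Z < W"
proof -
  define H where "H = (\<Sum>d\<in>{w + W..m}. monom (coeff q d) d)"
  have H: "coeff H d = (if w + W \<le> d \<and> d \<le> m then coeff q d else 0)" for d
    by (simp add: H_def coeff_sum)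
  define q' where "q' = q - H"
  have "coeff q' d = 0" if "d \<ge> w + W" for d
    using that assms by (cases "d \<le> m") (auto simp: q'_def H coeff_eq_0)
  then have dq: "degree q' < w + W" using assms by (intro degree_lessI) auto
  define A where "A = H + q' mod G"
  define Z where "Z = q' div G"
  have modc: "coeff (q' mod G) d = 0" if "d \<ge> w" for d
    using degree_mod_less[OF assms(2), of q'] assms(1) that by (auto intro: coeff_eq_0)
  have "q = A + G * Z"
    using div_mult_mod_eq[of q' G] by (simp add: A_def Z_def q'_def algebra_simps)
  moreover have "degree A \<le> m"
    using assms modc by (intro degree_le) (auto simp: A_def H)
  moreover have "coeff A d = 0" if "w \<le> d" "d < w + W" for d
    using that modc by (simp add: A_def H)
  moreover have "degree Z < W"
  proof (cases "Z = 0")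
    case False
    have "degree (G * Z) = w + degree Z" using False assms by (simp add: degree_mult_eq)
    moreover have "degree (G * Z) < w + W"
    proof -
      have "G * Z = q' - q' mod G" unfolding Z_def by (simp add: minus_mod_eq_mult_div)
      moreover have "degree (q' mod G) < w + W"
        using degree_mod_less[OF assms(2), of q'] assms by auto
      ultimately show ?thesis using dq by (simp add: degree_diff_less)
    qed
    ultimately show ?thesis by simp
  qed (use assms in simp)
  ultimately show ?thesis by blast
qed

lemma op_apply_at_fps_const: "op_apply_at L a (fps_const c * f) = fps_const c * op_apply_at L a f"
proof -
  have "(fps_deriv ^^ i) (fps_const c * f) = fps_const c * (fps_deriv ^^ i) f" for i
    by (induction i) auto
  then show ?thesis by (simp add: op_apply_at_def sum_distrib_left mult_ac)
qed

lemma op_apply_at_sum: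
  assumes "finite A"
  shows "op_apply_at L a (\<Sum>i\<in>A. f i) = (\<Sum>i\<in>A. op_apply_at L a (f i))"
proof -
  have "(fps_deriv ^^ k) (\<Sum>i\<in>A. f i) = (\<Sum>i\<in>A. (fps_deriv ^^ k) (f i))" for k
    by (induction k) (auto simp: fps_deriv_sum)
  then show ?thesis unfolding op_apply_at_def sum_distrib_left by (simp add: sum_distrib_left) (rule sum.swap)
qed

text \<open>Keeps only what is needed of P: \<open>u i\<close> is g_i minus its constant term
  \<alpha>_i. All branches but the first have order one, the first may have order two.\<close>

locale branch_points =
  fixes \<alpha> :: "nat \<Rightarrow> 'k::field_char_0" and u :: "nat \<Rightarrow> 'k fps" and rP rL dL :: nat
  assumes rP: "rP \<ge> 2" and rL: "rL \<ge> 1"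
    and \<alpha>_inj: "inj_on \<alpha> {1..rP}"
    and u_0: "i \<in> {1..rP} \<Longrightarrow> u i $ 0 = 0"
    and u_1: "i \<in> {2..rP} \<Longrightarrow> u i $ 1 \<noteq> 0"
    and u_2: "u 1 $ 1 \<noteq> 0 \<or> u 1 $ 2 \<noteq> 0"
    and dL: "dL \<ge> (rL * rP - rL + 1) * rP"
begin

definition "ops = {L :: 'k poly poly. degree L = rL \<and> (\<forall>i. degree (coeff L i) \<le> dL)
                 \<and> (\<forall>i\<in>{1..rP}. poly (lead_coeff L) (\<alpha> i) \<noteq> 0)}"

definition "ord = rL * rP"
text \<open>Equal to rL * (rP - 1), the number of initial values at all branches but one. It is also
  the highest jet order that enters the solution coefficients up to index \<open>ord\<close>;
  \<open>dL\<close> is at least (nfree + 1) * rP.\<close>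

definition "nfree = ord - rL"
definition "ncoords = (rL + 1) * (dL + 1)"

text \<open>A relation modulo \<open>x ^ R\<close> between the generators, recorded through its
  component \<open>F i\<close> on each branch. Its scalar coefficients are the initial values of the
  components.\<close>

definition related :: "'k poly poly \<Rightarrow> nat \<Rightarrow> (nat \<Rightarrow> 'k fps) \<Rightarrow> bool" where
  "related L R F \<longleftrightarrow> (\<forall>i\<in>{1..rP}. op_apply_at L (\<alpha> i) (F i) = 0) \<and>
     (\<forall>c<R. (\<Sum>i\<in>{1..rP}. (F i oo u i) $ c) = 0)"

definition degenerate :: "nat \<Rightarrow> 'k poly poly set" where
  "degenerate R = {L \<in> ops. \<exists>F. related L R F \<and> (\<exists>i\<in>{1..rP}. F i \<noteq> 0)}"

text \<open>\<open>F i $ j\<close> is the pivot: the equation on branch i can be solved for Taylor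
  coefficients of the D^j coefficient. Fixing \<open>F i' $ j' = 1\<close> removes the scaling of
  the relation and saves one parameter.\<close>

definition piece :: "nat \<Rightarrow> nat \<times> nat \<times> nat \<times> nat \<Rightarrow> ('k poly poly \<times> (nat \<Rightarrow> 'k fps)) set" where
  "piece R = (\<lambda>(i, j, i', j'). {(L, F). L \<in> ops \<and> related L R F \<and> F i $ j \<noteq> 0 \<and> F i' $ j' = 1})"

definition piece_indices :: "(nat \<times> nat \<times> nat \<times> nat) set" where
  "piece_indices = {(i, j, i', j'). i \<in> {2..rP} \<and> j < rL \<and> i' \<in> {1..rP} \<and> i' \<noteq> i \<and> j' < rL}"

lemma finite_piece_indices: "finite piece_indices"
  by (rule finite_subset[of _ "{2..rP} \<times> {..<rL} \<times> {1..rP} \<times> {..<rL}"]) (auto simp: piece_indices_def)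

lemma nfree_ord: "nfree + rL = ord" "nfree = rL * (rP - 1)" "nfree \<ge> rL" "2 * rL \<le> ord"
proof -
  have "rL * 2 \<le> ord" unfolding ord_def using rP by (intro mult_le_mono) auto
  then show "nfree + rL = ord" "nfree \<ge> rL" "2 * rL \<le> ord" by (auto simp: nfree_def)
  show "nfree = rL * (rP - 1)" by (simp add: nfree_def ord_def diff_mult_distrib2)
qed

lemma dL': "(nfree + 1) * rP \<le> dL"
  using dL by (simp add: nfree_def ord_def)

lemma ops_jet: "L \<in> ops \<Longrightarrow> i \<in> {1..rP} \<Longrightarrow> jet L (\<alpha> i) rL 0 \<noteq> 0"
  by (auto simp: ops_def jet_0)

lemma subdegree_u: "i \<in> {1..rP} \<Longrightarrow> subdegree (u i) > 0 \<and> subdegree (u i) \<le> 2"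
proof -
  assume i: "i \<in> {1..rP}"
  have "u i $ 1 \<noteq> 0 \<or> u i $ 2 \<noteq> 0" using u_1[of i] u_2 i by (cases "i = 1") auto
  then have "u i \<noteq> 0" "subdegree (u i) \<le> 2" by (auto intro: subdegree_leI order.trans[OF subdegree_leI])
  moreover have "subdegree (u i) \<noteq> 0" using u_0[OF i] \<open>u i \<noteq> 0\<close> by (simp add: subdegree_eq_0_iff)
  ultimately show ?thesis by simp
qed

lemma solution_leading:
  assumes "L \<in> ops" "i \<in> {1..rP}" "op_apply_at L (\<alpha> i) F = 0" "F \<noteq> 0"
  obtains j where "j < rL" "F $ j \<noteq> 0" "\<And>k. k < j \<Longrightarrow> F $ k = 0"
proof -
  have "\<exists>j<rL. F $ j \<noteq> 0"
    using op_apply_at_unique[of L rL "\<alpha> i" F] ops_jet[OF assms(1,2)] assms by (auto simp: ops_def)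
  then obtain j where "j < rL" "F $ j \<noteq> 0" by blast
  then have "(LEAST j. F $ j \<noteq> 0) < rL" "F $ (LEAST j. F $ j \<noteq> 0) \<noteq> 0"
    using LeastI[of "\<lambda>j. F $ j \<noteq> 0" j] Least_le[of "\<lambda>j. F $ j \<noteq> 0" j] by auto
  then show ?thesis using that not_less_Least by blast
qed

text \<open>A nonzero solution has order at most rL - 1 and a branch order at most 2, so the
  composition has order at most 2 * (rL - 1). As \<open>2 * rL \<le> ord\<close>, no relation modulo
  \<open>x ^ ord\<close> lives on a single branch.\<close>

lemma composition_nonzero:
  assumes "L \<in> ops" "i \<in> {1..rP}" "op_apply_at L (\<alpha> i) F = 0" "F \<noteq> 0"
  shows "\<exists>c < 2 * rL - 1. (F oo u i) $ c \<noteq> 0"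
proof -
  obtain j where j: "j < rL" "F $ j \<noteq> 0" "\<And>k. k < j \<Longrightarrow> F $ k = 0" using solution_leading[OF assms] by blast
  have "(F oo u i) $ (j * subdegree (u i)) \<noteq> 0"
    using fps_compose_leading_nth[OF j(2,3)] subdegree_u[OF assms(2)] by blast
  moreover have "j * subdegree (u i) \<le> j * 2" using subdegree_u[OF assms(2)] by (intro mult_le_mono) auto
  then have "j * subdegree (u i) < 2 * rL - 1" using j(1) by linarith
  ultimately show ?thesis by blast
qed

text \<open>At least two components of a relation are nonzero, so one of them belongs to a branch
  beyond the first and can serve as pivot, while another is available for normalization.\<close>

lemma degenerate_covered:
  assumes R: "R \<ge> ord" and L: "L \<in> degenerate R"
  shows "\<exists>p\<in>piece_indices. \<exists>F. (L, F) \<in> piece R p"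
proof -
  obtain F i where LV: "L \<in> ops" and F: "related L R F" and i: "i \<in> {1..rP}" "F i \<noteq> 0"
    using L by (auto simp: degenerate_def)
  have sol: "op_apply_at L (\<alpha> k) (F k) = 0" if "k \<in> {1..rP}" for k using F that by (auto simp: related_def)
  have "\<exists>k\<in>{1..rP}. k \<noteq> i \<and> F k \<noteq> 0"
  proof (rule ccontr)
    assume "\<not> ?thesis"
    then have z: "F k = 0" if "k \<in> {1..rP} - {i}" for k using that by auto
    have "(F i oo u i) $ c = 0" if "c < R" for c
    proof -
      have "(\<Sum>k\<in>{1..rP}. (F k oo u k) $ c) = (F i oo u i) $ c + (\<Sum>k\<in>{1..rP} - {i}. (F k oo u k) $ c)"
        using i by (intro sum.remove) auto
      also have "(\<Sum>k\<in>{1..rP} - {i}. (F k oo u k) $ c) = 0" using z by (intro sum.neutral) simp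
      finally show ?thesis using F that by (simp add: related_def)
    qed
    moreover obtain c where "c < 2 * rL - 1" "(F i oo u i) $ c \<noteq> 0"
      using composition_nonzero[OF LV i(1) sol[OF i(1)] i(2)] by blast
    ultimately show False using nfree_ord(4) R by auto
  qed
  then obtain k where k: "k \<in> {1..rP}" "k \<noteq> i" "F k \<noteq> 0" by blast
  obtain a b where ab: "a \<in> {2..rP}" "b \<in> {1..rP}" "b \<noteq> a" "F a \<noteq> 0" "F b \<noteq> 0"
  proof (cases "i = 1")
    case True
    then show ?thesis using that[of k i] i k by auto
  next
    case False
    then show ?thesis using that[of i k] i k by auto
  qed
  have a1: "a \<in> {1..rP}" using ab by auto
  obtain j where j: "j < rL" "F a $ j \<noteq> 0" using solution_leading[OF LV a1 sol[OF a1] ab(4)] by blast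
  obtain j' where j': "j' < rL" "F b $ j' \<noteq> 0" using solution_leading[OF LV ab(2) sol[OF ab(2)] ab(5)] by blast
  define c where "c = inverse (F b $ j')"
  define F' where "F' = (\<lambda>i. fps_const c * F i)"
  have "related L R F'"
    unfolding related_def
  proof (intro conjI ballI allI impI)
    fix i assume "i \<in> {1..rP}"
    then show "op_apply_at L (\<alpha> i) (F' i) = 0" by (simp add: F'_def op_apply_at_fps_const sol)
  next
    fix l assume "l < R"
    have "(F' i oo u i) $ l = c * (F i oo u i) $ l" for i
      by (simp add: F'_def fps_compose_nth sum_distrib_left mult.assoc)
    then show "(\<Sum>i\<in>{1..rP}. (F' i oo u i) $ l) = 0"
      using F \<open>l < R\<close> by (simp add: sum_distrib_left[symmetric] related_def)
  qed
  then have "(L, F') \<in> piece R (a, j, b, j')"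
    using LV j j' by (simp add: piece_def F'_def c_def)
  then show ?thesis using ab j j' by (intro bexI[of _ "(a, j, b, j')"]) (auto simp: piece_indices_def)
qed

text \<open>Multiples of this polynomial do not affect the jets of orders 0 to \<open>nfree\<close>
  at any branch point except \<alpha>_i.\<close>

definition other_points :: "nat \<Rightarrow> 'k poly" where
  "other_points i = (\<Prod>k\<in>{1..rP} - {i}. [:- \<alpha> k, 1:] ^ (nfree + 1))"

lemma degree_other_points:
  assumes "i \<in> {1..rP}" shows "degree (other_points i) = (nfree + 1) * (rP - 1)" "other_points i \<noteq> 0"
proof -
  have "degree (other_points i) = (\<Sum>k\<in>{1..rP} - {i}. degree ([:- \<alpha> k, 1:] ^ (nfree + 1)))"
    unfolding other_points_def by (rule degree_prod_eq_sum_degree) (simp del: power_Suc)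
  also have "\<dots> = (nfree + 1) * (rP - 1)" using assms by (simp add: degree_power_eq mult.commute del: power_Suc)
  finally show "degree (other_points i) = (nfree + 1) * (rP - 1)" .
  show "other_points i \<noteq> 0" by (simp add: other_points_def del: power_Suc)
qed

lemma other_points_at:
  assumes "k \<in> {1..rP} - {i}" "p \<le> nfree"
  shows "coeff (pcompose (other_points i * Z) [:\<alpha> k, 1:]) p = 0"
proof -
  have "[:- \<alpha> k, 1:] ^ (nfree + 1) dvd other_points i"
    unfolding other_points_def using assms by (intro dvd_prodI) auto
  then obtain Y where "other_points i = [:- \<alpha> k, 1:] ^ (nfree + 1) * Y" by blast
  then have "pcompose (other_points i * Z) [:\<alpha> k, 1:] =
    pcompose ([:- \<alpha> k, 1:] ^ (nfree + 1)) [:\<alpha> k, 1:] * pcompose (Y * Z) [:\<alpha> k, 1:]"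
    by (simp only: pcompose_mult[symmetric] mult.assoc)
  also have "pcompose ([:- \<alpha> k, 1:] ^ (nfree + 1)) [:\<alpha> k, 1:] = monom 1 (nfree + 1)"
    by (simp add: pcompose_power pcompose_pCons monom_altdef del: power_Suc)
  finally show ?thesis using assms(2) by (simp add: coeff_monom_mult)
qed

lemma other_points_own:
  assumes "i \<in> {1..rP}"
  shows "coeff (pcompose (other_points i) [:\<alpha> i, 1:]) 0 \<noteq> 0"
proof -
  have "coeff (pcompose (other_points i) [:\<alpha> i, 1:]) 0 = poly (other_points i) (\<alpha> i)"
    by (simp add: poly_0_coeff_0[symmetric] poly_pcompose)
  also have "\<dots> = (\<Prod>k\<in>{1..rP} - {i}. (\<alpha> i - \<alpha> k) ^ (nfree + 1))"
    by (simp add: other_points_def poly_prod del: power_Suc)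
  finally have "coeff (pcompose (other_points i) [:\<alpha> i, 1:]) 0 = (\<Prod>k\<in>{1..rP} - {i}. (\<alpha> i - \<alpha> k) ^ (nfree + 1))" .
  moreover have "\<alpha> i - \<alpha> k \<noteq> 0" if "k \<in> {1..rP} - {i}" for k
    using inj_onD[OF \<alpha>_inj, of i k] assms that by auto
  ultimately show ?thesis by (simp del: power_Suc)
qed

end

context branch_points
begin

text \<open>On a piece, the relation determines the solution at \<open>\<alpha> i\<close>, and the equation \<open>L (F i) = 0\<close>
  then determines the Taylor coefficients at \<open>\<alpha> i\<close> of the coefficient of \<open>D ^ j\<close> in \<open>L\<close>. So these
  \<open>R - rL\<close> coordinates of \<open>L\<close> are traded for the initial values of the other solutions.\<close>

lemma piece_parametrized:
  assumes R: "ord \<le> R" "R \<le> ord + 1" and p: "p \<in> piece_indices"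
  shows "\<exists>t. \<forall>l<ncoords. (\<lambda>x. op_coords rL dL (fst x) l) \<in> ratfun (ncoords - 1 - (R - ord)) t (piece R p)"
proof -
  obtain i j i' j' where pe: "p = (i, j, i', j')" and i2: "i \<in> {2..rP}" and j: "j < rL"
    and i': "i' \<in> {1..rP} - {i}" and j': "j' < rL"
    using p by (auto simp: piece_indices_def)
  have i: "i \<in> {1..rP}" using i2 by auto
  let ?I = "{1..rP} - {i}"
  \<comment> \<open>Equation s of L (F i) = 0 reads coefficients of \<open>F i\<close> up to index s
    + rL, and the relation determines these below R; so the equations with s < R - rL are
    usable.\<close>
  define W where "W = R - rL"
  define w where "w = (nfree + 1) * (rP - 1)"
  define G where "G = other_points i"
  have W: "W > 0" "W \<le> nfree + 1" "W + rL = R" using nfree_ord rL R by (auto simp: W_def)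
  have wW: "w + W \<le> dL"
  proof -
    have "w + W \<le> (nfree + 1) * (rP - 1) + (nfree + 1)" using W by (simp add: w_def)
    also have "\<dots> = (nfree + 1) * rP" using rP by (cases rP) auto
    finally show ?thesis using dL' by simp
  qed
  have "\<forall>q. \<exists>A Z. degree q \<le> dL \<longrightarrow> q = A + G * Z \<and> degree A \<le> dL \<and>
    (\<forall>d. w \<le> d \<and> d < w + W \<longrightarrow> coeff A d = 0) \<and> degree Z < W"
    using poly_window_split[OF degree_other_points[OF i] W(1)] wW unfolding G_def w_def
    by (meson trans_le_add1)
  then obtain Apart Zpart where "\<forall>q. degree q \<le> dL \<longrightarrow> q = Apart q + G * Zpart q \<and> degree (Apart q) \<le> dL \<and>
    (\<forall>d. w \<le> d \<and> d < w + W \<longrightarrow> coeff (Apart q) d = 0) \<and> degree (Zpart q) < W"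
    unfolding choice_iff by blast
  then have split: "\<And>q. degree q \<le> dL \<Longrightarrow> q = Apart q + G * Zpart q"
    and Adeg: "\<And>q. degree q \<le> dL \<Longrightarrow> degree (Apart q) \<le> dL"
    and Awin: "\<And>q d. degree q \<le> dL \<Longrightarrow> w \<le> d \<Longrightarrow> d < w + W \<Longrightarrow> coeff (Apart q) d = 0"
    and Zdeg: "\<And>q. degree q \<le> dL \<Longrightarrow> degree (Zpart q) < W" by blast+

  let ?A = "\<lambda>x :: 'k poly poly \<times> (nat \<Rightarrow> 'k fps). Apart (coeff (fst x) j)"
  let ?Z = "\<lambda>x :: 'k poly poly \<times> (nat \<Rightarrow> 'k fps). Zpart (coeff (fst x) j)"
  define m where "m = ncoords - 1 - (R - ord)"
  define D where "D = piece R p"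
  have DV: "fst x \<in> ops" if "x \<in> D" for x using that by (auto simp: D_def piece_def pe)
  have Dsol: "op_apply_at (fst x) (\<alpha> k) (snd x k) = 0" if "x \<in> D" "k \<in> {1..rP}" for x k
    using that by (auto simp: D_def piece_def pe related_def)
  have Drel: "(\<Sum>k\<in>{1..rP}. (snd x k oo u k) $ c) = 0" if "x \<in> D" "c < R" for x c
    using that by (auto simp: D_def piece_def pe related_def)
  have Dj: "snd x i $ j \<noteq> 0" and Dj': "snd x i' $ j' = 1" if "x \<in> D" for x
    using that by (auto simp: D_def piece_def pe)
  have Ddeg: "degree (fst x) = rL" "degree (coeff (fst x) k) \<le> dL" if "x \<in> D" for x k
    using DV[OF that] by (auto simp: ops_def)

  \<comment> \<open>The coordinates of L outside the window, with the D^j coefficient replaced by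
    its part A, and the initial values on the other branches except the normalized one. These are
    ncoords - W + nfree - 1 parameters, which is the required number.\<close>
  define Par where "Par = Inl ` ({..rL} \<times> {..dL} - {j} \<times> {w..<w + W}) \<union> Inr ` (?I \<times> {..<rL} - {(i', j')})"
  define tt :: "nat \<times> nat + nat \<times> nat \<Rightarrow> 'k poly poly \<times> (nat \<Rightarrow> 'k fps) \<Rightarrow> 'k"
    where "tt = (\<lambda>\<pi> x. case \<pi> of Inl (k, d) \<Rightarrow> if k = j then coeff (?A x) d else coeff (coeff (fst x) k) d
     | Inr (k, q) \<Rightarrow> snd x k $ q)"
  have "finite Par" by (auto simp: Par_def)
  moreover have "card Par = m"
  proof -
    have "card ({..rL} \<times> {..dL} - {j} \<times> {w..<w + W}) = ncoords - W"
      using j wW by (subst card_Diff_subset) (auto simp: ncoords_def)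
    moreover have "card (?I \<times> {..<rL} - {(i', j')}) = nfree - 1"
      using i i' j' by (subst card_Diff_subset) (auto simp: nfree_ord(2) mult.commute)
    ultimately have "card Par = (ncoords - W) + (nfree - 1)"
      unfolding Par_def by (subst card_Un_disjoint) (auto simp: card_image)
    moreover have "W \<le> dL" using wW by simp
    then have "W < ncoords" by (auto simp: ncoords_def)
    ultimately show ?thesis using R nfree_ord rL by (simp add: m_def W_def)
  qed
  ultimately obtain t where t: "\<And>\<pi>. \<pi> \<in> Par \<Longrightarrow> tt \<pi> \<in> ratfun m t D"
    using ratfun_enumerated_parameters[of Par m tt D] by blast

  have coef: "(\<lambda>x. coeff (coeff (fst x) k) d) \<in> ratfun m t D" if k: "k \<le> rL" "k \<noteq> j" for k d
  proof (cases "d \<le> dL")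
    case True
    then have "Inl (k, d) \<in> Par" using k by (auto simp: Par_def)
    from t[OF this] show ?thesis using k by (simp add: tt_def)
  next
    case False
    have "coeff (coeff (fst x) k) d = 0" if "x \<in> D" for x
      using False Ddeg(2)[OF that, of k] by (intro coeff_eq_0) simp
    then show ?thesis by (intro ratfun_cong[OF ratfun_const[of 0]])
  qed
  have Acoef: "(\<lambda>x. coeff (?A x) d) \<in> ratfun m t D" for d
  proof (cases "d \<le> dL \<and> d \<notin> {w..<w + W}")
    case True
    then have "Inl (j, d) \<in> Par" using j by (auto simp: Par_def)
    from t[OF this] show ?thesis by (simp add: tt_def)
  next
    case False
    have "coeff (?A x) d = 0" if "x \<in> D" for x
    proof (cases "d \<le> dL")
      case True
      then show ?thesis using False Awin[OF Ddeg(2)[OF that]] by simp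
    next
      case False
      then show ?thesis using Adeg[OF Ddeg(2)[OF that], of j] by (intro coeff_eq_0) simp
    qed
    then show ?thesis by (intro ratfun_cong[OF ratfun_const[of 0]])
  qed
  have Ajet: "(\<lambda>x. coeff (pcompose (?A x) r) q) \<in> ratfun m t D" for r q
    using Adeg[OF Ddeg(2)] by (intro ratfun_pcompose_coeff[of _ _ dL] Acoef)
  have jet_other: "(\<lambda>x. jet (fst x) a k q) \<in> ratfun m t D" if "k \<le> rL" "k \<noteq> j" for a k q
    unfolding jet_def using Ddeg(2) by (intro ratfun_pcompose_coeff[of _ _ dL] coef that)
  \<comment> \<open>G vanishes to order nfree + 1 at the other branch points, so the still unknown Z
    does not enter the jets that determine the solutions there.\<close>
  have jet_j: "(\<lambda>x. jet (fst x) (\<alpha> k) j q) \<in> ratfun m t D" if k: "k \<in> ?I" "q \<le> nfree" for k q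
  proof (rule ratfun_cong[OF Ajet[of "[:\<alpha> k, 1:]" q]])
    fix x assume x: "x \<in> D"
    have "coeff (pcompose (G * ?Z x) [:\<alpha> k, 1:]) q = 0"
      unfolding G_def by (rule other_points_at[OF k])
    then show "jet (fst x) (\<alpha> k) j q = coeff (pcompose (?A x) [:\<alpha> k, 1:]) q"
      unfolding jet_def by (subst split[OF Ddeg(2)[OF x]]) (simp add: pcompose_add)
  qed
  have Fother: "(\<lambda>x. snd x k $ q) \<in> ratfun m t D" if k: "k \<in> ?I" and q: "q \<le> ord" for k q
  proof (rule ratfun_solution_coeffs[where L=fst and r=rL and n=nfree and a="\<alpha> k"])
    show "q \<le> nfree + rL" using q nfree_ord(1) by simp
    show "degree (fst x) \<le> rL" if "x \<in> D" for x using Ddeg[OF that] by simp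
    show "jet (fst x) (\<alpha> k) rL 0 \<noteq> 0" if "x \<in> D" for x using ops_jet[OF DV[OF that]] k by blast
    show "op_apply_at (fst x) (\<alpha> k) (snd x k) $ s = 0" if "x \<in> D" for x s using Dsol[OF that] k by simp
    show "(\<lambda>x. jet (fst x) (\<alpha> k) l s) \<in> ratfun m t D" if "l \<le> rL" "s \<le> nfree" for l s
      using jet_other jet_j[OF k] that by (cases "l = j") auto
    show "(\<lambda>x. snd x k $ l) \<in> ratfun m t D" if l: "l < rL" for l
    proof (cases "(k, l) = (i', j')")
      case True
      then show ?thesis using Dj' by (intro ratfun_cong[OF ratfun_const[of 1]]) auto
    next
      case False
      then have "Inr (k, l) \<in> Par" using k l by (auto simp: Par_def)
      from t[OF this] show ?thesis by (simp add: tt_def)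
    qed
  qed
  have comp_i: "(\<lambda>x. (snd x i oo u i) $ c) \<in> ratfun m t D" if c: "c < R" for c
  proof (rule ratfun_cong)
    show "(\<lambda>x. - (\<Sum>k\<in>?I. (snd x k oo u k) $ c)) \<in> ratfun m t D"
      using c R by (intro ratfun_uminus ratfun_sum ratfun_compose_nth Fother) auto
    fix x assume x: "x \<in> D"
    have "(\<Sum>k\<in>{1..rP}. (snd x k oo u k) $ c) = (snd x i oo u i) $ c + (\<Sum>k\<in>?I. (snd x k oo u k) $ c)"
      using i by (intro sum.remove) auto
    then show "(snd x i oo u i) $ c = - (\<Sum>k\<in>?I. (snd x k oo u k) $ c)"
      using Drel[OF x c] by (simp add: eq_neg_iff_add_eq_0)
  qed
  have F_i: "(\<lambda>x. snd x i $ q) \<in> ratfun m t D" if "q < R" for q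
    using ratfun_decompose_nth[of "u i" R "\<lambda>x. snd x i", OF u_0[OF i] u_1[OF i2] comp_i that] .

  define \<gamma> where "\<gamma> = (\<lambda>q. coeff (pcompose G [:\<alpha> i, 1:]) q)"
  have \<gamma>0: "\<gamma> 0 \<noteq> 0" using other_points_own[OF i] by (simp add: \<gamma>_def G_def)
  define \<zeta> :: "nat \<Rightarrow> 'k poly poly \<times> (nat \<Rightarrow> 'k fps) \<Rightarrow> 'k" where "\<zeta> = (\<lambda>q x. coeff (pcompose (?Z x) [:\<alpha> i, 1:]) q)"
  have jetZ: "jet (fst x) (\<alpha> i) j q = coeff (pcompose (?A x) [:\<alpha> i, 1:]) q + (\<Sum>l\<le>q. \<gamma> (q - l) * \<zeta> l x)"
    if x: "x \<in> D" for x q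
  proof -
    have "jet (fst x) (\<alpha> i) j q = coeff (pcompose (?A x) [:\<alpha> i, 1:] +
      pcompose (?Z x) [:\<alpha> i, 1:] * pcompose G [:\<alpha> i, 1:]) q"
      unfolding jet_def by (subst split[OF Ddeg(2)[OF x]]) (simp only: pcompose_add pcompose_mult mult.commute)
    then show ?thesis unfolding coeff_add coeff_mult \<gamma>_def \<zeta>_def by (simp only: mult.commute)
  qed
  \<comment> \<open>Equation s contains the order-s jet of the D^j coefficient with factor j! * F i
    $ j, nonzero on the piece; all other terms are already rational in the parameters. The matching
    Taylor coefficient of Z follows by dividing by the value of G at \<alpha>_i.\<close>
  have own: "s < W \<longrightarrow> (\<lambda>x. jet (fst x) (\<alpha> i) j s) \<in> ratfun m t D \<and> \<zeta> s \<in> ratfun m t D" for s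
  proof (induction s rule: less_induct)
    case (less s)
    show ?case
    proof
      assume s: "s < W"
      define T where "T = {..rL} \<times> {..s} - {(j, s)}"
      define rest where "rest = (\<lambda>x. \<Sum>y\<in>T. jet (fst x) (\<alpha> i) (fst y) (snd y) *
        (pochhammer (of_nat (s - snd y + 1)) (fst y) * snd x i $ (s - snd y + fst y)))"
      have rest: "rest \<in> ratfun m t D" unfolding rest_def
      proof (intro ratfun_sum ratfun_mult ratfun_const)
        fix y assume y: "y \<in> T"
        show "(\<lambda>x. jet (fst x) (\<alpha> i) (fst y) (snd y)) \<in> ratfun m t D"
        proof (cases "fst y = j")
          case True
          then have "snd y < s" using y by (cases y) (auto simp: T_def)
          then show ?thesis using less.IH[of "snd y"] s True by simp
        next
          case False
          then show ?thesis using y by (intro jet_other) (auto simp: T_def)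
        qed
        show "(\<lambda>x. snd x i $ (s - snd y + fst y)) \<in> ratfun m t D"
          using y s W by (intro F_i) (auto simp: T_def)
      qed
      have eq: "jet (fst x) (\<alpha> i) j s = - rest x / (pochhammer 1 j * snd x i $ j)" if x: "x \<in> D" for x
      proof -
        have "0 = op_apply_at (fst x) (\<alpha> i) (snd x i) $ s" using Dsol[OF x i] by simp
        also have "\<dots> = (\<Sum>y\<in>{..rL} \<times> {..s}. jet (fst x) (\<alpha> i) (fst y) (snd y) *
          (pochhammer (of_nat (s - snd y + 1)) (fst y) * snd x i $ (s - snd y + fst y)))"
          using op_apply_at_nth[of "fst x" rL "\<alpha> i" "snd x i" s, OF eq_refl[OF Ddeg(1)[OF x]]]
          unfolding sum.cartesian_product case_prod_beta .
        also have "\<dots> = jet (fst x) (\<alpha> i) j s * (pochhammer 1 j * snd x i $ j) + rest x"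
          unfolding rest_def T_def using j by (subst sum.remove[of _ "(j, s)"]) auto
        finally show ?thesis using Dj[OF x] by (simp add: field_simps pochhammer_fact[symmetric] eq_neg_iff_add_eq_0)
      qed
      have js: "(\<lambda>x. jet (fst x) (\<alpha> i) j s) \<in> ratfun m t D"
      proof (rule ratfun_cong[OF _ eq])
        show "(\<lambda>x. - rest x / (pochhammer 1 j * snd x i $ j)) \<in> ratfun m t D"
          using j W Dj by (intro ratfun_divide ratfun_uminus rest ratfun_mult ratfun_const F_i)
            (auto simp: pochhammer_fact[symmetric])
      qed
      have "\<zeta> s \<in> ratfun m t D"
      proof (rule ratfun_cong)
        show "(\<lambda>x. (jet (fst x) (\<alpha> i) j s - coeff (pcompose (?A x) [:\<alpha> i, 1:]) s -
            (\<Sum>l<s. \<gamma> (s - l) * \<zeta> l x)) / \<gamma> 0) \<in> ratfun m t D"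
          using \<gamma>0 less.IH s by (intro ratfun_divide ratfun_diff js Ajet ratfun_sum ratfun_mult ratfun_const) auto
        fix x assume x: "x \<in> D"
        have "(\<Sum>l\<le>s. \<gamma> (s - l) * \<zeta> l x) = (\<Sum>l<s. \<gamma> (s - l) * \<zeta> l x) + \<gamma> 0 * \<zeta> s x"
          by (simp add: lessThan_Suc_atMost[symmetric])
        then show "\<zeta> s x = (jet (fst x) (\<alpha> i) j s - coeff (pcompose (?A x) [:\<alpha> i, 1:]) s -
            (\<Sum>l<s. \<gamma> (s - l) * \<zeta> l x)) / \<gamma> 0"
          using jetZ[OF x, of s] \<gamma>0 by (simp add: field_simps)
      qed
      with js show "(\<lambda>x. jet (fst x) (\<alpha> i) j s) \<in> ratfun m t D \<and> \<zeta> s \<in> ratfun m t D" by blast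
    qed
  qed
  have Zcoef: "(\<lambda>x. coeff (?Z x) d) \<in> ratfun m t D" for d
  proof (rule ratfun_cong)
    have deg: "degree (pcompose (?Z x) [:\<alpha> i, 1:]) < W" if "x \<in> D" for x
      using Zdeg[OF Ddeg(2)[OF that], of j] by (simp add: degree_pcompose)
    show "(\<lambda>x. coeff (pcompose (pcompose (?Z x) [:\<alpha> i, 1:]) [:- \<alpha> i, 1:]) d) \<in> ratfun m t D"
    proof (rule ratfun_pcompose_coeff[of _ _ W])
      show "degree (pcompose (?Z x) [:\<alpha> i, 1:]) \<le> W" if "x \<in> D" for x using deg[OF that] by simp
      show "(\<lambda>x. coeff (pcompose (?Z x) [:\<alpha> i, 1:]) s) \<in> ratfun m t D" for s
      proof (cases "s < W")
        case True
        then show ?thesis using own[of s] by (simp add: \<zeta>_def)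
      next
        case False
        have "coeff (pcompose (?Z x) [:\<alpha> i, 1:]) s = 0" if "x \<in> D" for x
          using False deg[OF that] by (intro coeff_eq_0) simp
        then show ?thesis by (intro ratfun_cong[OF ratfun_const[of 0]])
      qed
    qed
    show "coeff (?Z x) d = coeff (pcompose (pcompose (?Z x) [:\<alpha> i, 1:]) [:- \<alpha> i, 1:]) d" for x
      by (simp add: pcompose_assoc[symmetric] pcompose_pCons)
  qed
  have coef_j: "(\<lambda>x. coeff (coeff (fst x) j) d) \<in> ratfun m t D" for d
  proof (rule ratfun_cong)
    show "(\<lambda>x. coeff (?A x) d + (\<Sum>l\<le>d. coeff G l * coeff (?Z x) (d - l))) \<in> ratfun m t D"
      by (intro ratfun_add Acoef ratfun_sum ratfun_mult ratfun_const Zcoef)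
    show "coeff (coeff (fst x) j) d = coeff (?A x) d + (\<Sum>l\<le>d. coeff G l * coeff (?Z x) (d - l))"
      if "x \<in> D" for x
      using arg_cong[OF split[OF Ddeg(2)[OF that, of j]], of "\<lambda>q. coeff q d"] by (simp add: coeff_mult)
  qed
  have "(\<lambda>x. op_coords rL dL (fst x) l) \<in> ratfun m t D" if l: "l < ncoords" for l
  proof -
    have "l div (dL + 1) \<le> rL" using l by (metis Suc_eq_plus1 less_Suc_eq_le less_mult_imp_div_less ncoords_def)
    then show ?thesis using l coef coef_j by (cases "l div (dL + 1) = j") (simp_all add: op_coords_def ncoords_def)
  qed
  then show ?thesis unfolding m_def D_def by blast
qed

definition coords :: "'k poly poly \<Rightarrow> nat \<Rightarrow> 'k" where
  "coords = op_coords rL dL"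

lemma degenerate_parametrized:
  assumes R: "ord \<le> R" "R \<le> ord + 1"
  obtains t where "\<And>p l. p \<in> piece_indices \<Longrightarrow> l < ncoords \<Longrightarrow>
      (\<lambda>x. coords (fst x) l) \<in> ratfun (ncoords - 1 - (R - ord)) (t p) (piece R p)"
    and "coords ` degenerate R \<subseteq> (\<Union>p\<in>piece_indices. (\<lambda>x. coords (fst x)) ` piece R p)"
proof -
  have "\<forall>p\<in>piece_indices. \<exists>t. \<forall>l<ncoords. (\<lambda>x. coords (fst x) l) \<in> ratfun (ncoords - 1 - (R - ord)) t (piece R p)"
    using piece_parametrized[OF R] unfolding coords_def by blast
  then obtain t where t: "\<forall>p\<in>piece_indices. \<forall>l<ncoords.
      (\<lambda>x. coords (fst x) l) \<in> ratfun (ncoords - 1 - (R - ord)) (t p) (piece R p)"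
    unfolding bchoice_iff by blast
  moreover have "coords ` degenerate R \<subseteq> (\<Union>p\<in>piece_indices. (\<lambda>x. coords (fst x)) ` piece R p)"
    using degenerate_covered[OF R(1)] by force
  ultimately show ?thesis using that by blast
qed

text \<open>For R = ord + 1 the bound is ncoords - 2. It holds for every subset S, closed or not,
  since only a parametrized cover is needed.\<close>

lemma degenerate_dim_le:
  assumes R: "ord \<le> R" "R \<le> ord + 1" and S: "S \<subseteq> degenerate R" and "irr_chain ncoords (coords ` S) len"
  shows "len \<le> ncoords - 1 - (R - ord)"
proof -
  obtain t where t: "\<And>p l. p \<in> piece_indices \<Longrightarrow> l < ncoords \<Longrightarrow>
      (\<lambda>x. coords (fst x) l) \<in> ratfun (ncoords - 1 - (R - ord)) (t p) (piece R p)"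
    and cover: "coords ` degenerate R \<subseteq> (\<Union>p\<in>piece_indices. (\<lambda>x. coords (fst x)) ` piece R p)"
    by (rule degenerate_parametrized[OF R]) blast
  have "coords ` S \<subseteq> (\<Union>p\<in>piece_indices. (\<lambda>x. coords (fst x)) ` piece R p)"
    using S cover by blast
  then show ?thesis
    by (rule irr_chain_length_le[where \<phi>="\<lambda>_ x. coords (fst x)", OF finite_piece_indices _ t assms(4)])
qed

text \<open>Provides a nonzero polynomial condition whose failure certifies that an operator is not
  degenerate. The functions h allow this on a hyperplane of coordinates as well as on the full
  space.\<close>

lemma degenerate_relation:
  assumes R: "ord \<le> R" "R \<le> ord + 1" and n: "n > ncoords - 1 - (R - ord)"
    and h: "\<And>k. k < n \<Longrightarrow> h k \<in> polyfun ncoords"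
  shows "\<exists>p\<in>polyfun n. (\<exists>v. p v \<noteq> 0) \<and> (\<forall>L\<in>degenerate R. p (\<lambda>k. h k (coords L)) = 0)"
proof -
  obtain t where t: "\<And>p l. p \<in> piece_indices \<Longrightarrow> l < ncoords \<Longrightarrow>
      (\<lambda>x. coords (fst x) l) \<in> ratfun (ncoords - 1 - (R - ord)) (t p) (piece R p)"
    and cover: "coords ` degenerate R \<subseteq> (\<Union>p\<in>piece_indices. (\<lambda>x. coords (fst x)) ` piece R p)"
    by (rule degenerate_parametrized[OF R]) blast
  obtain p where p: "p \<in> polyfun n" "\<exists>v. p v \<noteq> 0" "\<forall>q\<in>piece_indices. \<forall>x\<in>piece R q. p (\<lambda>k. h k (coords (fst x))) = 0"
    using algebraic_relation_on_parametrized[where \<phi>="\<lambda>_ x. coords (fst x)" and t=t and D="piece R" and h=h,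
        OF finite_piece_indices n] h t by blast
  have "p (\<lambda>k. h k (coords L)) = 0" if "L \<in> degenerate R" for L
    using that cover p(3) by fastforce
  with p show ?thesis by blast
qed

end

section \<open>Determinants\<close>

text \<open>Indexing by functions lets a row be replaced by a function update.\<close>

definition fun_det :: "nat \<Rightarrow> (nat \<Rightarrow> nat \<Rightarrow> 'a::comm_ring_1) \<Rightarrow> 'a" where
  "fun_det r X = det (mat r r (\<lambda>(a, b). X a b))"

lemma fun_det_altdef: "fun_det r X = (\<Sum>p | p permutes {0..<r}. signof p * (\<Prod>a\<in>{0..<r}. X a (p a)))"
proof -
  have "mat r r (\<lambda>(a, b). X a b) $$ (a, p a) = X a (p a)" if "p permutes {0..<r}" "a \<in> {0..<r}" for p a
    using that permutes_in_image[OF that(1), of a] by simp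
  then show ?thesis unfolding fun_det_def by (subst det_def'[of _ r]) (auto intro!: sum.cong prod.cong)
qed

lemma fun_det_cong: "(\<And>a b. a < r \<Longrightarrow> b < r \<Longrightarrow> X a b = Y a b) \<Longrightarrow> fun_det r X = fun_det r Y"
  unfolding fun_det_def by (intro arg_cong[of _ _ det] cong_mat) auto

lemma fun_det_eq_0_iff:
  fixes X :: "nat \<Rightarrow> nat \<Rightarrow> 'a::field"
  shows "fun_det r X = 0 \<longleftrightarrow> (\<exists>c. (\<exists>a<r. c a \<noteq> 0) \<and> (\<forall>b<r. (\<Sum>a<r. c a * X a b) = 0))"
proof -
  define B where "B = mat r r (\<lambda>(b, a). X a b)"
  have B: "B \<in> carrier_mat r r" by (simp add: B_def)
  have "transpose_mat B = mat r r (\<lambda>(a, b). X a b)" by (auto simp: B_def)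
  then have "fun_det r X = det B" using det_transpose[OF B] by (simp add: fun_det_def)
  then have "fun_det r X = 0 \<longleftrightarrow> (\<exists>v. v \<in> carrier_vec r \<and> v \<noteq> 0\<^sub>v r \<and> B *\<^sub>v v = 0\<^sub>v r)"
    using det_0_iff_vec_prod_zero_field[OF B] by simp
  also have "\<dots> \<longleftrightarrow> (\<exists>c. (\<exists>a<r. c a \<noteq> 0) \<and> (\<forall>b<r. (\<Sum>a<r. c a * X a b) = 0))"
  proof
    assume "\<exists>v. v \<in> carrier_vec r \<and> v \<noteq> 0\<^sub>v r \<and> B *\<^sub>v v = 0\<^sub>v r"
    then obtain v where v: "v \<in> carrier_vec r" "v \<noteq> 0\<^sub>v r" "B *\<^sub>v v = 0\<^sub>v r" by blast
    have "\<exists>a<r. vec_index v a \<noteq> 0" using v(1,2) by (metis carrier_vecD eq_vecI index_zero_vec(1) index_zero_vec(2))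
    moreover have "(\<Sum>a<r. vec_index v a * X a b) = 0" if b: "b < r" for b
    proof -
      have "vec_index (B *\<^sub>v v) b = (\<Sum>a<r. vec_index v a * X a b)"
        using b v(1) by (auto simp: B_def scalar_prod_def row_def mult.commute atLeast0LessThan intro!: sum.cong)
      then show ?thesis using v(3) b by simp
    qed
    ultimately show "\<exists>c. (\<exists>a<r. c a \<noteq> 0) \<and> (\<forall>b<r. (\<Sum>a<r. c a * X a b) = 0)" by blast
  next
    assume "\<exists>c. (\<exists>a<r. c a \<noteq> 0) \<and> (\<forall>b<r. (\<Sum>a<r. c a * X a b) = 0)"
    then obtain c a where c: "a < r" "c a \<noteq> 0" "\<And>b. b < r \<Longrightarrow> (\<Sum>a<r. c a * X a b) = 0" by blast
    have "vec_index (vec r c) a \<noteq> vec_index (0\<^sub>v r) a" using c by simp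
    then have "vec r c \<noteq> 0\<^sub>v r" by metis
    moreover have "B *\<^sub>v vec r c = 0\<^sub>v r"
    proof (rule eq_vecI)
      fix b assume "b < dim_vec (0\<^sub>v r)"
      then have b: "b < r" by simp
      have "vec_index (B *\<^sub>v vec r c) b = (\<Sum>a<r. c a * X a b)"
        using b by (auto simp: B_def scalar_prod_def row_def mult.commute atLeast0LessThan intro!: sum.cong)
      then show "vec_index (B *\<^sub>v vec r c) b = vec_index (0\<^sub>v r) b" using c(3)[OF b] b by simp
    qed (simp add: B_def)
    ultimately show "\<exists>v. v \<in> carrier_vec r \<and> v \<noteq> 0\<^sub>v r \<and> B *\<^sub>v v = 0\<^sub>v r"
      by (intro exI[of _ "vec r c"]) auto
  qed
  finally show ?thesis .
qed

text \<open>Linearity in row a0; the last determinant is the cofactor of the entry (a0, b0).\<close>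

lemma fun_det_add_entry:
  assumes "a0 < r"
  shows "fun_det r (\<lambda>a b. X a b + (if a = a0 \<and> b = b0 then z else 0)) =
    fun_det r X + z * fun_det r (X(a0 := (\<lambda>b. if b = b0 then 1 else 0)))"
proof -
  have split: "(\<Prod>a\<in>{0..<r}. f a) = f a0 * (\<Prod>a\<in>{0..<r} - {a0}. f a)" for f :: "nat \<Rightarrow> 'a"
    using assms by (intro prod.remove) auto
  have "(\<Prod>a\<in>{0..<r}. X a (p a) + (if a = a0 \<and> p a = b0 then z else 0)) =
    (\<Prod>a\<in>{0..<r}. X a (p a)) + z * (\<Prod>a\<in>{0..<r}. (X(a0 := (\<lambda>b. if b = b0 then 1 else 0))) a (p a))" for p
  proof -
    have "(\<Prod>a\<in>{0..<r} - {a0}. X a (p a) + (if a = a0 \<and> p a = b0 then z else 0)) = (\<Prod>a\<in>{0..<r} - {a0}. X a (p a))"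
      by (intro prod.cong) auto
    moreover have "(\<Prod>a\<in>{0..<r} - {a0}. (X(a0 := (\<lambda>b. if b = b0 then 1 else 0))) a (p a)) = (\<Prod>a\<in>{0..<r} - {a0}. X a (p a))"
      by (intro prod.cong) auto
    ultimately show ?thesis unfolding split by (simp add: algebra_simps)
  qed
  then show ?thesis unfolding fun_det_altdef by (simp add: algebra_simps sum.distrib sum_distrib_left)
qed

lemma ratfun_fun_det:
  assumes "\<And>a b. a < r \<Longrightarrow> b < r \<Longrightarrow> (\<lambda>x. X x a b) \<in> ratfun m t D"
  shows "(\<lambda>x. fun_det r (X x)) \<in> ratfun m t D"
  unfolding fun_det_altdef
proof (intro ratfun_sum ratfun_mult ratfun_const ratfun_prod)
  fix p a assume "p \<in> {p. p permutes {0..<r}}" and a: "a \<in> {0..<r}"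
  then have "p a < r" using permutes_in_image[of p "{0..<r}" a] by simp
  then show "(\<lambda>x. X x a (p a)) \<in> ratfun m t D" using assms a by simp
qed

section \<open>Perturbing one coordinate of an operator\<close>

lemma op_apply_at_add_monom:
  "op_apply_at (L + monom q j) a F = op_apply_at L a F + fps_of_poly (pcompose q [:a, 1:]) * (fps_deriv ^^ j) F"
proof -
  let ?n = "max (degree L) j"
  have "degree (monom q j) \<le> ?n" using degree_monom_le[of q j] by simp
  then have "degree (L + monom q j) \<le> ?n" by (intro degree_add_le) auto
  then have "op_apply_at (L + monom q j) a F =
    (\<Sum>i\<le>?n. fps_of_poly (pcompose (coeff L i) [:a, 1:]) * (fps_deriv ^^ i) F +
      (if i = j then fps_of_poly (pcompose q [:a, 1:]) * (fps_deriv ^^ j) F else 0))"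
    by (subst op_apply_at_upto) (auto simp: pcompose_add fps_of_poly_add algebra_simps intro!: sum.cong)
  also have "\<dots> = op_apply_at L a F + fps_of_poly (pcompose q [:a, 1:]) * (fps_deriv ^^ j) F"
    by (simp add: sum.distrib op_apply_at_upto[of L ?n])
  finally show ?thesis .
qed

context branch_points
begin

definition sol :: "'k poly poly \<Rightarrow> nat \<Rightarrow> nat \<Rightarrow> 'k fps" where
  "sol L i j = Abs_fps (solseq L (\<alpha> i) (\<lambda>m. if m = j then 1 else 0))"

lemma sol_solution: "L \<in> ops \<Longrightarrow> i \<in> {1..rP} \<Longrightarrow> op_apply_at L (\<alpha> i) (sol L i j) = 0"
  unfolding sol_def using ops_jet[of L i] by (intro op_apply_at_solseq) (auto simp: ops_def)

lemma sol_initial: "L \<in> ops \<Longrightarrow> m < rL \<Longrightarrow> sol L i j $ m = (if m = j then 1 else 0)"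
  unfolding sol_def by (auto simp: solseq.simps ops_def)

text \<open>The row index \<open>\<rho>\<close> encodes the pair consisting of a branch and an initial condition.\<close>

definition branch :: "nat \<Rightarrow> nat" where "branch \<rho> = 1 + \<rho> div rL"
definition cond :: "nat \<Rightarrow> nat" where "cond \<rho> = \<rho> mod rL"

definition entry :: "'k poly poly \<Rightarrow> nat \<Rightarrow> nat \<Rightarrow> 'k" where
  "entry L \<rho> c = (sol L (branch \<rho>) (cond \<rho>) oo u (branch \<rho>)) $ c"

lemma branch_cond: assumes "\<rho> < ord" shows "branch \<rho> \<in> {1..rP}" "cond \<rho> < rL"
proof -
  have "\<rho> div rL < rP" using assms by (simp add: ord_def less_mult_imp_div_less mult.commute)
  then show "branch \<rho> \<in> {1..rP}" by (auto simp: branch_def)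
  show "cond \<rho> < rL" using rL by (simp add: cond_def)
qed

lemma branch_cond_inj: "branch \<rho> = branch \<sigma> \<Longrightarrow> cond \<rho> = cond \<sigma> \<Longrightarrow> \<rho> = \<sigma>"
  by (metis branch_def cond_def add_left_cancel div_mult_mod_eq)

definition row :: "nat \<Rightarrow> nat \<Rightarrow> nat" where "row i j = (i - 1) * rL + j"

lemma row: assumes "i \<in> {1..rP}" "j < rL" shows "row i j < ord" "branch (row i j) = i" "cond (row i j) = j"
proof -
  have "row i j < (i - 1) * rL + rL" using assms by (simp add: row_def)
  also have "\<dots> = i * rL" using assms by (cases i) auto
  also have "\<dots> \<le> rP * rL" using assms by (intro mult_le_mono) auto
  finally show "row i j < ord" by (simp add: ord_def mult.commute)
  show "branch (row i j) = i" "cond (row i j) = j" using assms by (auto simp: row_def branch_def cond_def)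
qed

lemma sum_rows: "(\<Sum>\<rho><ord. f \<rho>) = (\<Sum>i\<in>{1..rP}. \<Sum>j<rL. f (row i j))"
proof -
  have "(\<Sum>i\<in>{1..rP}. \<Sum>j<rL. f (row i j)) = (\<Sum>x\<in>{1..rP} \<times> {..<rL}. f (row (fst x) (snd x)))"
    by (simp add: sum.cartesian_product case_prod_beta)
  also have "\<dots> = (\<Sum>\<rho><ord. f \<rho>)"
  proof (rule sum.reindex_bij_witness[of _ "\<lambda>\<rho>. (branch \<rho>, cond \<rho>)" "\<lambda>x. row (fst x) (snd x)"])
    fix \<rho> assume \<rho>: "\<rho> \<in> {..<ord}"
    then show "(branch \<rho>, cond \<rho>) \<in> {1..rP} \<times> {..<rL}" using branch_cond by auto
    show "row (fst (branch \<rho>, cond \<rho>)) (snd (branch \<rho>, cond \<rho>)) = \<rho>" by (simp add: row_def branch_def cond_def)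
  qed (use row in auto)
  finally show ?thesis ..
qed

definition combination :: "'k poly poly \<Rightarrow> (nat \<Rightarrow> 'k) \<Rightarrow> nat \<Rightarrow> 'k fps" where
  "combination L c i = (\<Sum>j<rL. fps_const (c (row i j)) * sol L i j)"

lemma combination_solution: "L \<in> ops \<Longrightarrow> i \<in> {1..rP} \<Longrightarrow> op_apply_at L (\<alpha> i) (combination L c i) = 0"
  unfolding combination_def by (simp add: op_apply_at_sum op_apply_at_fps_const sol_solution)

lemma combination_initial:
  assumes "L \<in> ops" "j < rL" shows "combination L c i $ j = c (row i j)"
proof -
  have "combination L c i $ j = (\<Sum>k<rL. if k = j then c (row i k) else 0)"
    unfolding combination_def fps_sum_nth using assms by (intro sum.cong) (auto simp: sol_initial)
  then show ?thesis using assms by simp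
qed

lemma combination_compose:
  "(\<Sum>i\<in>{1..rP}. (combination L c i oo u i) $ s) = (\<Sum>\<rho><ord. c \<rho> * entry L \<rho> s)"
proof -
  have "(combination L c i oo u i) $ s = (\<Sum>j<rL. c (row i j) * entry L (row i j) s)" if "i \<in> {1..rP}" for i
  proof -
    have "(combination L c i oo u i) = (\<Sum>j<rL. (fps_const (c (row i j)) * sol L i j) oo u i)"
      by (simp add: combination_def fps_compose_sum_distrib)
    then show ?thesis
      using row[OF that] u_0[OF that] by (simp add: fps_sum_nth entry_def fps_compose_mult_distrib)
  qed
  then show ?thesis unfolding sum_rows by simp
qed

text \<open>A row relation is read back from the initial values of its components, so a nontrivial
  one yields a nonzero tuple witnessing degeneracy.\<close>

lemma nondegenerate_independent:
  assumes "L \<in> ops" "L \<notin> degenerate R" "\<And>s. s < R \<Longrightarrow> (\<Sum>\<rho><ord. c \<rho> * entry L \<rho> s) = 0"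
  shows "\<forall>\<rho><ord. c \<rho> = 0"
proof (rule ccontr)
  assume "\<not> ?thesis"
  then obtain \<rho> where \<rho>: "\<rho> < ord" "c \<rho> \<noteq> 0" by blast
  note b = branch_cond[OF \<rho>(1)]
  have rowb: "row (branch \<rho>) (cond \<rho>) = \<rho>" by (simp add: row_def branch_def cond_def)
  have "combination L c (branch \<rho>) $ cond \<rho> \<noteq> 0"
    using combination_initial[OF assms(1) b(2), of c "branch \<rho>"] \<rho> rowb by simp
  then have "combination L c (branch \<rho>) \<noteq> 0" by auto
  moreover have "related L R (combination L c)"
    unfolding related_def combination_compose using combination_solution[OF assms(1)] assms(3) by blast
  ultimately show False using assms(1,2) b(1) unfolding degenerate_def by blast
qed

text \<open>The cofactor of the last entry of row \<rho>0, the entry that the perturbation below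
  moves.\<close>

definition cofactor_top :: "nat \<Rightarrow> (nat \<Rightarrow> nat \<Rightarrow> 'k) \<Rightarrow> 'k" where
  "cofactor_top \<rho>0 X = fun_det ord (X(\<rho>0 := (\<lambda>b. if b = ord - 1 then 1 else 0)))"

text \<open>Without the last column the rows have a relation \<mu>. It cannot live on branch 1
  alone, because a composition there already has a nonzero coefficient before the last column. So
  \<mu> is nonzero at some \<rho>0 on another branch, and a vanishing cofactor at \<rho>0 would
  contradict nondegeneracy.\<close>

lemma nondegenerate_cofactor:
  assumes L: "L \<in> ops" "L \<notin> degenerate ord"
  shows "\<exists>\<rho>0<ord. branch \<rho>0 \<in> {2..rP} \<and> cofactor_top \<rho>0 (entry L) \<noteq> 0"
proof -
  have ord2: "2 * rL - 1 \<le> ord - 1" "ord > 0" using nfree_ord(4) rL by auto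
  have "card {..<ord - 1} < card {..<ord}" using ord2 by simp
  from homogeneous_system_nontrivial_solution[OF _ _ this, of "entry L"]
  obtain \<mu> where \<mu>: "\<exists>\<rho><ord. \<mu> \<rho> \<noteq> 0" "\<And>c. c < ord - 1 \<Longrightarrow> (\<Sum>\<rho><ord. \<mu> \<rho> * entry L \<rho> c) = 0" by auto
  have "\<exists>\<rho>0<ord. branch \<rho>0 \<in> {2..rP} \<and> \<mu> \<rho>0 \<noteq> 0"
  proof (rule ccontr)
    assume "\<not> ?thesis"
    then have z: "\<mu> \<rho> = 0" if "\<rho> < ord" "branch \<rho> \<noteq> 1" for \<rho> using that branch_cond[OF that(1)] by force
    have one: "(1::nat) \<in> {1..rP}" using rP by auto
    have c0: "combination L \<mu> i = 0" if "i \<in> {1..rP} - {1}" for i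
      unfolding combination_def using that row[of i] z by (intro sum.neutral) auto
    obtain \<rho> where \<rho>: "\<rho> < ord" "\<mu> \<rho> \<noteq> 0" using \<mu> by blast
    then have b1: "branch \<rho> = 1" using z by blast
    have "row 1 (cond \<rho>) = \<rho>" using b1 div_mult_mod_eq[of \<rho> rL] by (simp add: row_def branch_def cond_def)
    then have "combination L \<mu> 1 $ cond \<rho> \<noteq> 0"
      using combination_initial[OF L(1) branch_cond(2)[OF \<rho>(1)], of \<mu> 1] \<rho> by simp
    then have "combination L \<mu> 1 \<noteq> 0" by auto
    then obtain c where c: "c < 2 * rL - 1" "(combination L \<mu> 1 oo u 1) $ c \<noteq> 0"
      using composition_nonzero[OF L(1) one combination_solution[OF L(1) one]] by blast
    have "(\<Sum>i\<in>{1..rP}. (combination L \<mu> i oo u i) $ c) = (combination L \<mu> 1 oo u 1) $ c + (\<Sum>i\<in>{1..rP} - {1}. (combination L \<mu> i oo u i) $ c)"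
      using one by (intro sum.remove) auto
    also have "(\<Sum>i\<in>{1..rP} - {1}. (combination L \<mu> i oo u i) $ c) = 0" using c0 by (intro sum.neutral) auto
    finally show False using c \<mu>(2)[of c] ord2 unfolding combination_compose by simp
  qed
  then obtain \<rho>0 where \<rho>0: "\<rho>0 < ord" "branch \<rho>0 \<in> {2..rP}" "\<mu> \<rho>0 \<noteq> 0" by blast
  have "cofactor_top \<rho>0 (entry L) \<noteq> 0"
  proof
    assume "cofactor_top \<rho>0 (entry L) = 0"
    then obtain \<nu> where \<nu>: "\<exists>\<rho><ord. \<nu> \<rho> \<noteq> 0"
      "\<And>c. c < ord \<Longrightarrow> (\<Sum>\<rho><ord. \<nu> \<rho> * ((entry L)(\<rho>0 := (\<lambda>b. if b = ord - 1 then 1 else 0))) \<rho> c) = 0"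
      unfolding cofactor_top_def fun_det_eq_0_iff by blast
    define \<nu>' where "\<nu>' = \<nu>(\<rho>0 := 0)"
    have sum: "\<nu> \<rho>0 * (if c = ord - 1 then 1 else 0) + (\<Sum>\<rho><ord. \<nu>' \<rho> * entry L \<rho> c) = 0" if "c < ord" for c
    proof -
      have "(\<Sum>\<rho><ord. \<nu> \<rho> * ((entry L)(\<rho>0 := (\<lambda>b. if b = ord - 1 then 1 else 0))) \<rho> c) =
        \<nu> \<rho>0 * (if c = ord - 1 then 1 else 0) + (\<Sum>\<rho>\<in>{..<ord} - {\<rho>0}. \<nu>' \<rho> * entry L \<rho> c)"
        using \<rho>0 by (subst sum.remove[of _ \<rho>0]) (auto simp: \<nu>'_def intro!: sum.cong)
      also have "(\<Sum>\<rho>\<in>{..<ord} - {\<rho>0}. \<nu>' \<rho> * entry L \<rho> c) = (\<Sum>\<rho><ord. \<nu>' \<rho> * entry L \<rho> c)"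
        using \<rho>0 by (intro sum.mono_neutral_left) (auto simp: \<nu>'_def)
      finally show ?thesis using \<nu>(2)[OF that] by simp
    qed
    have \<nu>'nz: "\<exists>\<rho><ord. \<nu>' \<rho> \<noteq> 0"
    proof (rule ccontr)
      assume "\<not> ?thesis"
      then have "(\<Sum>\<rho><ord. \<nu>' \<rho> * entry L \<rho> (ord - 1)) = 0" by (intro sum.neutral) auto
      then have "\<nu> \<rho>0 = 0" using sum[of "ord - 1"] ord2 by simp
      then have "\<nu>' = \<nu>" by (auto simp: \<nu>'_def)
      then show False using \<open>\<not> (\<exists>\<rho><ord. \<nu>' \<rho> \<noteq> 0)\<close> \<nu>(1) by simp
    qed
    define a b where "a = (\<Sum>\<rho><ord. \<mu> \<rho> * entry L \<rho> (ord - 1))" and "b = (\<Sum>\<rho><ord. \<nu>' \<rho> * entry L \<rho> (ord - 1))"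
    have low: "(\<Sum>\<rho><ord. \<nu>' \<rho> * entry L \<rho> c) = 0" if "c < ord - 1" for c using sum[of c] that by simp
    have b: "b \<noteq> 0"
    proof
      assume "b = 0"
      then have "(\<Sum>\<rho><ord. \<nu>' \<rho> * entry L \<rho> c) = 0" if "c < ord" for c
        using that low by (cases "c = ord - 1") (auto simp: b_def)
      then show False using nondegenerate_independent[OF L, of \<nu>'] \<nu>'nz by blast
    qed
    \<comment> \<open>Two relations on the first ord - 1 columns are combined to cancel the last
      column. The result is nonzero at \<rho>0, because \<nu>' is zero there.\<close>
    have "(\<Sum>\<rho><ord. (b * \<mu> \<rho> - a * \<nu>' \<rho>) * entry L \<rho> c) = 0" if "c < ord" for c
    proof -
      have "(\<Sum>\<rho><ord. (b * \<mu> \<rho> - a * \<nu>' \<rho>) * entry L \<rho> c) =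
        b * (\<Sum>\<rho><ord. \<mu> \<rho> * entry L \<rho> c) - a * (\<Sum>\<rho><ord. \<nu>' \<rho> * entry L \<rho> c)"
        by (simp add: left_diff_distrib sum_subtractf sum_distrib_left mult.assoc)
      then show ?thesis using that low \<mu>(2) by (cases "c = ord - 1") (auto simp: a_def b_def)
    qed
    from nondegenerate_independent[OF L this] \<rho>0(1) have "b * \<mu> \<rho>0 - a * \<nu>' \<rho>0 = 0" by blast
    then show False using b \<rho>0 by (simp add: \<nu>'_def)
  qed
  with \<rho>0 show ?thesis by blast
qed

text \<open>Vanishes to order exactly nfree - 1 at \<alpha>_i and to order at least nfree + 1 at the
  other points. Among the solution coefficients below \<open>ord\<close>, adding a multiple of it to
  L can thus change only those of index nfree - 1 + rL = ord - 1 on branch i.\<close>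

definition bump :: "nat \<Rightarrow> 'k poly" where
  "bump i = [:- \<alpha> i, 1:] ^ (nfree - 1) * other_points i"

definition perturb :: "nat \<Rightarrow> 'k \<Rightarrow> 'k poly poly \<Rightarrow> 'k poly poly" where
  "perturb \<rho>0 z L = L + monom (smult z (bump (branch \<rho>0))) (cond \<rho>0)"

lemma bump_at_own:
  assumes "i \<in> {1..rP}"
  shows "q < nfree - 1 \<Longrightarrow> coeff (pcompose (bump i) [:\<alpha> i, 1:]) q = 0"
    "coeff (pcompose (bump i) [:\<alpha> i, 1:]) (nfree - 1) \<noteq> 0"
proof -
  have "pcompose (bump i) [:\<alpha> i, 1:] = monom 1 (nfree - 1) * pcompose (other_points i) [:\<alpha> i, 1:]"
    by (simp add: bump_def pcompose_mult pcompose_power pcompose_pCons monom_altdef)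
  then show "q < nfree - 1 \<Longrightarrow> coeff (pcompose (bump i) [:\<alpha> i, 1:]) q = 0"
    "coeff (pcompose (bump i) [:\<alpha> i, 1:]) (nfree - 1) \<noteq> 0"
    using other_points_own[OF assms] by (auto simp: coeff_monom_mult)
qed

lemma bump_at_other:
  assumes "k \<in> {1..rP} - {i}" "q \<le> nfree" shows "coeff (pcompose (bump i) [:\<alpha> k, 1:]) q = 0"
  unfolding bump_def by (subst mult.commute) (rule other_points_at[OF assms])

lemma degree_bump:
  assumes "i \<in> {1..rP}"
  shows "degree (bump i) = nfree - 1 + (nfree + 1) * (rP - 1)" "degree (bump i) \<le> dL" "lead_coeff (bump i) = 1"
proof -
  have "degree (bump i) = degree ([:- \<alpha> i, 1:] ^ (nfree - 1)) + degree (other_points i)"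
    unfolding bump_def using degree_other_points[OF assms] by (intro degree_mult_eq) auto
  then show d: "degree (bump i) = nfree - 1 + (nfree + 1) * (rP - 1)"
    using degree_other_points[OF assms] by (simp add: degree_power_eq)
  have "nfree - 1 + (nfree + 1) * (rP - 1) \<le> (nfree + 1) * rP" using rP by (cases rP) auto
  then show "degree (bump i) \<le> dL" using d dL' by simp
  show "lead_coeff (bump i) = 1"
    by (simp add: bump_def other_points_def lead_coeff_mult lead_coeff_power lead_coeff_prod del: power_Suc)
qed

lemma perturb_ops:
  assumes "\<rho>0 < ord" "L \<in> ops" shows "perturb \<rho>0 z L \<in> ops"
proof -
  note b = branch_cond[OF assms(1)]
  have c: "coeff (perturb \<rho>0 z L) k = coeff L k + (if k = cond \<rho>0 then smult z (bump (branch \<rho>0)) else 0)" for k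
    by (simp add: perturb_def)
  have degL: "degree L = rL" using assms by (simp add: ops_def)
  have "degree (perturb \<rho>0 z L) = rL"
  proof -
    have "degree (monom (smult z (bump (branch \<rho>0))) (cond \<rho>0)) < degree L"
      using degree_monom_le[of "smult z (bump (branch \<rho>0))" "cond \<rho>0"] b(2) degL by simp
    then show ?thesis unfolding perturb_def using degL by (simp add: degree_add_eq_left)
  qed
  moreover have "coeff (perturb \<rho>0 z L) rL = coeff L rL" using b(2) by (simp add: c)
  moreover have "degree (coeff (perturb \<rho>0 z L) k) \<le> dL" for k
    unfolding c using assms(2) degree_bump(2)[OF b(1)] degree_smult_le[of z "bump (branch \<rho>0)"]
    by (intro degree_add_le) (auto simp: ops_def intro: order.trans)
  ultimately show ?thesis using assms(2) by (auto simp: ops_def)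
qed

text \<open>The change of coefficient ord - 1 of the perturbed solution per unit of z, times the
  power of \<open>u $ 1\<close> contributed by composition. Division by the leading coefficient of L
  at the branch point is left out because it depends on L.\<close>

definition slope :: "nat \<Rightarrow> 'k" where
  "slope \<rho>0 = - (coeff (pcompose (bump (branch \<rho>0)) [:\<alpha> (branch \<rho>0), 1:]) (nfree - 1) * fact (cond \<rho>0)) /
     pochhammer (of_nat nfree) rL * (u (branch \<rho>0) $ 1) ^ (ord - 1)"

lemma slope_nonzero: "\<rho>0 < ord \<Longrightarrow> branch \<rho>0 \<in> {2..rP} \<Longrightarrow> slope \<rho>0 \<noteq> 0"
  using bump_at_own(2)[OF branch_cond(1)] u_1[of "branch \<rho>0"] pochhammer_Suc_nonzero[of "nfree - 1" rL, where 'k='k] nfree_ord rL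
  by (auto simp: slope_def)

text \<open>Adding a multiple of the bump changes a single matrix entry, so the determinant is affine in it.\<close>

lemma entry_perturb:
  assumes \<rho>0: "\<rho>0 < ord" and L: "L \<in> ops" and \<rho>: "\<rho> < ord" and c: "c < ord"
  shows "entry (perturb \<rho>0 z L) \<rho> c = entry L \<rho> c +
    (if \<rho> = \<rho>0 \<and> c = ord - 1 then z * slope \<rho>0 / poly (coeff L rL) (\<alpha> (branch \<rho>0)) else 0)"
proof -
  let ?i = "branch \<rho>0" and ?j = "cond \<rho>0" and ?k = "branch \<rho>" and ?l = "cond \<rho>"
  let ?L' = "perturb \<rho>0 z L" and ?a = "\<alpha> (branch \<rho>)"
  note b0 = branch_cond[OF \<rho>0] and b = branch_cond[OF \<rho>]
  have L': "?L' \<in> ops" by (rule perturb_ops[OF \<rho>0 L])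
  define F F' \<Delta> where "F = sol L ?k ?l" and "F' = sol ?L' ?k ?l" and "\<Delta> = F' - F"
  define E where "E = pcompose (bump ?i) [:?a, 1:]"
  \<comment> \<open>The difference of the two solutions solves an inhomogeneous equation for the
    unperturbed L, with zero initial values and a source that starts at order nfree - 1 or
    later.\<close>
  have LD: "op_apply_at L ?a \<Delta> = - (fps_const z * (fps_of_poly E * (fps_deriv ^^ ?j) F'))"
  proof -
    have "0 = op_apply_at ?L' ?a F'" unfolding F'_def using sol_solution[OF L' b(1)] by simp
    also have "\<dots> = op_apply_at L ?a F' + fps_const z * (fps_of_poly E * (fps_deriv ^^ ?j) F')"
      by (simp add: perturb_def op_apply_at_add_monom E_def pcompose_smult fps_of_poly_smult mult.assoc)
    finally have "op_apply_at L ?a F' = - (fps_const z * (fps_of_poly E * (fps_deriv ^^ ?j) F'))"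
      by (simp add: eq_neg_iff_add_eq_0)
    moreover have "op_apply_at L ?a F = 0" unfolding F_def by (rule sol_solution[OF L b(1)])
    moreover have "(fps_deriv ^^ i) (F' - F) = (fps_deriv ^^ i) F' - (fps_deriv ^^ i) F" for i
      by (induction i) auto
    then have "op_apply_at L ?a \<Delta> = op_apply_at L ?a F' - op_apply_at L ?a F"
      by (simp add: op_apply_at_def \<Delta>_def right_diff_distrib sum_subtractf)
    ultimately show ?thesis by simp
  qed
  have LDs: "op_apply_at L ?a \<Delta> $ s = - z * (\<Sum>q\<le>s. coeff E q * ((fps_deriv ^^ ?j) F') $ (s - q))" for s
  proof -
    have "(fps_of_poly E * (fps_deriv ^^ ?j) F') $ s = (\<Sum>q\<le>s. coeff E q * ((fps_deriv ^^ ?j) F') $ (s - q))"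
      by (simp add: fps_mult_nth atLeast0AtMost)
    then show ?thesis unfolding LD by simp
  qed
  have init: "\<Delta> $ m = 0" if "m < rL" for m
    using that by (simp add: \<Delta>_def F_def F'_def sol_initial[OF L] sol_initial[OF L'])
  have degL: "degree L \<le> rL" using L by (simp add: ops_def)
  note jet = ops_jet[OF L b(1)]
  have \<Delta>: "\<Delta> $ m = (if \<rho> = \<rho>0 \<and> m = ord - 1 then
      - z * (coeff (pcompose (bump ?i) [:\<alpha> ?i, 1:]) (nfree - 1) * fact ?j) / (poly (coeff L rL) (\<alpha> ?i) * pochhammer (of_nat nfree) rL) else 0)"
    if m: "m < ord" for m
  proof (cases "?k = ?i")
    case False
    then have "coeff E q = 0" if "q \<le> nfree" for q unfolding E_def using that b b0 by (intro bump_at_other) auto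
    then have "op_apply_at L ?a \<Delta> $ s = 0" if "s < nfree" for s using that by (simp add: LDs)
    from op_apply_at_truncated_unique(1)[OF degL jet init this] m nfree_ord(1) have "\<Delta> $ m = 0" by simp
    then show ?thesis using False by auto
  next
    case True
    then have low: "coeff E q = 0" if "q < nfree - 1" for q
      unfolding E_def using that bump_at_own(1)[OF b0(1)] by simp
    have z: "op_apply_at L ?a \<Delta> $ s = 0" if "s < nfree - 1" for s using that low by (simp add: LDs)
    have S: "nfree - 1 + rL = ord - 1" "nfree - 1 + 1 = nfree" using nfree_ord rL by auto
    show ?thesis
    proof (cases "m = ord - 1")
      case False
      then show ?thesis using op_apply_at_truncated_unique(1)[where S="nfree - 1" and m=m, OF degL jet init z] m S by simp
    next
      case top: True
      have "jet L ?a rL 0 * (pochhammer (of_nat nfree) rL * \<Delta> $ (ord - 1)) = op_apply_at L ?a \<Delta> $ (nfree - 1)"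
        using op_apply_at_truncated_unique(2)[where S="nfree - 1", OF degL jet init z] unfolding S .
      also have "\<dots> = - z * (coeff E (nfree - 1) * (fact ?j * F' $ ?j))"
      proof -
        have "(\<Sum>q\<le>nfree - 1. coeff E q * ((fps_deriv ^^ ?j) F') $ (nfree - 1 - q)) = coeff E (nfree - 1) * ((fps_deriv ^^ ?j) F') $ 0"
          using low by (simp add: lessThan_Suc_atMost[symmetric])
        then show ?thesis unfolding LDs by (simp add: fps_deriv_funpow_nth pochhammer_fact)
      qed
      \<comment> \<open>The source begins with j! times an initial value of F', and this is nonzero
        only for the solution whose initial condition matches the perturbed coefficient.\<close>
      also have "F' $ ?j = (if \<rho> = \<rho>0 then 1 else 0)"
        using sol_initial[OF L' b0(2), of ?k ?l] True branch_cond_inj[of \<rho> \<rho>0] by (auto simp: F'_def)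
      finally have "poly (coeff L rL) (\<alpha> ?i) * (pochhammer (of_nat nfree) rL * \<Delta> $ (ord - 1)) =
        - z * (coeff E (nfree - 1) * (fact ?j * (if \<rho> = \<rho>0 then 1 else 0)))" by (simp add: jet_0 True)
      moreover have "poly (coeff L rL) (\<alpha> ?i) \<noteq> 0" using jet True by (simp add: jet_0)
      moreover have "pochhammer (of_nat nfree) rL \<noteq> (0::'k)"
        using pochhammer_Suc_nonzero[of "nfree - 1" rL, where 'k='k] S(2) by simp
      ultimately show ?thesis using top True by (auto simp: E_def field_simps)
    qed
  qed
  have "entry ?L' \<rho> c = entry L \<rho> c + (\<Delta> oo u ?k) $ c"
    by (simp add: entry_def \<Delta>_def F_def F'_def fps_compose_sub_distrib)
  moreover have "(\<Delta> oo u ?k) $ c = (\<Sum>m\<le>c. \<Delta> $ m * (u ?k ^ m) $ c)" by (simp add: fps_compose_nth atLeast0AtMost)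
  moreover have "\<dots> = (if \<rho> = \<rho>0 \<and> c = ord - 1 then z * slope \<rho>0 / poly (coeff L rL) (\<alpha> ?i) else 0)"
  proof (cases "\<rho> = \<rho>0 \<and> c = ord - 1")
    case False
    then have "(\<Sum>m\<le>c. \<Delta> $ m * (u ?k ^ m) $ c) = 0" using \<Delta> c by (intro sum.neutral) auto
    then show ?thesis unfolding if_not_P[OF False] .
  next
    case True
    have "(\<Sum>m\<le>c. \<Delta> $ m * (u ?k ^ m) $ c) = (\<Sum>m\<in>{c}. \<Delta> $ m * (u ?k ^ m) $ c)"
      using \<Delta> c True by (intro sum.mono_neutral_right) auto
    also have "\<dots> = \<Delta> $ c * (u ?k $ 1) ^ c" using startsby_zero_power_nth_same[OF u_0[OF b(1)], of c] by simp
    finally show ?thesis using True \<Delta>[OF c] by (simp add: slope_def field_simps)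
  qed
  ultimately show ?thesis by simp
qed

end

section \<open>Operators with an apparent singularity\<close>

context branch_points
begin

definition op_of :: "(nat \<Rightarrow> 'k) \<Rightarrow> 'k poly poly" where
  "op_of y = (\<Sum>k\<le>rL. monom (\<Sum>d\<le>dL. monom (y (k * (dL + 1) + d)) d) k)"

lemma coeff_op_of: "coeff (coeff (op_of y) k) d = (if k \<le> rL \<and> d \<le> dL then y (k * (dL + 1) + d) else 0)"
  by (auto simp: op_of_def coeff_sum)

lemma coord_index_less: "k \<le> rL \<Longrightarrow> d \<le> dL \<Longrightarrow> k * (dL + 1) + d < ncoords"
proof -
  assume "k \<le> rL" "d \<le> dL"
  then have "k * (dL + 1) + d < k * (dL + 1) + (dL + 1)" by simp
  also have "\<dots> = (k + 1) * (dL + 1)" by simp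
  also have "\<dots> \<le> ncoords" unfolding ncoords_def using \<open>k \<le> rL\<close> by (intro mult_le_mono) auto
  finally show ?thesis .
qed

lemma coords_nth: "k \<le> rL \<Longrightarrow> d \<le> dL \<Longrightarrow> coords L (k * (dL + 1) + d) = coeff (coeff L k) d"
  using coord_index_less[of k d] by (simp add: coords_def op_coords_def ncoords_def div_mult_self3 del: mult_Suc_right)

lemma coords_add: "coords (A + B) l = coords A l + coords B l"
  by (simp add: coords_def op_coords_def)

lemma coords_op_of: "l < ncoords \<Longrightarrow> coords (op_of y) l = y l"
proof -
  assume l: "l < ncoords"
  then have "l div (dL + 1) \<le> rL" by (metis Suc_eq_plus1 less_Suc_eq_le less_mult_imp_div_less ncoords_def)
  moreover have "l mod (dL + 1) \<le> dL" by (simp add: less_Suc_eq_le[symmetric])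
  ultimately show ?thesis using l div_mult_mod_eq[of l "dL + 1"]
    by (simp add: coords_def op_coords_def ncoords_def coeff_op_of)
qed

lemma ops_eqI:
  assumes "\<And>k. k > rL \<Longrightarrow> coeff A k = 0" "\<And>k. k > rL \<Longrightarrow> coeff B k = 0"
    "\<And>k. degree (coeff A k) \<le> dL" "\<And>k. degree (coeff B k) \<le> dL" "\<And>l. l < ncoords \<Longrightarrow> coords A l = coords B l"
  shows "A = B"
proof (intro poly_eqI)
  fix k d
  show "coeff (coeff A k) d = coeff (coeff B k) d"
  proof (cases "k \<le> rL \<and> d \<le> dL")
    case True
    then show ?thesis using assms(5)[OF coord_index_less[of k d]] coords_nth by simp
  next
    case False
    then consider "k > rL" | "d > dL" by linarith
    then show ?thesis
    proof cases
      case 2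
      then have "coeff (coeff A k) d = 0" "coeff (coeff B k) d = 0"
        using assms(3,4)[of k] by (auto intro: coeff_eq_0)
      then show ?thesis by simp
    qed (use assms in simp)
  qed
qed

lemma degree_coeff_op_of: "degree (coeff (op_of y) k) \<le> dL"
  by (intro degree_le) (simp add: coeff_op_of)

text \<open>One polynomial in the coordinates whose nonvanishing expresses that L lies in
  \<open>ops\<close>.\<close>

definition lc_prod :: "'k poly poly \<Rightarrow> 'k" where
  "lc_prod L = (\<Prod>i\<in>{1..rP}. poly (coeff L rL) (\<alpha> i))"

lemma op_of_ops: "lc_prod (op_of y) \<noteq> 0 \<Longrightarrow> op_of y \<in> ops"
proof -
  assume lc: "lc_prod (op_of y) \<noteq> 0"
  then have nz: "\<forall>i\<in>{1..rP}. poly (coeff (op_of y) rL) (\<alpha> i) \<noteq> 0" by (auto simp: lc_prod_def)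
  moreover have "(1::nat) \<in> {1..rP}" using rP by auto
  ultimately have "coeff (op_of y) rL \<noteq> 0" by (metis poly_0)
  then have "rL \<le> degree (op_of y)" by (rule le_degree)
  moreover have "degree (op_of y) \<le> rL" by (intro degree_le) (auto simp: poly_eq_iff coeff_op_of)
  ultimately have "degree (op_of y) = rL" by simp
  then show ?thesis using nz degree_coeff_op_of by (auto simp: ops_def)
qed

lemma polyfun_lc_prod:
  assumes "\<And>d. (\<lambda>v. coeff (coeff (A v) rL) d) \<in> polyfun m" "\<And>v. degree (coeff (A v) rL) \<le> dL"
  shows "(\<lambda>v. lc_prod (A v)) \<in> polyfun m"
proof -
  have "poly (coeff (A v) rL) a = (\<Sum>d\<le>dL. coeff (coeff (A v) rL) d * a ^ d)" for v a
    unfolding poly_altdef using assms(2)[of v] by (intro sum.mono_neutral_left) (auto simp: coeff_eq_0)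
  then show ?thesis unfolding lc_prod_def using assms(1)
    by (simp add: polyfun_prod polyfun_sum pf_mult pf_const)
qed

lemma ncoords_ge_2: "ncoords \<ge> 2"
  using rL by (auto simp: ncoords_def)

text \<open>Degenerate operators modulo \<open>x ^ ord\<close> depend on ncoords - 1 parameters, so
  the ncoords coordinates satisfy a nonzero relation on them. A point where neither this relation
  nor \<open>lc_prod\<close> vanishes does the job.\<close>

lemma nondegenerate_exists: "\<exists>L\<in>ops. L \<notin> degenerate ord"
proof -
  obtain p w where p: "p \<in> polyfun ncoords" "p w \<noteq> 0" "\<And>L. L \<in> degenerate ord \<Longrightarrow> p (\<lambda>k. coords L k) = 0"
    using degenerate_relation[of ord ncoords "\<lambda>k y. y k"] ncoords_ge_2 by (auto intro: pf_var)
  have q: "(\<lambda>y. lc_prod (op_of y)) \<in> polyfun ncoords"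
  proof (intro polyfun_lc_prod degree_coeff_op_of)
    show "(\<lambda>y. coeff (coeff (op_of y) rL) d) \<in> polyfun ncoords" for d
      using coord_index_less[of rL d] by (cases "d \<le> dL") (simp_all add: coeff_op_of pf_var pf_const del: mult_Suc_right)
  qed
  \<comment> \<open>The coordinates of the operator D^rL.\<close>
  define y1 where "y1 = (\<lambda>l. if l = rL * (dL + 1) then 1 else (0::'k))"
  have "coeff (op_of y1) rL = 1"
    by (auto simp: poly_eq_iff coeff_op_of y1_def coeff_1)
  then have "lc_prod (op_of y1) \<noteq> 0" by (simp add: lc_prod_def)
  from polyfun_common_nonzero[OF p(1) q p(2) this]
  obtain y where y: "p y \<noteq> 0" "lc_prod (op_of y) \<noteq> 0" by blast
  have "p (\<lambda>k. coords (op_of y) k) = p y" by (rule polyfun_cong[OF p(1)]) (rule coords_op_of)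
  then show ?thesis using y p(3) op_of_ops by metis
qed

lemma fun_det_perturb:
  assumes "\<rho>0 < ord" "L \<in> ops"
  shows "fun_det ord (entry (perturb \<rho>0 z L)) = fun_det ord (entry L) +
      z * slope \<rho>0 / poly (coeff L rL) (\<alpha> (branch \<rho>0)) * cofactor_top \<rho>0 (entry L)"
    and "cofactor_top \<rho>0 (entry (perturb \<rho>0 z L)) = cofactor_top \<rho>0 (entry L)"
proof -
  have "fun_det ord (entry (perturb \<rho>0 z L)) = fun_det ord (\<lambda>\<rho> c. entry L \<rho> c +
    (if \<rho> = \<rho>0 \<and> c = ord - 1 then z * slope \<rho>0 / poly (coeff L rL) (\<alpha> (branch \<rho>0)) else 0))"
    using entry_perturb[OF assms] by (intro fun_det_cong) auto
  then show "fun_det ord (entry (perturb \<rho>0 z L)) = fun_det ord (entry L) +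
      z * slope \<rho>0 / poly (coeff L rL) (\<alpha> (branch \<rho>0)) * cofactor_top \<rho>0 (entry L)"
    unfolding cofactor_top_def fun_det_add_entry[OF assms(1)] .
  show "cofactor_top \<rho>0 (entry (perturb \<rho>0 z L)) = cofactor_top \<rho>0 (entry L)"
    unfolding cofactor_top_def using entry_perturb[OF assms] by (intro fun_det_cong) auto
qed

text \<open>Solving \<open>det = 0\<close> for the perturbed coordinate parametrizes a hypersurface by the remaining coordinates.\<close>

theorem irr_chain_singular_operators:
  assumes S: "\<And>L c. L \<in> ops \<Longrightarrow> L \<notin> degenerate (ord + 1) \<Longrightarrow> \<exists>\<rho><ord. c \<rho> \<noteq> 0 \<Longrightarrow>
      (\<And>s. s < ord \<Longrightarrow> (\<Sum>\<rho><ord. c \<rho> * entry L \<rho> s) = 0) \<Longrightarrow> L \<in> S"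
  shows "irr_chain ncoords (coords ` S) (ncoords - 1)"
proof -
  obtain L0 where L0: "L0 \<in> ops" "L0 \<notin> degenerate ord" using nondegenerate_exists by blast
  obtain \<rho>0 where \<rho>0: "\<rho>0 < ord" "branch \<rho>0 \<in> {2..rP}" and cof0: "cofactor_top \<rho>0 (entry L0) \<noteq> 0"
    using nondegenerate_cofactor[OF L0] by blast
  note b0 = branch_cond[OF \<rho>0(1)]
  define j where "j = cond \<rho>0"
  define E where "E = bump (branch \<rho>0)"
  \<comment> \<open>The coordinate of the leading term of the bump. The bump is monic, so adding z
    times it moves this coordinate by exactly z, and any operator can be moved to the hyperplane
    where the coordinate is zero.\<close>
  define e0 where "e0 = j * (dL + 1) + degree E"
  have jr: "j < rL" using b0 by (simp add: j_def)
  have dE: "degree E \<le> dL" "lead_coeff E = 1" using degree_bump[OF b0(1)] by (auto simp: E_def)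
  have e0: "e0 < ncoords" unfolding e0_def using jr dE by (intro coord_index_less) auto
  define cE where "cE = (\<lambda>l. coords (monom E j) l)"
  have cE0: "cE e0 = 1" unfolding cE_def e0_def using jr dE by (subst coords_nth) auto
  have coords_perturb: "coords (perturb \<rho>0 z L) l = coords L l + z * cE l" for z L l
  proof -
    have "coords (monom (smult z E) j) l = z * cE l" by (simp add: cE_def coords_def op_coords_def)
    then show ?thesis by (simp add: perturb_def coords_add E_def j_def)
  qed
  define m where "m = ncoords - 1"
  have mN: "ncoords = Suc m" using ncoords_ge_2 by (simp add: m_def)
  define idx where "idx = (\<lambda>l. if l < e0 then l else Suc l)"
  define unidx where "unidx = (\<lambda>l. if l < e0 then l else l - 1)"
  have idx: "idx l < ncoords" "idx l \<noteq> e0" "unidx (idx l) = l" if "l < m" for l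
    using that by (auto simp: idx_def unidx_def mN)
  have unidx: "unidx l < m" "idx (unidx l) = l" if "l < ncoords" "l \<noteq> e0" for l
    using that e0 by (auto simp: idx_def unidx_def mN)
  define base where "base = (\<lambda>v. op_of (\<lambda>l. if l = e0 then 0 else v (unidx l)))"
  have coeff_base: "(\<lambda>v. coeff (coeff (base v) k) d) \<in> polyfun m" for k d
  proof (cases "k \<le> rL \<and> d \<le> dL \<and> k * (dL + 1) + d \<noteq> e0")
    case True
    then have "unidx (k * (dL + 1) + d) < m" using unidx coord_index_less by blast
    then show ?thesis using True by (simp add: base_def coeff_op_of pf_var del: mult_Suc_right)
  next
    case False
    then have "(\<lambda>v. coeff (coeff (base v) k) d) = (\<lambda>v. 0)" by (auto simp: base_def coeff_op_of)
    then show ?thesis by (simp add: pf_const)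
  qed
  have coords_base: "coords (base v) l = (if l = e0 then 0 else v (unidx l))" if "l < ncoords" for v l
    using coords_op_of[OF that] by (simp add: base_def)
  have deg_base: "degree (coeff (base v) k) \<le> dL" for v k unfolding base_def by (rule degree_coeff_op_of)

  define q0 where "q0 = (\<lambda>v. lc_prod (base v))"
  define D0 where "D0 = {v. q0 v \<noteq> 0}"
  have q0: "q0 \<in> polyfun m" unfolding q0_def by (intro polyfun_lc_prod coeff_base deg_base)
  have base_ops: "base v \<in> ops" if "v \<in> D0" for v
    using that op_of_ops unfolding D0_def q0_def base_def by blast
  have coeff_rat: "(\<lambda>v. coeff (coeff (base v) k) d) \<in> ratfun m (\<lambda>v. v) D" for k d D
    using ratfun_polyfun[OF coeff_base, of "\<lambda>v. v"] by simp
  have jet_rat: "(\<lambda>v. jet (base v) a k p) \<in> ratfun m (\<lambda>v. v) D" for a k p D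
    unfolding jet_def by (intro ratfun_pcompose_coeff[of _ _ dL] coeff_rat deg_base)
  have sol_rat: "(\<lambda>v. sol (base v) i l $ q) \<in> ratfun m (\<lambda>v. v) D0" if i: "i \<in> {1..rP}" and q: "q \<le> ord" for i l q
  proof (rule ratfun_solution_coeffs[where L=base and r=rL and n=nfree and a="\<alpha> i"])
    show "q \<le> nfree + rL" using q nfree_ord(1) by simp
    show "degree (base v) \<le> rL" if "v \<in> D0" for v using base_ops[OF that] by (simp add: ops_def)
    show "jet (base v) (\<alpha> i) rL 0 \<noteq> 0" if "v \<in> D0" for v by (rule ops_jet[OF base_ops[OF that] i])
    show "op_apply_at (base v) (\<alpha> i) (sol (base v) i l) $ s = 0" if "v \<in> D0" for v s
      using sol_solution[OF base_ops[OF that] i] by simp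
    show "(\<lambda>v. jet (base v) (\<alpha> i) k p) \<in> ratfun m (\<lambda>v. v) D0" for k p by (rule jet_rat)
    show "(\<lambda>v. sol (base v) i l $ q) \<in> ratfun m (\<lambda>v. v) D0" if "q < rL" for q
      by (rule ratfun_cong[OF ratfun_const]) (rule sol_initial[OF base_ops that])
  qed
  have entry_rat: "(\<lambda>v. entry (base v) \<rho> c) \<in> ratfun m (\<lambda>v. v) D0" if "\<rho> < ord" "c < ord" for \<rho> c
    unfolding entry_def using branch_cond[OF that(1)] that by (intro ratfun_compose_nth sol_rat) auto
  define cof where "cof = (\<lambda>v. cofactor_top \<rho>0 (entry (base v)))"
  have cof: "cof \<in> ratfun m (\<lambda>v. v) D0" unfolding cof_def cofactor_top_def
  proof (rule ratfun_fun_det)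
    fix a b assume ab: "a < ord" "b < ord"
    show "(\<lambda>v. ((entry (base v))(\<rho>0 := (\<lambda>b. if b = ord - 1 then 1 else 0))) a b) \<in> ratfun m (\<lambda>v. v) D0"
      using entry_rat[OF ab] ratfun_const by (cases "a = \<rho>0") auto
  qed
  define dd where "dd = (\<lambda>v. fun_det ord (entry (base v)))"
  have dd: "dd \<in> ratfun m (\<lambda>v. v) D0" unfolding dd_def by (intro ratfun_fun_det entry_rat)
  define lc where "lc = (\<lambda>v. poly (coeff (base v) rL) (\<alpha> (branch \<rho>0)))"
  have lc: "lc \<in> ratfun m (\<lambda>v. v) D0" using jet_rat[of "\<alpha> (branch \<rho>0)" rL 0] by (simp add: lc_def jet_0)
  have lc0: "lc v \<noteq> 0" if "v \<in> D0" for v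
    using ops_jet[OF base_ops[OF that] b0(1)] by (simp add: lc_def jet_0)
  have slope: "slope \<rho>0 \<noteq> 0" by (rule slope_nonzero[OF \<rho>0])
  obtain p1 q1 where p1: "p1 \<in> polyfun m" "\<And>v. v \<in> D0 \<Longrightarrow> q1 v \<noteq> 0" "\<And>v. v \<in> D0 \<Longrightarrow> cof v * q1 v = p1 v"
    by (rule ratfunE[OF cof]) auto
  \<comment> \<open>The root of the determinant, which is affine in the size of the
    perturbation.\<close>
  define z where "z = (\<lambda>v. - (dd v * lc v) / (slope \<rho>0 * cof v))"
  define D1 where "D1 = {v \<in> D0. cof v \<noteq> 0}"
  have z: "z \<in> ratfun m (\<lambda>v. v) D1"
  proof -
    have "f \<in> ratfun m (\<lambda>v. v) D1" if "f \<in> ratfun m (\<lambda>v. v) D0" for f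
      using that by (rule ratfun_subset) (simp add: D1_def)
    note this[OF dd] this[OF lc] this[OF cof]
    moreover have "slope \<rho>0 * cof v \<noteq> 0" if "v \<in> D1" for v using that slope by (simp add: D1_def)
    ultimately show ?thesis
      unfolding z_def by (intro ratfun_divide ratfun_uminus ratfun_mult ratfun_const)
  qed
  define fam where "fam = (\<lambda>v. perturb \<rho>0 (z v) (base v))"
  have fam_ops: "fam v \<in> ops" if "v \<in> D0" for v unfolding fam_def by (rule perturb_ops[OF \<rho>0(1) base_ops[OF that]])
  have fam_fun_det: "fun_det ord (entry (fam v)) = 0" if "v \<in> D1" for v
  proof -
    have v: "v \<in> D0" "cof v \<noteq> 0" using that by (auto simp: D1_def)
    have "fun_det ord (entry (fam v)) = dd v + z v * slope \<rho>0 / lc v * cof v"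
      unfolding fam_def dd_def lc_def cof_def by (rule fun_det_perturb(1)[OF \<rho>0(1) base_ops[OF v(1)]])
    then show ?thesis using v lc0[OF v(1)] slope by (simp add: z_def)
  qed
  \<comment> \<open>Projects along the bump direction to the hyperplane with coordinate e0 equal to
    zero. The perturbation size drops out, so the parameters v are recovered whatever
    \<open>z v\<close> is.\<close>
  define \<tau> where "\<tau> = (\<lambda>l (y :: nat \<Rightarrow> 'k). y (idx l) - y e0 * cE (idx l))"
  have \<tau>: "\<tau> l \<in> polyfun ncoords" if "l < m" for l
    unfolding \<tau>_def using idx[OF that] e0 by (intro polyfun_diff pf_mult pf_var pf_const)
  have \<tau>fam: "\<tau> l (coords (fam v)) = v l" if "l < m" for l v
    using idx[OF that] e0 by (simp add: \<tau>_def fam_def coords_perturb coords_base cE0)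

  \<comment> \<open>Witnessed by projecting L0 along the bump: neither membership in
    \<open>ops\<close> nor the cofactor changes under the perturbation.\<close>
  have "\<exists>v. q0 v * p1 v \<noteq> 0"
  proof -
    define v0 where "v0 = (\<lambda>l. \<tau> l (coords L0))"
    have bv: "base v0 = perturb \<rho>0 (- coords L0 e0) L0"
    proof (rule ops_eqI)
      have po: "perturb \<rho>0 (- coords L0 e0) L0 \<in> ops" by (rule perturb_ops[OF \<rho>0(1) L0(1)])
      show "coeff (base v0) k = 0" if "k > rL" for k using that by (simp add: base_def poly_eq_iff coeff_op_of)
      show "coeff (perturb \<rho>0 (- coords L0 e0) L0) k = 0" if "k > rL" for k
        using po that by (intro coeff_eq_0) (simp add: ops_def)
      show "degree (coeff (base v0) k) \<le> dL" for k by (rule deg_base)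
      show "degree (coeff (perturb \<rho>0 (- coords L0 e0) L0) k) \<le> dL" for k using po by (simp add: ops_def)
      show "coords (base v0) l = coords (perturb \<rho>0 (- coords L0 e0) L0) l" if l: "l < ncoords" for l
        using unidx[OF l] by (auto simp: coords_base[OF l] coords_perturb cE0 v0_def \<tau>_def)
    qed
    then have "base v0 \<in> ops" using perturb_ops[OF \<rho>0(1) L0(1)] by simp
    then have q: "q0 v0 \<noteq> 0" by (auto simp: q0_def lc_prod_def ops_def)
    then have v0: "v0 \<in> D0" by (simp add: D0_def)
    have "cof v0 \<noteq> 0" using fun_det_perturb(2)[OF \<rho>0(1) L0(1)] cof0 by (simp add: cof_def bv)
    then have "p1 v0 \<noteq> 0" using p1(2,3)[OF v0] by auto
    then show ?thesis using q by auto
  qed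
  then obtain v1 where v1: "q0 v1 * p1 v1 \<noteq> 0" by blast
  \<comment> \<open>Degeneracy modulo \<open>x ^ (ord + 1)\<close> leaves only m - 1 parameters, so
    even the m projected coordinates satisfy a relation p; \<open>p v \<noteq> 0\<close> then makes
    \<open>fam v\<close> nondegenerate.\<close>
  obtain p w where p: "p \<in> polyfun m" "p w \<noteq> 0" "\<And>L. L \<in> degenerate (ord + 1) \<Longrightarrow> p (\<lambda>k. \<tau> k (coords L)) = 0"
    using degenerate_relation[of "ord + 1" m \<tau>] \<tau> mN ncoords_ge_2 by auto
  have q0p1: "(\<lambda>v. q0 v * p1 v) \<in> polyfun m" by (intro pf_mult q0 p1)
  define Q where "Q = (\<lambda>v. (q0 v * p1 v) * p v)"
  have Q: "Q \<in> polyfun m" unfolding Q_def by (intro pf_mult q0p1 p)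
  obtain v2 where "Q v2 \<noteq> 0"
    using polyfun_common_nonzero[OF q0p1 p(1) v1 p(2)] unfolding Q_def by (metis mult_eq_0_iff)
  have QD: "v \<in> D1" "p v \<noteq> 0" if "Q v \<noteq> 0" for v
  proof -
    have "v \<in> D0" using that by (auto simp: Q_def D0_def)
    moreover have "cof v \<noteq> 0" using that p1(3)[OF \<open>v \<in> D0\<close>] by (auto simp: Q_def)
    ultimately show "v \<in> D1" by (simp add: D1_def)
    show "p v \<noteq> 0" using that by (simp add: Q_def)
  qed
  have "irr_chain ncoords (coords ` S) m"
  proof (rule irr_chain_of_open_parametrization[OF Q \<open>Q v2 \<noteq> 0\<close>, where \<phi>="\<lambda>v. coords (fam v)" and \<tau>=\<tau>])
    show "(\<lambda>v. coords (fam v) l) \<in> ratfun m (\<lambda>u. u) {u. Q u \<noteq> 0}" if l: "l < ncoords" for l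
    proof -
      have "(\<lambda>v. coords (base v) l) \<in> ratfun m (\<lambda>v. v) D1"
        using l unfolding coords_def op_coords_def ncoords_def[symmetric] by (simp add: coeff_rat)
      then have "(\<lambda>v. coords (base v) l + z v * cE l) \<in> ratfun m (\<lambda>v. v) D1"
        by (intro ratfun_add ratfun_mult z ratfun_const)
      then have "(\<lambda>v. coords (fam v) l) \<in> ratfun m (\<lambda>v. v) D1" by (simp only: fam_def coords_perturb)
      then show ?thesis by (rule ratfun_subset) (use QD(1) in blast)
    qed
    show "\<tau> k \<in> polyfun ncoords" if "k < m" for k by (rule \<tau>[OF that])
    show "\<tau> k (coords (fam v)) = v k" if "k < m" for k v by (rule \<tau>fam[OF that])
    fix v assume v: "Q v \<noteq> 0"
    note v' = QD[OF v]
    have fo: "fam v \<in> ops" using v' fam_ops by (simp add: D1_def)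
    have "p (\<lambda>k. \<tau> k (coords (fam v))) = p v" by (rule polyfun_cong[OF p(1)]) (rule \<tau>fam)
    then have nd: "fam v \<notin> degenerate (ord + 1)" using p(3) v' by auto
    obtain c where "\<exists>\<rho><ord. c \<rho> \<noteq> 0" "\<And>s. s < ord \<Longrightarrow> (\<Sum>\<rho><ord. c \<rho> * entry (fam v) \<rho> s) = 0"
      using fam_fun_det[OF v'(1)] unfolding fun_det_eq_0_iff by blast
    then have "fam v \<in> S" using S[OF fo nd] by blast
    then show "coords (fam v) \<in> coords ` S" by blast
  qed
  then show ?thesis by (simp add: m_def)
qed

end

section \<open>Simple roots\<close>

lemma squarefree_no_double_root:
  fixes p :: "'k::field poly"
  assumes "squarefree p" "p = [:- a, 1:] * q" shows "poly q a \<noteq> 0"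
proof
  assume "poly q a = 0"
  then obtain s where "q = [:- a, 1:] * s" unfolding poly_eq_0_iff_dvd by blast
  then have "[:- a, 1:]\<^sup>2 dvd p" unfolding assms(2) by (simp add: power2_eq_square mult.assoc[symmetric] del: mult_pCons_left mult_pCons_right)
  then have "[:- a, 1:] dvd 1" using assms(1) by (rule squarefreeD[rotated])
  then show False using poly_eq_0_iff_dvd[of 1 a] by simp
qed

lemma ps_root_at_0:
  fixes P :: "'k::field_char_0 poly poly"
  assumes "is_ps_root P h" shows "poly (map_poly (\<lambda>c. poly c 0) P) (h $ 0) = 0"
  using assms bieval_nth_0[of P h] by (simp add: is_ps_root_def bieval_def)

text \<open>At x = 0 the root is simple, so already the constant term of P_y(x, h(x)) is
  nonzero.\<close>

lemma bieval_pderiv_nonzero: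
  fixes P :: "'k::field_char_0 poly poly"
  assumes "squarefree (map_poly (\<lambda>c. poly c 0) P)" "is_ps_root P h"
  shows "bieval (pderiv P) h \<noteq> 0"
proof -
  let ?P0 = "map_poly (\<lambda>c. poly c 0) P"
  obtain q where q: "?P0 = [:- (h $ 0), 1:] * q"
    using ps_root_at_0[OF assms(2)] unfolding poly_eq_0_iff_dvd by blast
  have "map_poly (\<lambda>c. poly c 0) (pderiv P) = pderiv ?P0"
    by (rule poly_eqI) (simp add: coeff_map_poly coeff_pderiv)
  then have "bieval (pderiv P) h $ 0 = poly (pderiv ([:- (h $ 0), 1:] * q)) (h $ 0)"
    by (simp add: bieval_nth_0 q del: mult_pCons_left)
  also have "\<dots> = poly q (h $ 0)" by (simp add: pderiv_mult pderiv_pCons del: mult_pCons_left)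
  finally show ?thesis using squarefree_no_double_root[OF assms(1) q] by auto
qed

text \<open>After y - h' is split off, a second lift of the same value would be a root of the
  cofactor, and P(0, y) would have a double root. This makes the branch points distinct.\<close>

lemma ps_roots_distinct_at_0:
  fixes P :: "'k::field_char_0 poly poly"
  assumes sf: "squarefree (map_poly (\<lambda>c. poly c 0) P)" and h: "is_ps_root P h" "is_ps_root P h'" and eq: "h $ 0 = h' $ 0"
  shows "h = h'"
proof (rule ccontr)
  assume ne: "h \<noteq> h'"
  define p where "p = map_poly fps_of_poly P"
  obtain q where q: "p = [:- h', 1:] * q" using h(2) unfolding is_ps_root_def p_def[symmetric] poly_eq_0_iff_dvd by blast
  have "(h - h') * poly q h = 0" using h(1) unfolding is_ps_root_def p_def[symmetric] q by (simp add: algebra_simps)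
  then have qh: "poly q h = 0" using ne by simp
  have ev: "poly r h $ 0 = poly (map_poly (\<lambda>c. c $ 0) r) (h $ 0)" for r
    by (induction r) (auto simp: map_poly_pCons)
  have "map_poly (\<lambda>c. poly c 0) P = map_poly (\<lambda>c. c $ 0) p"
    by (rule poly_eqI) (simp add: p_def coeff_map_poly poly_0_coeff_0)
  also have "\<dots> = [:- (h $ 0), 1:] * map_poly (\<lambda>c. c $ 0) q"
    unfolding q by (rule poly_eqI) (auto simp: coeff_map_poly eq coeff_pCons split: nat.split)
  finally have "poly (map_poly (\<lambda>c. c $ 0) q) (h $ 0) \<noteq> 0" by (rule squarefree_no_double_root[OF sf])
  then show False using ev[of q] qh by simp
qed

section \<open>Comparison of the two dimensions\<close>

theorem theorem18:
  fixes Cset :: "'k::field_char_0 set"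
    and P :: "'k poly poly"
    and g :: "nat \<Rightarrow> 'k fps"
    and rL dL :: nat
  assumes alg_closed: "\<And>p :: 'k poly. degree p > 0 \<Longrightarrow> \<exists>z. poly p z = 0"
    and C_subfield: "0 \<in> Cset" "1 \<in> Cset"
        "\<And>a b. a \<in> Cset \<Longrightarrow> b \<in> Cset \<Longrightarrow> a + b \<in> Cset"
        "\<And>a b. a \<in> Cset \<Longrightarrow> b \<in> Cset \<Longrightarrow> a * b \<in> Cset"
        "\<And>a. a \<in> Cset \<Longrightarrow> - a \<in> Cset"
        "\<And>a. a \<in> Cset \<Longrightarrow> inverse a \<in> Cset"
    and C_alg: "\<And>z. \<exists>q. q \<noteq> 0 \<and> (\<forall>i. coeff q i \<in> Cset) \<and> poly q z = 0"
    and P_over_C: "\<And>i j. coeff (coeff P i) j \<in> Cset"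
    and rP: "degree P > 1"
    and P_sqfree: "squarefree (map_poly to_fract P)"
    and P_no_y_divisor: "\<And>q :: 'k poly. map_poly (\<lambda>c. [:c:]) q dvd P \<Longrightarrow> degree q = 0"
    and S1: "squarefree (map_poly (\<lambda>c. poly c 0) P)"
            "degree (map_poly (\<lambda>c. poly c 0) P) = degree P"
    and G_roots: "\<And>i. i \<in> {1..degree P} \<Longrightarrow> is_ps_root P (g i)"
    and G_inj: "inj_on g {1..degree P}"
    and G_all: "\<And>h. is_ps_root P h \<Longrightarrow> \<exists>i\<in>{1..degree P}. h = g i"
    and G_beta: "\<And>i. i \<in> {2..degree P} \<Longrightarrow> g i $ 1 \<noteq> 0"
    and G_1: "g 1 $ 1 \<noteq> 0 \<or> g 1 $ 2 \<noteq> 0"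
    and rL: "rL \<ge> 1"
    and dL: "dL \<ge> (rL * degree P - rL + 1) * degree P"
  defines "V \<equiv> {L :: 'k poly poly. degree L = rL \<and> (\<forall>i. degree (coeff L i) \<le> dL)
                 \<and> (\<forall>i\<in>{1..degree P}. poly (lead_coeff L) (g i $ 0) \<noteq> 0)}"
  defines "X \<equiv> {L \<in> V. \<exists>M. is_min_op P L M \<and> apparent_sing_at0 M}"
  defines "Y \<equiv> {L \<in> V. \<exists>M. is_min_op P L M \<and> apparent_sing_at0 M
                 \<and> \<not> removable_at_cost M [:0, 1:] 1}"
  shows "op_dim rL dL X > op_dim rL dL Y"
proof -
  define \<alpha> where "\<alpha> = (\<lambda>i. g i $ 0)"
  define u where "u = (\<lambda>i. g i - fps_const (g i $ 0))"
  let ?rP = "degree P"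
  interpret branch_points \<alpha> u ?rP rL dL
  proof
    show "inj_on \<alpha> {1..?rP}"
    proof (rule inj_onI)
      fix i k assume ik: "i \<in> {1..?rP}" "k \<in> {1..?rP}" "\<alpha> i = \<alpha> k"
      have "g i = g k"
        by (rule ps_roots_distinct_at_0[OF S1(1) G_roots[OF ik(1)] G_roots[OF ik(2)]]) (use ik(3) in \<open>simp add: \<alpha>_def\<close>)
      then show "i = k" using inj_onD[OF G_inj] ik by blast
    qed
    show "2 \<le> ?rP" using rP by simp
    show "1 \<le> rL" "(rL * ?rP - rL + 1) * ?rP \<le> dL" using rL dL by auto
    show "u i $ 0 = 0" for i by (simp add: u_def)
    show "u i $ 1 \<noteq> 0" if "i \<in> {2..?rP}" for i using G_beta[OF that] by (simp add: u_def)
    show "u 1 $ 1 \<noteq> 0 \<or> u 1 $ 2 \<noteq> 0" using G_1 by (simp add: u_def)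
  qed
  have V: "V = ops" unfolding ops_def unfolding V_def \<alpha>_def by (rule refl)
  have annih: "\<exists>N. N \<noteq> 0 \<and> degree N \<le> ord \<and> annihilates_comp P L N" if L: "L \<in> ops" for L
  proof -
    have degL: "degree L = rL" using L by (simp add: ops_def)
    have "bieval (in_y (lead_coeff L)) h \<noteq> 0" if h: "is_ps_root P h" for h
    proof -
      obtain i where i: "i \<in> {1..?rP}" "h = g i" using G_all[OF h] by blast
      have "bieval (in_y (lead_coeff L)) h $ 0 = poly (lead_coeff L) (\<alpha> i)"
        unfolding bieval_in_y by (simp add: i \<alpha>_def poly_0_coeff_0[symmetric] poly_pcompose)
      then show ?thesis using L i(1) by (auto simp: ops_def)
    qed
    from annihilator_exists[OF _ _ bieval_pderiv_nonzero[OF S1(1)] this] show ?thesis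
      using rL rP degL by (simp add: ord_def)
  qed
  define w where "w = (\<lambda>L \<rho>. sol L (branch \<rho>) (cond \<rho>) oo u (branch \<rho>))"
  have w_entry: "w L \<rho> $ s = entry L \<rho> s" for L \<rho> s by (simp add: w_def entry_def)
  have w_sol: "op_apply_at M 0 (w L \<rho>) = 0" if "L \<in> ops" "annihilates_comp P L M" "\<rho> < ord" for L M \<rho>
    using that(2) G_roots[OF branch_cond(1)[OF that(3)]] sol_solution[OF that(1) branch_cond(1)[OF that(3)]]
    unfolding annihilates_comp_def w_def u_def \<alpha>_def by blast
  have indep: "\<forall>\<rho><ord. c \<rho> = 0" if L: "L \<in> ops" "L \<notin> degenerate (ord + 1)" and c: "(\<Sum>\<rho><ord. fps_const (c \<rho>) * w L \<rho>) = 0" for L c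
  proof (rule nondegenerate_independent[OF L])
    fix s
    show "(\<Sum>\<rho><ord. c \<rho> * entry L \<rho> s) = 0"
      using arg_cong[OF c, of "\<lambda>f. f $ s"] by (simp add: fps_sum_nth w_entry)
  qed
  \<comment> \<open>The upper bound comes from the constructed annihilator, the lower one from the
    \<open>ord\<close> independent solutions that any annihilator must have.\<close>
  have deg_min: "degree M = ord" if L: "L \<in> ops" "L \<notin> degenerate (ord + 1)" and M: "is_min_op P L M" for L M
  proof (rule antisym)
    show "degree M \<le> ord" using annih[OF L(1)] M unfolding is_min_op_def by (meson order.trans)
    show "ord \<le> degree M"
    proof (rule ccontr)
      assume "\<not> ?thesis"
      then have "degree M < card {..<ord}" by simp
      moreover have "M \<noteq> 0" "annihilates_comp P L M" using M by (auto simp: is_min_op_def)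
      ultimately obtain c where "\<exists>\<rho>\<in>{..<ord}. c \<rho> \<noteq> 0" "(\<Sum>\<rho><ord. fps_const (c \<rho>) * w L \<rho>) = 0"
        using solutions_linearly_dependent[of M "{..<ord}" "w L"] w_sol[OF L(1)] by auto
      then show False using indep[OF L] by auto
    qed
  qed
  have YD: "Y \<subseteq> degenerate (ord + 1)"
  proof
    fix L assume "L \<in> Y"
    then obtain M where L: "L \<in> ops" and M: "is_min_op P L M" and nr: "\<not> removable_at_cost M [:0, 1:] 1"
      by (auto simp: Y_def V)
    show "L \<in> degenerate (ord + 1)"
    proof (rule ccontr)
      assume nd: "L \<notin> degenerate (ord + 1)"
      note d = deg_min[OF L nd M]
      have "removable_at_cost M [:0, 1:] 1"
      proof (rule removable_if_independent[where I="{..<ord}" and w="w L"])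
        show "M \<noteq> 0" using M by (simp add: is_min_op_def)
        show "op_apply_at M 0 (w L \<rho>) = 0" if "\<rho> \<in> {..<ord}" for \<rho>
          using w_sol[OF L] M that by (simp add: is_min_op_def)
        show "\<forall>\<rho>\<in>{..<ord}. c \<rho> = 0" if "\<And>s. s \<le> degree M \<Longrightarrow> (\<Sum>\<rho><ord. c \<rho> * w L \<rho> $ s) = 0" for c
          using nondegenerate_independent[OF L nd, of c] that by (auto simp: d w_entry)
      qed (simp_all add: d)
      with nr show False by contradiction
    qed
  qed
  have "irr_chain ncoords (coords ` X) (ncoords - 1)"
  proof (rule irr_chain_singular_operators)
    fix L c
    assume L: "L \<in> ops" and nd: "L \<notin> degenerate (ord + 1)" and c: "\<exists>\<rho><ord. c \<rho> \<noteq> 0"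
      and rel: "\<And>s. s < ord \<Longrightarrow> (\<Sum>\<rho><ord. c \<rho> * entry L \<rho> s) = 0"
    obtain M where M: "is_min_op P L M" using annih[OF L] min_op_exists by blast
    note d = deg_min[OF L nd M]
    have Ma: "annihilates_comp P L M" using M by (simp add: is_min_op_def)
    define F where "F = (\<Sum>\<rho><ord. fps_const (c \<rho>) * w L \<rho>)"
    have "F \<noteq> 0" using indep[OF L nd, of c] c by (auto simp: F_def)
    moreover have "op_apply_at M 0 F = 0"
      by (simp add: F_def op_apply_at_sum op_apply_at_fps_const w_sol[OF L Ma])
    moreover have "F $ s = 0" if "s < ord" for s using rel[OF that] by (simp add: F_def fps_sum_nth w_entry)
    \<comment> \<open>F is a nonzero solution whose first \<open>ord\<close> coefficients vanish;
      regularity of M at 0 would force such a solution to be zero.\<close>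
    ultimately have "jet M 0 ord 0 = 0" using op_apply_at_unique[OF d, of 0 F] by blast
    then have "poly (lead_coeff M) 0 = 0" by (simp add: jet_0 d)
    moreover have "\<forall>i<degree M. op_apply_at M 0 (w L i) = 0" using w_sol[OF L Ma] d by simp
    moreover have "\<forall>c. (\<Sum>i<degree M. fps_const (c i) * w L i) = 0 \<longrightarrow> (\<forall>i<degree M. c i = 0)"
      using indep[OF L nd] d by simp
    ultimately have "apparent_sing_at0 M" unfolding apparent_sing_at0_def by blast
    then show "L \<in> X" using L M by (auto simp: X_def V)
  qed
  then have lower: "ereal (real (ncoords - 1)) \<le> op_dim rL dL X"
  proof -
    assume chain: "irr_chain ncoords (coords ` X) (ncoords - 1)"
    then obtain Z where "zirreducible_in ncoords (coords ` X) Z" unfolding irr_chain_def by blast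
    then have ne: "coords ` X \<noteq> {}" unfolding zirreducible_in_def zclosed_in_def by blast
    have "ereal (real (ncoords - 1)) \<le> (SUP n \<in> {n. irr_chain ncoords (coords ` X) n}. ereal (real n))"
      using chain by (intro SUP_upper) simp
    then show ?thesis using ne unfolding op_dim_def alg_dim_def coords_def ncoords_def by simp
  qed
  have upper: "op_dim rL dL Y < ereal (real (ncoords - 1))"
  proof (cases "coords ` Y = {}")
    \<comment> \<open>The empty set has dimension -1 by convention, still below ncoords - 1.\<close>
    case True
    have "ereal (- 1) < ereal (real (ncoords - 1))" by simp
    then have "(-1 :: ereal) < ereal (real (ncoords - 1))" by (simp add: one_ereal_def)
    then show ?thesis using True unfolding op_dim_def alg_dim_def coords_def ncoords_def by simp
  next
    case False
    have "(SUP n \<in> {n. irr_chain ncoords (coords ` Y) n}. ereal (real n)) \<le> ereal (real (ncoords - 2))"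
    proof (rule SUP_least)
      fix n assume "n \<in> {n. irr_chain ncoords (coords ` Y) n}"
      then have "n \<le> ncoords - 1 - (ord + 1 - ord)"
        using degenerate_dim_le[OF _ _ YD, of n] by simp
      then show "ereal (real n) \<le> ereal (real (ncoords - 2))" by simp
    qed
    also have "\<dots> < ereal (real (ncoords - 1))" using ncoords_ge_2 by simp
    finally show ?thesis using False unfolding op_dim_def alg_dim_def coords_def ncoords_def by simp
  qed
  show ?thesis using lower upper by (rule order.strict_trans2[rotated])
qed

end
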